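(* For every product measure $\mathbb P$ (i.i.d. couplings in $[0,1]$) and every $\lambda>0$, uniformly over $\mathbf n\in S^{d-1}$, $$\lim_{\beta\to+\infty}\frac{\tau^\lambda_\beta(\mathbf n)}{\beta}=\lambda J^{\min}\|\mathbf n\|_1.$$
   Context: Fix $d\ge 2$, $q\ge 1$; $\beta\ge 0$. For $x,y\in\mathbb Z^d$ write $x\sim y$ if $\|x-y\|_2=1$; for $\Lambda\subset\mathbb Z^d$ let $E(\Lambda)=\{\{x,y\}:x,y\in\Lambda,\ x\sim y\}$. The couplings $J=(J_e)_{e\in E(\mathbb Z^d)}$ are i.i.d. with values in $[0,1]$ under the product measure $\mathbb P$. $J^{\min}=\inf\{\lambda\ge0:\mathbb P(J_e<\lambda)>0\}$; $\|x\|_1=\sum_i|x_i|$. Random cluster model: for finite $E\subset E(\mathbb Z^d)$, boundary condition $\pi\in\{0,1\}^{E^c}$ and $\omega\in\{0,1\}^E$, $\Phi^{J,\pi,q}_{E,\beta}(\{\omega\})=\frac1Z\prod_{e\in E}p_e^{\omega_e}(1-p_e)^{1-\omega_e}\,q^{C^\pi_E(\omega)}$ with $p_e=1-e^{-\beta J_e}$, where $C^\pi_E(\omega)$ is the number of clusters of the set of vertices touched by $E$ when connections use the open edges of $\omega$ in $E$ and of $\pi$ outside $E$, and $Z$ is the normalizing constant. The boundary condition $w$ (wired) is $\pi\equiv1$. Geometry: $S^{d-1}$ is the Euclidean unit sphere. For $\mathbf n\in S^{d-1}$, $\mathbb S_{\mathbf n}$ is the set of the $(d-1)$-dimensional unit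 cubes $\{\sum_{k=1}^{d-1}t_k\mathbf u_k: t_k\in[-\frac12,\frac12]\}$ with $(\mathbf u_1,\dots,\mathbf u_{d-1},\mathbf n)$ an orthonormal basis of $\mathbb R^d$. $\mathcal R_{x,L,H}(\mathcal S,\mathbf n)=x+L\mathcal S+[-H,H]\mathbf n$. For such $\mathcal R$, $\hat{\mathcal R}$ is the set of points of $\mathbb Z^d$ in the interior of $\mathcal R$; $\partial\hat{\mathcal R}=\{y\in\hat{\mathcal R}:\exists z\in\mathbb Z^d\setminus\hat{\mathcal R},\ z\sim y\}$; $\partial^+\hat{\mathcal R}=\{y\in\partial\hat{\mathcal R}:(y-x)\cdot\mathbf n\ge0\}$, $\partial^-\hat{\mathcal R}=\{y\in\partial\hat{\mathcal R}:(y-x)\cdot\mathbf n<0\}$. $\Phi^{J,w}_{\mathcal R}$ is $\Phi^{J,w,q}_{E(\hat{\mathcal R}),\beta}$. Surface tension: $\mathcal D_{\mathcal R}$ is the event that no $\omega$-open path in $E(\hat{\mathcal R})$ joins $\partial^+\hat{\mathcal R}$ to $\partial^-\hat{\mathcal R}$, and $\tau^J_{\mathcal R}=-\frac1{L^{d-1}}\log\Phi^{J,w}_{\mathcal R}(\mathcal D_{\mathcal R})$. For constant couplings $J\equiv J^{\min}$, $\tau^J_{\mathcal R_{0,N,\delta N}(\mathcal S,\mathbf n)}$ converges as $N\to\infty$ to a limit $\tau^{\min}(\mathbf n)$ independent of $\delta>0$, $\mathcal S\in\mathbb S_{\mathbf n}$. Rate function: for $\tau>\tau^{\min}(\mathbf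 n)$, $I_{\mathbf n}(\tau)=\lim_{N}-\frac1{N^{d-1}}\log\mathbb P(\tau^J_{\mathcal R_{0,N,\delta N}(\mathcal S,\mathbf n)}\le\tau)\in[0,\infty)$ (it exists and does not depend on $\delta>0$, $\mathcal S\in\mathbb S_{\mathbf n}$); $I_{\mathbf n}(\tau)=+\infty$ for $\tau<\tau^{\min}(\mathbf n)$ and $I_{\mathbf n}(\tau^{\min}(\mathbf n))=\lim_{\varepsilon\to0^+}I_{\mathbf n}(\tau^{\min}(\mathbf n)+\varepsilon)$. Surface tension under averaged Gibbs measures: $\tau^\lambda_\beta(\mathbf n)=\inf_{\tau\in\mathbb R}\{\lambda\tau+I_{\mathbf n}(\tau)\}$, $\lambda>0$. *)

theory Defs
  imports "HOL-Probability.Probability"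
begin

section \<open>The lattice\<close>

definition lattice_point :: "int ^ 'd \<Rightarrow> real ^ 'd" where
  "lattice_point x = (\<chi> i. real_of_int (x $ i))"

definition adjacent :: "int ^ 'd \<Rightarrow> int ^ 'd \<Rightarrow> bool" where
  "adjacent x y \<longleftrightarrow> norm (lattice_point x - lattice_point y) = 1"

definition edges :: "(int ^ 'd) set \<Rightarrow> (int ^ 'd) set set" where
  "edges V = {{x, y} | x y. x \<in> V \<and> y \<in> V \<and> adjacent x y}"

definition norm1 :: "real ^ 'd \<Rightarrow> real" where
  "norm1 n = (\<Sum>i\<in>UNIV. \<bar>n $ i\<bar>)"

section \<open>Couplings\<close>

text \<open>
  The common law \<open>\<mu>\<close> of the couplings is a probability measure on the interval \<open>[0,1]\<close>.
\<close>

definition coupling_law :: "real measure \<Rightarrow> bool" where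
  "coupling_law \<mu> \<longleftrightarrow> prob_space \<mu> \<and> sets \<mu> = sets (restrict_space borel {0..1})"

definition coupling_measure :: "real measure \<Rightarrow> ((int ^ 'd) set \<Rightarrow> real) measure" where
  "coupling_measure \<mu> = PiM (edges UNIV) (\<lambda>_. \<mu>)"

definition J_min :: "real measure \<Rightarrow> real" where
  "J_min \<mu> = Inf {l. 0 \<le> l \<and> measure \<mu> {j \<in> space \<mu>. j < l} > 0}"

section \<open>The random cluster model\<close>

text \<open>
  A configuration \<open>\<omega> \<in> {0,1}\<^sup>E\<close> is identified with its set of open edges, a subset of \<open>E\<close>;
  likewise a boundary condition is the set of its open edges, a subset of the complement of \<open>E\<close>.
\<close>

definition connection :: "(int ^ 'd) set set \<Rightarrow> (int ^ 'd) rel" where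
  "connection F = {(x, y). {x, y} \<in> F}\<^sup>*"

definition num_clusters ::
    "(int ^ 'd) set set \<Rightarrow> (int ^ 'd) set set \<Rightarrow> (int ^ 'd) set set \<Rightarrow> nat" where
  "num_clusters E \<pi> \<omega> = card (\<Union>E // (connection (\<omega> \<union> \<pi>) \<inter> (\<Union>E \<times> \<Union>E)))"

definition edge_prob :: "real \<Rightarrow> ((int ^ 'd) set \<Rightarrow> real) \<Rightarrow> (int ^ 'd) set \<Rightarrow> real" where
  "edge_prob \<beta> J e = 1 - exp (- \<beta> * J e)"

definition rc_weight :: "real \<Rightarrow> real \<Rightarrow> ((int ^ 'd) set \<Rightarrow> real) \<Rightarrow> (int ^ 'd) set set \<Rightarrow>
    (int ^ 'd) set set \<Rightarrow> (int ^ 'd) set set \<Rightarrow> real" where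
  "rc_weight q \<beta> J E \<pi> \<omega> =
     (\<Prod>e\<in>E. if e \<in> \<omega> then edge_prob \<beta> J e else 1 - edge_prob \<beta> J e) * q ^ num_clusters E \<pi> \<omega>"

definition rc_prob :: "real \<Rightarrow> real \<Rightarrow> ((int ^ 'd) set \<Rightarrow> real) \<Rightarrow> (int ^ 'd) set set \<Rightarrow>
    (int ^ 'd) set set \<Rightarrow> (int ^ 'd) set set set \<Rightarrow> real" where
  "rc_prob q \<beta> J E \<pi> A =
     (\<Sum>\<omega>\<in>Pow E \<inter> A. rc_weight q \<beta> J E \<pi> \<omega>) / (\<Sum>\<omega>\<in>Pow E. rc_weight q \<beta> J E \<pi> \<omega>)"

definition wired :: "(int ^ 'd) set set \<Rightarrow> (int ^ 'd) set set" where
  "wired E = edges UNIV - E"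

section \<open>Geometry\<close>

definition unit_cubes :: "real ^ 'd \<Rightarrow> (real ^ 'd) set set" where
  "unit_cubes n =
     {{\<Sum>u\<in>B. t u *\<^sub>R u | t. \<forall>u\<in>B. - 1/2 \<le> t u \<and> t u \<le> 1/2} | B.
        n \<notin> B \<and> pairwise orthogonal (insert n B) \<and> (\<forall>u\<in>insert n B. norm u = 1) \<and>
        span (insert n B) = UNIV}"

definition cylinder ::
    "real ^ 'd \<Rightarrow> real \<Rightarrow> real \<Rightarrow> (real ^ 'd) set \<Rightarrow> real ^ 'd \<Rightarrow> (real ^ 'd) set" where
  "cylinder x L H S n = {x + L *\<^sub>R s + h *\<^sub>R n | s h. s \<in> S \<and> h \<in> {-H..H}}"

definition lattice_cylinder ::
    "real ^ 'd \<Rightarrow> real \<Rightarrow> real \<Rightarrow> (real ^ 'd) set \<Rightarrow> real ^ 'd \<Rightarrow> (int ^ 'd) set" where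
  "lattice_cylinder x L H S n = {z. lattice_point z \<in> interior (cylinder x L H S n)}"

definition inner_boundary :: "(int ^ 'd) set \<Rightarrow> (int ^ 'd) set" where
  "inner_boundary V = {y \<in> V. \<exists>z. z \<notin> V \<and> adjacent z y}"

definition upper_boundary ::
    "real ^ 'd \<Rightarrow> real \<Rightarrow> real \<Rightarrow> (real ^ 'd) set \<Rightarrow> real ^ 'd \<Rightarrow> (int ^ 'd) set" where
  "upper_boundary x L H S n =
     {y \<in> inner_boundary (lattice_cylinder x L H S n). (lattice_point y - x) \<bullet> n \<ge> 0}"

definition lower_boundary ::
    "real ^ 'd \<Rightarrow> real \<Rightarrow> real \<Rightarrow> (real ^ 'd) set \<Rightarrow> real ^ 'd \<Rightarrow> (int ^ 'd) set" where
  "lower_boundary x L H S n =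
     {y \<in> inner_boundary (lattice_cylinder x L H S n). (lattice_point y - x) \<bullet> n < 0}"

section \<open>Surface tension\<close>

definition disconnection ::
    "real ^ 'd \<Rightarrow> real \<Rightarrow> real \<Rightarrow> (real ^ 'd) set \<Rightarrow> real ^ 'd \<Rightarrow> (int ^ 'd) set set set" where
  "disconnection x L H S n =
     {\<omega>. \<omega> \<subseteq> edges (lattice_cylinder x L H S n) \<and>
         \<not> (\<exists>y\<in>upper_boundary x L H S n. \<exists>z\<in>lower_boundary x L H S n. (y, z) \<in> connection \<omega>)}"

definition surface_tension :: "real \<Rightarrow> real \<Rightarrow> ((int ^ 'd) set \<Rightarrow> real) \<Rightarrow>
    real ^ 'd \<Rightarrow> real \<Rightarrow> real \<Rightarrow> (real ^ 'd) set \<Rightarrow> real ^ 'd \<Rightarrow> real" where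
  "surface_tension q \<beta> J x L H S n =
     (let E = edges (lattice_cylinder x L H S n)
      in - (1 / L ^ (CARD('d) - 1)) * ln (rc_prob q \<beta> J E (wired E) (disconnection x L H S n)))"

text \<open>
  The minimal surface tension and the rate function are defined as limits common to all
  \<open>\<delta> > 0\<close> and all cubes \<open>S\<close>. The predicates below characterize them uniquely for a unit vector
  \<open>n\<close>: the limits of the sequences in question are unique, and \<open>unit_cubes n\<close> is nonempty.
\<close>

definition is_min_surface_tension ::
    "real \<Rightarrow> real \<Rightarrow> real measure \<Rightarrow> real ^ 'd \<Rightarrow> real \<Rightarrow> bool" where
  "is_min_surface_tension q \<beta> \<mu> n t \<longleftrightarrow>
     (\<forall>\<delta>>0. \<forall>S\<in>unit_cubes n.
        (\<lambda>N::nat. surface_tension q \<beta> (\<lambda>_. J_min \<mu>) 0 (real N) (\<delta> * real N) S n) \<longlonglongrightarrow> t)"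

definition neg_log :: "real \<Rightarrow> ereal" where
  "neg_log p = (if p = 0 then \<infinity> else ereal (- ln p))"

definition is_rate_function ::
    "real \<Rightarrow> real \<Rightarrow> real measure \<Rightarrow> real ^ 'd \<Rightarrow> real \<Rightarrow> (real \<Rightarrow> ereal) \<Rightarrow> bool" where
  "is_rate_function q \<beta> \<mu> n t_min I \<longleftrightarrow>
     (\<forall>t>t_min. 0 \<le> I t \<and> I t < \<infinity> \<and>
        (\<forall>\<delta>>0. \<forall>S\<in>unit_cubes n.
           (\<lambda>N::nat.
              neg_log (measure (coupling_measure \<mu>)
                {J \<in> space (coupling_measure \<mu>).
                   surface_tension q \<beta> J 0 (real N) (\<delta> * real N) S n \<le> t})
              / ereal (real N ^ (CARD('d) - 1))) \<longlonglongrightarrow> I t)) \<and>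
     (\<forall>t<t_min. I t = \<infinity>) \<and>
     ((\<lambda>\<epsilon>. I (t_min + \<epsilon>)) \<longlongrightarrow> I t_min) (at_right 0)"

text \<open>
  For a rate function in the above sense and \<open>\<lambda> > 0\<close> the infimum is finite: it is at least
  \<open>\<lambda> * t_min\<close>, and \<open>I t < \<infinity>\<close> whenever \<open>t > t_min\<close>. Hence \<open>real_of_ereal\<close> loses nothing here.
\<close>

definition averaged_surface_tension :: "real \<Rightarrow> (real \<Rightarrow> ereal) \<Rightarrow> real" where
  "averaged_surface_tension l I = real_of_ereal (INF t. ereal (l * t) + I t)"

end

theory Submission
  imports Defs
begin

text \<open>
  Write \<open>d = CARD('d)\<close>. The infimum that defines the averaged surface tension is at least
  \<open>l * tau_min \<beta> n\<close>, and at most \<open>l * t + I t\<close> for any \<open>t\<close>. The theorem follows by comparing both sides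
  with the size of the flat cut, the set of edges of the cylinder that cross the hyperplane
  orthogonal to \<open>n\<close> through the origin. In a cylinder of width \<open>N\<close> it has \<open>norm1 n * N ^ (d - 1)\<close> edges
  to leading order (\<open>card_flat_cut_asymp\<close>): its edges in direction \<open>i\<close> correspond to the lattice
  points in the projection of the base along \<open>i\<close>, whose area is \<open>\<bar>n $ i\<bar> * N ^ (d - 1)\<close>.

  Upper bound. Closing the flat cut disconnects the cylinder, and each edge is closed with conditional
  probability at least \<open>exp (- \<beta> * J e)\<close>. Hence the surface tension is at most
  \<open>\<beta> * (J_min + \<epsilon>) * norm1 n\<close> in the limit, once all couplings on the flat cut are below \<open>J_min + \<epsilon>\<close>.
  This event costs a bounded amount per unit area, whatever \<open>\<beta>\<close> is, so \<open>I t\<close> stays bounded for a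
  suitable \<open>t\<close> close to \<open>\<beta> * J_min * norm1 n\<close> (\<open>rate_function_le\<close>). Division by \<open>\<beta>\<close> removes this cost.

  Lower bound. For constant couplings \<open>j = J_min\<close> it suffices to show
  \<open>tau_min \<beta> n \<ge> \<beta> * j * norm1 n - C\<close> with \<open>C\<close> independent of \<open>\<beta>\<close> and \<open>n\<close> (\<open>min_surface_tension_ge\<close>).
  This is a Peierls argument. In a disconnected configuration, the clusters of the upper boundary
  are separated from the lower boundary by closed edges. Extended by the flat cut outside the cylinder,
  these contain a minimal cut of a large box (\<open>disconnection_interface\<close>). It has at least as many
  edges in the cylinder as the flat cut, because every lattice line through an edge of the flat cut
  has to be cut. A minimal cut is connected through plaquettes (\<open>interface_connected\<close>), since a mod
  two closed set of edges in a box is the boundary of a set of vertices. So the number of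
  cuts of a given size is at most exponential in the size, up to the number of possible
  roots (\<open>sum_rooted_connected_sets_le_card\<close>). Each prescribed edge is closed with conditional probability
  at most \<open>q * exp (- \<beta> * j)\<close>, and summation over the cuts gives the bound.
\<close>

section \<open>Edges of the integer lattice\<close>

lemma sum_squares_eq_one_int:
  fixes f :: "'d::finite \<Rightarrow> int"
  assumes "(\<Sum>k\<in>UNIV. (f k)\<^sup>2) = 1"
  obtains i where "f i = 1 \<or> f i = -1" "\<And>k. k \<noteq> i \<Longrightarrow> f k = 0"
proof -
  obtain i where i: "f i \<noteq> 0"
  proof (rule ccontr)
    assume "\<not> thesis"
    hence "(\<Sum>k\<in>UNIV. (f k)\<^sup>2) = 0" using that by (intro sum.neutral) auto
    thus False using assms by simp
  qed
  have split: "(f i)\<^sup>2 + (\<Sum>k\<in>UNIV - {i}. (f k)\<^sup>2) = 1"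
    using assms by (simp add: sum.remove[of UNIV i])
  have "(f i)\<^sup>2 \<ge> 1" using i by (simp add: int_one_le_iff_zero_less)
  moreover have "(\<Sum>k\<in>UNIV - {i}. (f k)\<^sup>2) \<ge> 0" by (simp add: sum_nonneg)
  ultimately have 1: "(f i)\<^sup>2 = 1" and 0: "(\<Sum>k\<in>UNIV - {i}. (f k)\<^sup>2) = 0"
    using split by linarith+
  have "f k = 0" if "k \<noteq> i" for k
    using 0 that by (subst (asm) sum_nonneg_eq_0_iff) auto
  moreover have "f i = 1 \<or> f i = -1" using 1 power2_eq_1_iff by blast
  ultimately show ?thesis using that by blast
qed

lemma adjacent_iff:
  fixes x y :: "int ^ 'd"
  shows "adjacent x y \<longleftrightarrow> (\<exists>i. y = x + axis i 1 \<or> x = y + axis i 1)"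
proof -
  have "norm (lattice_point x - lattice_point y) = 1 \<longleftrightarrow> (\<Sum>k\<in>UNIV. (real_of_int (x $ k - y $ k))\<^sup>2) = 1"
    by (simp add: norm_vec_def L2_set_def lattice_point_def)
  also have "\<dots> \<longleftrightarrow> (\<Sum>k\<in>UNIV. (x $ k - y $ k)\<^sup>2) = 1"
    by (metis (no_types, lifting) of_int_1 of_int_eq_iff of_int_power of_int_sum sum.cong)
  finally have *: "adjacent x y \<longleftrightarrow> (\<Sum>k\<in>UNIV. (x $ k - y $ k)\<^sup>2) = 1" by (simp add: adjacent_def)
  have one: "(\<Sum>k\<in>UNIV. (if k = i then 1 else 0)) = (1::int)" for i :: 'd by simp
  show ?thesis
  proof
    assume "adjacent x y"
    then obtain i where i: "x $ i - y $ i = 1 \<or> x $ i - y $ i = -1"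
      and k: "\<And>k. k \<noteq> i \<Longrightarrow> x $ k - y $ k = 0"
      using sum_squares_eq_one_int[of "\<lambda>k. x $ k - y $ k"] * by blast
    from i show "\<exists>i. y = x + axis i 1 \<or> x = y + axis i 1"
    proof
      assume "x $ i - y $ i = 1"
      hence "x = y + axis i 1" using k by (auto simp: vec_eq_iff axis_def)
      thus ?thesis by blast
    next
      assume "x $ i - y $ i = -1"
      hence "y = x + axis i 1" using k by (auto simp: vec_eq_iff axis_def)
      thus ?thesis by blast
    qed
  next
    assume "\<exists>i. y = x + axis i 1 \<or> x = y + axis i 1"
    then obtain i where "y = x + axis i 1 \<or> x = y + axis i 1" by blast
    hence "(x $ k - y $ k)\<^sup>2 = (if k = i then 1 else 0)" for k
      by (auto simp: axis_def)
    thus "adjacent x y" by (simp add: *)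
  qed
qed

lemma adjacent_sym: "adjacent x y \<longleftrightarrow> adjacent y x"
  by (auto simp: adjacent_iff)

lemma adjacent_step [simp]: "adjacent x (x + axis i 1)" "adjacent (x + axis i 1) x"
  by (auto simp: adjacent_iff)

lemma edges_mono: "V \<subseteq> W \<Longrightarrow> edges V \<subseteq> edges W"
  unfolding edges_def by blast

lemma edge_mem_iff: "{x, y} \<in> edges V \<longleftrightarrow> x \<in> V \<and> y \<in> V \<and> adjacent x y"
  by (auto simp: edges_def doubleton_eq_iff adjacent_sym)

lemma edges_eq_image: "edges V \<subseteq> (\<lambda>(x, i). {x, x + axis i 1}) ` (V \<times> UNIV)"
  by (force simp: edges_def adjacent_iff insert_commute)

lemma finite_edges: "finite V \<Longrightarrow> finite (edges V)"
  by (rule finite_subset[OF edges_eq_image]) auto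

lemma step_edge_eq_iff:
  "{x, x + axis i 1} = {y, y + axis j 1} \<longleftrightarrow> x = y \<and> i = (j :: 'd::finite)" for x y :: "int ^ 'd"
proof
  assume eq: "{x, x + axis i 1} = {y, y + axis j 1}"
  then consider "x = y" "x + axis i 1 = y + axis j 1"
    | "x = y + axis j 1" "x + axis i 1 = y" by (auto simp: doubleton_eq_iff)
  thus "x = y \<and> i = j"
  proof cases
    case 1 thus ?thesis by (simp add: axis_eq_axis)
  next
    case 2
    hence "axis j 1 $ i + axis i 1 $ i = (0::int)" by (metis add_cancel_right_right group_cancel.add1 vector_add_component zero_index)
    thus ?thesis by (simp add: axis_def split: if_splits)
  qed
qed auto

lemma lattice_point_step: "lattice_point (x + axis i 1) = lattice_point x + axis i 1"
  by (simp add: lattice_point_def vec_eq_iff axis_def)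

lemma finite_lattice_box: "finite {lo..hi :: int ^ 'd}"
  and card_lattice_box: "lo \<le> hi \<Longrightarrow> card {lo..hi} = (\<Prod>k\<in>UNIV. nat (hi $ k - lo $ k + 1))"
proof -
  have bij: "bij_betw vec_nth {lo..hi} (PiE UNIV (\<lambda>k. {lo $ k..hi $ k}))"
    by (rule bij_betw_byWitness[where f' = vec_lambda])
       (auto simp: less_eq_vec_def PiE_iff extensional_def)
  have "finite (PiE UNIV (\<lambda>k. {lo $ k..hi $ k}))" by (intro finite_PiE) auto
  thus "finite {lo..hi :: int ^ 'd}" using bij_betw_finite[OF bij] by simp
  show "card {lo..hi} = (\<Prod>k\<in>UNIV. nat (hi $ k - lo $ k + 1))" if "lo \<le> hi"
    using bij_betw_same_card[OF bij] by (simp add: card_PiE)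
qed

lemma lattice_box_iff: "x \<in> {lo..hi} \<longleftrightarrow> (\<forall>k. lo $ k \<le> x $ k \<and> x $ k \<le> hi $ k)" for x :: "int ^ 'd"
  by (auto simp: less_eq_vec_def)

section \<open>Gradients modulo two on boxes\<close>

text \<open>
  The first cohomology of a box with coefficients modulo two vanishes: \<open>f\<close> says which edges
  \<open>{x, x + axis i 1}\<close> are marked, and if every plaquette has an even number of marked edges, then
  the marked edges are exactly those on which some two-valued \<open>g\<close> changes. The induction removes
  the top layer of the box in a direction \<open>k\<close>. A potential on the smaller box extends to the removed
  layer along the edges in direction \<open>k\<close>, and the plaquettes that touch the layer make this
  extension correct on the edges inside the layer.
\<close>
lemma plaquette_closed_imp_potential:
  fixes f :: "int ^ 'd \<Rightarrow> 'd \<Rightarrow> bool"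
  assumes "\<And>x i j. i \<noteq> j \<Longrightarrow> x \<in> {lo..hi} \<Longrightarrow> x + axis i 1 + axis j 1 \<in> {lo..hi} \<Longrightarrow>
      (f x i = f (x + axis j 1) i) = (f x j = f (x + axis i 1) j)"
  shows "\<exists>g :: int ^ 'd \<Rightarrow> bool. \<forall>x i. x \<in> {lo..hi} \<longrightarrow> x + axis i 1 \<in> {lo..hi} \<longrightarrow> f x i = (g x \<noteq> g (x + axis i 1))"
  using assms
proof (induction "\<Sum>k\<in>UNIV. nat (hi $ k - lo $ k)" arbitrary: hi rule: less_induct)
  case less
  show ?case
  proof (cases "\<forall>k. hi $ k \<le> lo $ k")
    case True
    have "\<not> (x \<in> {lo..hi} \<and> x + axis i 1 \<in> {lo..hi})" for x i
    proof
      assume x: "x \<in> {lo..hi} \<and> x + axis i 1 \<in> {lo..hi}"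
      have "lo $ i \<le> x $ i"
        using x unfolding lattice_box_iff by blast
      moreover have "(x + axis i 1) $ i \<le> hi $ i"
        using x unfolding lattice_box_iff by blast
      hence "x $ i + 1 \<le> hi $ i" by (simp add: axis_def)
      ultimately
      show False using True[rule_format, of i] by linarith
    qed
    thus ?thesis by blast
  next
    case False
    then obtain k where k: "lo $ k < hi $ k" by (auto simp: not_le)
    define hi' where "hi' = hi - axis k 1"
    have hi': "hi' $ m = (if m = k then hi $ k - 1 else hi $ m)" for m
      by (simp add: hi'_def axis_def)
    have smaller: "(\<Sum>m\<in>UNIV. nat (hi' $ m - lo $ m)) < (\<Sum>m\<in>UNIV. nat (hi $ m - lo $ m))"
    proof (rule sum_strict_mono_ex1)
      show "\<exists>m\<in>UNIV. nat (hi' $ m - lo $ m) < nat (hi $ m - lo $ m)"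
        using k by (intro bexI[of _ k]) (simp_all add: hi')
    qed (simp_all add: hi')
    have sub: "x \<in> {lo..hi'} \<longleftrightarrow> x \<in> {lo..hi} \<and> x $ k < hi $ k" for x
    proof -
      have "x \<in> {lo..hi'} \<longleftrightarrow> (\<forall>m. lo $ m \<le> x $ m \<and> x $ m \<le> hi $ m \<and> (m = k \<longrightarrow> x $ k < hi $ k))"
      proof -
        have "(lo $ m \<le> x $ m \<and> x $ m \<le> hi' $ m) =
            (lo $ m \<le> x $ m \<and> x $ m \<le> hi $ m \<and> (m = k \<longrightarrow> x $ k < hi $ k))" for m
          using hi'[of m] by (cases "m = k") auto
        thus ?thesis unfolding lattice_box_iff by simp
      qed
      thus ?thesis unfolding lattice_box_iff by blast
    qed
    have "\<exists>g :: int ^ 'd \<Rightarrow> bool. \<forall>x i. x \<in> {lo..hi'} \<longrightarrow> x + axis i 1 \<in> {lo..hi'} \<longrightarrow> f x i = (g x \<noteq> g (x + axis i 1))"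
    proof (rule less.hyps[OF smaller])
      fix x and i j :: 'd
      assume "i \<noteq> j" "x \<in> {lo..hi'}" "x + axis i 1 + axis j 1 \<in> {lo..hi'}"
      thus "(f x i = f (x + axis j 1) i) = (f x j = f (x + axis i 1) j)"
        unfolding sub using less.prems[of i j x] by blast
    qed
    then obtain g :: "int ^ 'd \<Rightarrow> bool" where
      g_all: "\<forall>x i. x \<in> {lo..hi'} \<longrightarrow> x + axis i 1 \<in> {lo..hi'} \<longrightarrow> f x i = (g x \<noteq> g (x + axis i 1))" ..
    have g: "f x i = (g x \<noteq> g (x + axis i 1))" if "x \<in> {lo..hi'}" "x + axis i 1 \<in> {lo..hi'}" for x i
      using g_all that by simp
    \<comment> \<open>On the top layer the value is forced by the edge that leads down.\<close>
    define g' where "g' = (\<lambda>x. if x $ k < hi $ k then g x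
        else (g (x - axis k 1) \<noteq> f (x - axis k 1) k))"
    have "f x i = (g' x \<noteq> g' (x + axis i 1))"
      if x: "x \<in> {lo..hi}" and xi: "x + axis i 1 \<in> {lo..hi}" for x i
    proof (cases "x $ k < hi $ k")
      case lt: True
      hence x': "x \<in> {lo..hi'}" using x sub by blast
      show ?thesis
      proof (cases "(x + axis i 1) $ k < hi $ k")
        case True
        hence "x + axis i 1 \<in> {lo..hi'}" using xi sub by blast
        from g[OF x' this] show ?thesis using True lt by (simp only: g'_def if_True)
      next
        case False
        hence "i = k" using lt by (cases "k = i") (simp_all add: axis_def)
        thus ?thesis using False lt unfolding g'_def by (simp only: if_True if_False add_diff_cancel_right') blast
      qed
    next
      case top: False
      have xk: "x $ k = hi $ k" 
      proof -
        have "x $ k \<le> hi $ k" using x unfolding lattice_box_iff by blast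
        thus ?thesis using top by linarith
      qed
      have ik: "i \<noteq> k"
      proof
        assume "i = k"
        hence "(x + axis i 1) $ k = hi $ k + 1" using xk by (simp add: axis_def)
        moreover have "(x + axis i 1) $ k \<le> hi $ k" using xi unfolding lattice_box_iff by blast
        ultimately show False by linarith
      qed
      hence same: "(x + axis i 1) $ k = x $ k" by (simp add: axis_def)
      define y where "y = x - axis k 1"
      have ym: "y $ m = (if m = k then x $ m - 1 else x $ m)" for m
        by (simp add: y_def axis_def)
      have x_eq: "x = y + axis k 1" by (simp add: y_def)
      have yi_eq: "x + axis i 1 - axis k 1 = y + axis i 1" by (simp add: y_def)
      have corner: "y + axis i 1 + axis k 1 = x + axis i 1" by (simp add: y_def)
      have lox: "lo $ m \<le> x $ m" "x $ m \<le> hi $ m" for m using x unfolding lattice_box_iff by blast+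
      have "lo $ m \<le> y $ m \<and> y $ m \<le> hi $ m" for m
        using ym[of m] lox[of m] xk k by (cases "m = k") auto
      moreover have "y $ k < hi $ k" using ym[of k] xk by simp
      ultimately have y: "y \<in> {lo..hi'}"
        unfolding sub unfolding lattice_box_iff by blast
      have loxi: "lo $ m \<le> (x + axis i 1) $ m" "(x + axis i 1) $ m \<le> hi $ m" for m
        using xi unfolding lattice_box_iff by blast+
      have yim: "(y + axis i 1) $ m = (if m = k then x $ m - 1 else (x + axis i 1) $ m)" for m
        using ik by (simp add: ym axis_def)
      have "lo $ m \<le> (y + axis i 1) $ m \<and> (y + axis i 1) $ m \<le> hi $ m" for m
        using yim[of m] loxi[of m] lox[of m] xk k by (cases "m = k") auto
      moreover have "(y + axis i 1) $ k < hi $ k" using yim[of k] xk by simp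
      ultimately have yi: "y + axis i 1 \<in> {lo..hi'}"
        unfolding sub unfolding lattice_box_iff by blast
      have "(f y i = f (y + axis k 1) i) = (f y k = f (y + axis i 1) k)"
      proof (rule less.prems[OF ik])
        show "y \<in> {lo..hi}" using y sub by blast
        show "y + axis i 1 + axis k 1 \<in> {lo..hi}" unfolding corner by (rule xi)
      qed
      hence "(f y i = f x i) = (f y k = f (y + axis i 1) k)" unfolding x_eq[symmetric] .
      moreover have "g' x = (g y \<noteq> f y k)" using top by (simp add: g'_def y_def)
      moreover have "g' (x + axis i 1) = (g (y + axis i 1) \<noteq> f (y + axis i 1) k)"
        unfolding g'_def same yi_eq using top by (simp only: if_False)
      ultimately show ?thesis using g[OF y yi] by blast
    qed
    thus ?thesis by blast
  qed
qed

section \<open>Counting connected sets\<close>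

text \<open>
  The number of connected sets of size \<open>m\<close> through a given point \<open>r\<close> is at most exponential in \<open>m\<close>,
  by a percolation argument: among all subsets of \<open>V\<close>, at least the proportion \<open>1 / 2 ^ (Suc D * card G)\<close>
  contains \<open>G\<close> and misses the neighbours of \<open>G\<close>. For such a subset \<open>G\<close> is the component of \<open>r\<close>, so
  these families are disjoint for different \<open>G\<close>, and their proportions add up to at most one.
\<close>
lemma sum_connected_sets_le_one:
  fixes near :: "'e \<Rightarrow> 'e \<Rightarrow> bool"
  assumes fin: "finite V"
    and deg: "\<And>e. e \<in> V \<Longrightarrow> card {f \<in> V. near e f} \<le> D"
    and sub: "\<And>G. G \<in> \<G> \<Longrightarrow> G \<subseteq> V \<and> r \<in> G"
    and conn: "\<And>G P. G \<in> \<G> \<Longrightarrow> P \<subseteq> G \<Longrightarrow> P \<noteq> {} \<Longrightarrow> P \<noteq> G \<Longrightarrow> \<exists>e\<in>P. \<exists>f\<in>G - P. near e f"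
  shows "(\<Sum>G\<in>\<G>. (1 / 2 ^ Suc D) ^ card G) \<le> (1 :: real)"
proof -
  define N where "N = (\<lambda>G. {f \<in> V - G. \<exists>e\<in>G. near e f})"
  \<comment> \<open>The subsets of \<open>V\<close> in which \<open>G\<close> is the component of \<open>r\<close>.\<close>
  define cyl where "cyl = (\<lambda>G. {\<omega> \<in> Pow V. G \<subseteq> \<omega> \<and> \<omega> \<inter> N G = {}})"
  have fin\<G>: "finite \<G>" using sub fin by (meson Pow_iff finite_Pow_iff finite_subset subsetI)
  have disj: "cyl G \<inter> cyl G' = {}" if G: "G \<in> \<G>" "G' \<in> \<G>" "G \<noteq> G'" for G G'
  proof -
    have *: "cyl G \<inter> cyl G' = {}" if G: "G \<in> \<G>" "G' \<in> \<G>" "\<not> G \<subseteq> G'" for G G'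
    proof -
      have "G \<inter> G' \<noteq> {}" using sub G by blast
      then obtain e f where "e \<in> G \<inter> G'" "f \<in> G - G'" "near e f"
        using conn[OF G(1), of "G \<inter> G'"] G by blast
      moreover from this have "f \<in> V" using sub G by blast
      ultimately have "f \<in> N G'" "f \<in> G" by (auto simp: N_def)
      thus ?thesis by (auto simp: cyl_def)
    qed
    show ?thesis
    proof (cases "G \<subseteq> G'")
      case True
      hence "\<not> G' \<subseteq> G" using G by blast
      thus ?thesis using *[of G' G] G by blast
    qed (use *[of G G'] G in blast)
  qed
  have big: "2 ^ card V * (1 / 2 ^ Suc D) ^ card G \<le> real (card (cyl G))" if G: "G \<in> \<G>" for G
  proof -
    have GV: "G \<subseteq> V" and finG: "finite G" using sub[OF G] fin finite_subset by auto
    have NV: "N G \<subseteq> V - G" by (auto simp: N_def)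
    have "card (N G) \<le> card (\<Union>e\<in>G. {f \<in> V. near e f})"
      using fin finG GV by (intro card_mono) (auto simp: N_def)
    also have "\<dots> \<le> (\<Sum>e\<in>G. card {f \<in> V. near e f})" by (rule card_UN_le[OF finG])
    also have "\<dots> \<le> (\<Sum>e\<in>G. D)" using GV deg by (intro sum_mono) auto
    finally have cN: "card (N G) \<le> card G * D" by simp
    have cV: "card V = card G + card (N G) + card (V - G - N G)"
    proof -
      have "card (V - G - N G) = card V - card G - card (N G)"
        using fin finG NV GV by (simp add: card_Diff_subset finite_subset)
      moreover have "card (N G) \<le> card V - card G"
        using card_mono[OF _ NV] fin finG GV by (simp add: card_Diff_subset)
      moreover have "card G \<le> card V" using fin GV by (rule card_mono)
      ultimately show ?thesis by linarith
    qed
    have "(\<lambda>\<omega>. G \<union> \<omega>) ` Pow (V - G - N G) \<subseteq> cyl G"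
      using GV NV by (auto simp: cyl_def)
    moreover have "inj_on (\<lambda>\<omega>. G \<union> \<omega>) (Pow (V - G - N G))" by (rule inj_onI) blast
    moreover have "finite (cyl G)" using fin by (simp add: cyl_def)
    ultimately have "card (Pow (V - G - N G)) \<le> card (cyl G)" by (metis card_inj_on_le)
    hence c: "2 ^ card (V - G - N G) \<le> card (cyl G)" using fin by (simp add: card_Pow)
    have "card V \<le> card (V - G - N G) + Suc D * card G" using cV cN by (simp add: mult.commute)
    hence "(2::real) ^ card V \<le> 2 ^ card (V - G - N G) * (2 ^ Suc D) ^ card G"
      by (simp add: power_add[symmetric] power_mult[symmetric] del: power_Suc)
    hence "2 ^ card V * (1 / 2 ^ Suc D) ^ card G \<le> (2::real) ^ card (V - G - N G)"
      by (simp add: power_divide field_simps del: power_Suc)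
    also have "\<dots> \<le> real (card (cyl G))"
      using c by (metis of_nat_le_iff of_nat_numeral of_nat_power)
    finally show ?thesis .
  qed
  have "2 ^ card V * (\<Sum>G\<in>\<G>. (1 / 2 ^ Suc D) ^ card G) \<le> (\<Sum>G\<in>\<G>. real (card (cyl G)))"
    unfolding sum_distrib_left using big by (rule sum_mono)
  also have "\<dots> = real (card (\<Union>G\<in>\<G>. cyl G))"
    using fin\<G> fin disj by (subst card_UN_disjoint) (auto simp: cyl_def)
  also have "\<dots> \<le> real (card (Pow V))"
    using fin by (intro of_nat_mono card_mono) (auto simp: cyl_def)
  also have "\<dots> = 2 ^ card V" using fin by (simp add: card_Pow)
  finally show ?thesis by simp
qed

lemma sum_rooted_connected_sets_le_card:
  fixes near :: "'e \<Rightarrow> 'e \<Rightarrow> bool"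
  assumes fin: "finite V"
    and deg: "\<And>e. e \<in> V \<Longrightarrow> card {f \<in> V. near e f} \<le> D"
    and sub: "\<And>G. G \<in> \<G> \<Longrightarrow> G \<subseteq> V \<and> G \<noteq> {}"
    and conn: "\<And>G P. G \<in> \<G> \<Longrightarrow> P \<subseteq> G \<Longrightarrow> P \<noteq> {} \<Longrightarrow> P \<noteq> G \<Longrightarrow> \<exists>e\<in>P. \<exists>f\<in>G - P. near e f"
  shows "(\<Sum>G\<in>\<G>. (1 / 2 ^ Suc D) ^ card G) \<le> real (card V)"
proof -
  let ?w = "\<lambda>G :: 'e set. (1 / 2 ^ Suc D) ^ card G :: real"
  have fin\<G>: "finite \<G>" using sub fin by (meson Pow_iff finite_Pow_iff finite_subset subsetI)
  have "(\<Sum>G\<in>\<G>. ?w G) \<le> (\<Sum>G\<in>\<G>. \<Sum>r\<in>{r \<in> V. r \<in> G}. ?w G)"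
  proof (rule sum_mono)
    fix G assume "G \<in> \<G>"
    hence "{r \<in> V. r \<in> G} \<noteq> {}" using sub by blast
    hence "0 < card {r \<in> V. r \<in> G}" using fin by (simp add: card_gt_0_iff)
    hence "1 \<le> real (card {r \<in> V. r \<in> G})" by linarith
    hence "1 * ?w G \<le> real (card {r \<in> V. r \<in> G}) * ?w G" by (intro mult_right_mono) auto
    thus "?w G \<le> (\<Sum>r\<in>{r \<in> V. r \<in> G}. ?w G)" by simp
  qed
  also have "\<dots> = (\<Sum>r\<in>V. \<Sum>G\<in>{G \<in> \<G>. r \<in> G}. ?w G)"
    by (rule sum.swap_restrict[OF fin\<G> fin])
  also have "\<dots> \<le> (\<Sum>r\<in>V. 1)"
  proof (rule sum_mono)
    fix r assume "r \<in> V"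
    show "(\<Sum>G\<in>{G \<in> \<G>. r \<in> G}. ?w G) \<le> 1"
    proof (rule sum_connected_sets_le_one[OF fin deg])
      fix G P assume "G \<in> {G \<in> \<G>. r \<in> G}" "P \<subseteq> G" "P \<noteq> {}" "P \<noteq> G"
      thus "\<exists>e\<in>P. \<exists>f\<in>G - P. near e f" using conn[of G P] by simp
    qed (use sub in blast)+
  qed
  finally show ?thesis by simp
qed

section \<open>Connected interfaces in a box\<close>

definition component :: "(int ^ 'd) set \<Rightarrow> int ^ 'd \<Rightarrow> (int ^ 'd) set" where
  "component X a = {x. (a, x) \<in> {(u, v). u \<in> X \<and> v \<in> X \<and> adjacent u v}\<^sup>*}"

lemma component_self: "a \<in> component X a"
  by (simp add: component_def)

lemma component_subset: "a \<in> X \<Longrightarrow> component X a \<subseteq> X"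
  by (auto simp: component_def dest: rtranclD tranclD2)

lemma component_step:
  "x \<in> component X a \<Longrightarrow> x \<in> X \<Longrightarrow> y \<in> X \<Longrightarrow> adjacent x y \<Longrightarrow> y \<in> component X a"
  by (auto simp: component_def intro: rtrancl_into_rtrancl)

lemma component_const:
  assumes "x \<in> component X a"
    and "\<And>u v. u \<in> component X a \<Longrightarrow> v \<in> component X a \<Longrightarrow> adjacent u v \<Longrightarrow> u \<in> S \<longleftrightarrow> v \<in> S"
  shows "x \<in> S \<longleftrightarrow> a \<in> S"
proof -
  have "(a, x) \<in> {(u, v). u \<in> X \<and> v \<in> X \<and> adjacent u v}\<^sup>*" using assms(1) by (simp add: component_def)
  thus ?thesis
  proof (induction rule: rtrancl_induct)
    case (step y z)
    hence "y \<in> component X a" "z \<in> component X a"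
      by (auto simp: component_def intro: rtrancl_into_rtrancl)
    thus ?case using assms(2)[of y z] step by auto
  qed simp
qed

text \<open>
  Decreasing the distance to \<open>a\<close> in one coordinate at a time never leaves the box spanned by \<open>a\<close> and \<open>x\<close>.
\<close>
lemma component_hull:
  fixes a x :: "int ^ 'd"
  assumes "\<And>z. (\<And>k. min (a $ k) (x $ k) \<le> z $ k \<and> z $ k \<le> max (a $ k) (x $ k)) \<Longrightarrow> z \<in> X"
  shows "x \<in> component X a"
  using assms
proof (induction "\<Sum>k\<in>UNIV. nat \<bar>x $ k - a $ k\<bar>" arbitrary: x rule: less_induct)
  case less
  show ?case
  proof (cases "x = a")
    case True thus ?thesis by (simp add: component_self)
  next
    case False
    then obtain i where i: "x $ i \<noteq> a $ i" by (auto simp: vec_eq_iff)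
    define y where "y = (if x $ i < a $ i then x + axis i 1 else x - axis i 1)"
    have yk: "y $ k = (if k = i then (if x $ i < a $ i then x $ i + 1 else x $ i - 1) else x $ k)" for k
      by (simp add: y_def axis_def)
    have hull: "z \<in> X" if z: "\<And>k. min (a $ k) (y $ k) \<le> z $ k \<and> z $ k \<le> max (a $ k) (y $ k)" for z
    proof (rule less.prems)
      fix k show "min (a $ k) (x $ k) \<le> z $ k \<and> z $ k \<le> max (a $ k) (x $ k)"
        using z[of k] i by (auto simp: yk split: if_splits)
    qed
    have "y \<in> component X a"
      using i hull by (intro less.hyps sum_strict_mono_ex1) (auto simp: yk)
    moreover have "y \<in> X" using hull[of y] by auto
    moreover have "x \<in> X" using less.prems[of x] by auto
    moreover have "x = y + axis i 1 \<or> y = x + axis i 1" by (auto simp: y_def)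
    hence "adjacent y x" by (auto simp: adjacent_iff)
    ultimately show ?thesis by (blast intro: component_step)
  qed
qed

text \<open>
  Two edges of a common plaquette are near, and an edge has boundedly many edges near to it. Allowing
  a unit cube in place of a plaquette makes the second property easy and costs only a constant.
\<close>
definition near :: "(int ^ 'd) set \<Rightarrow> (int ^ 'd) set \<Rightarrow> bool" where
  "near e f \<longleftrightarrow> (\<exists>z. \<forall>v\<in>e \<union> f. \<forall>k. z $ k \<le> v $ k \<and> v $ k \<le> z $ k + 1)"

lemma near_degree:
  fixes W :: "(int ^ 'd) set"
  assumes "e \<in> edges W"
  shows "card {f \<in> edges W. near e f} \<le> 2 ^ (3 ^ CARD('d))"
proof -
  obtain x where x: "x \<in> e" using assms by (auto simp: edges_def)
  let ?C = "{x - 1..x + 1}"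
  have "{f \<in> edges W. near e f} \<subseteq> Pow ?C"
  proof (intro subsetI PowI, elim CollectE conjE)
    fix f v assume "near e f" "v \<in> f"
    then obtain z where z: "\<And>u k. u \<in> e \<union> f \<Longrightarrow> z $ k \<le> u $ k \<and> u $ k \<le> z $ k + 1"
      unfolding near_def by blast
    have "x $ k - 1 \<le> v $ k \<and> v $ k \<le> x $ k + 1" for k
      using z[of x k] z[of v k] x \<open>v \<in> f\<close> by auto
    thus "v \<in> ?C" by (auto simp: less_eq_vec_def)
  qed
  hence "card {f \<in> edges W. near e f} \<le> card (Pow ?C)"
    using finite_lattice_box by (intro card_mono) auto
  also have "\<dots> = 2 ^ card ?C" using finite_lattice_box by (rule card_Pow)
  also have "card ?C = 3 ^ CARD('d)"
    by (subst card_lattice_box) (auto simp: less_eq_vec_def)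
  finally show ?thesis .
qed

text \<open>
  Both sides of the interface are components: the inner side of \<open>a\<close> within \<open>X\<close>, then the outer
  side of \<open>b\<close> within all that is left. Components of the complement that do not contain \<open>b\<close> are
  thereby filled in, so that the interface is a minimal cut between \<open>a\<close> and \<open>b\<close>.
\<close>
definition inner_side where "inner_side W X a = component (W \<inter> X) a"
definition outer_side where "outer_side W X a b = component (W - inner_side W X a) b"
definition interface :: "(int ^ 'd) set \<Rightarrow> (int ^ 'd) set \<Rightarrow> int ^ 'd \<Rightarrow> int ^ 'd \<Rightarrow> (int ^ 'd) set set" where
  "interface W X a b = {{u, v} | u v. u \<in> inner_side W X a \<and> v \<in> outer_side W X a b \<and> adjacent u v}"

lemma
  assumes "a \<in> W" "a \<in> X" "b \<in> W" "b \<notin> X"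
  shows inner_side_subset: "inner_side W X a \<subseteq> W \<inter> X"
    and outer_side_subset: "outer_side W X a b \<subseteq> W - inner_side W X a"
  using assms component_subset[of a "W \<inter> X"] component_subset[of b "W - inner_side W X a"]
  by (auto simp: inner_side_def outer_side_def)

lemma interface_step:
  assumes ab: "a \<in> W" "a \<in> X" "b \<in> W" "b \<notin> X"
    and uv: "{u, v} \<in> interface W X a b"
  shows "adjacent u v" "u \<in> W" "v \<in> W" "(u \<in> X \<and> v \<notin> X) \<or> (v \<in> X \<and> u \<notin> X)"
proof -
  have *: "adjacent u v \<and> u \<in> W \<and> v \<in> W \<and> u \<in> X \<and> v \<notin> X"
    if uv: "u \<in> inner_side W X a" "v \<in> outer_side W X a b" "adjacent u v" for u v
  proof -
    have u: "u \<in> W" "u \<in> X" and v: "v \<in> W" "v \<notin> inner_side W X a"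
      using uv inner_side_subset[OF ab] outer_side_subset[OF ab] by auto
    moreover have "v \<notin> X"
      using component_step[of u "W \<inter> X" a v] uv u v by (auto simp: inner_side_def)
    ultimately show ?thesis using uv by simp
  qed
  obtain u' v' where "{u, v} = {u', v'}" "u' \<in> inner_side W X a" "v' \<in> outer_side W X a b" "adjacent u' v'"
    using uv by (auto simp: interface_def)
  with *[of u' v'] show "adjacent u v" "u \<in> W" "v \<in> W" "(u \<in> X \<and> v \<notin> X) \<or> (v \<in> X \<and> u \<notin> X)"
    by (auto simp: doubleton_eq_iff adjacent_sym)
qed

text \<open>
  The interface is the whole edge boundary of the outer side: a vertex next to the outer side that is
  not on the inner side would belong to the outer component.
\<close>
lemma interface_iff:
  assumes ab: "a \<in> W" "a \<in> X" "b \<in> W" "b \<notin> X"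
    and uv: "u \<in> W" "v \<in> W" "adjacent u v"
  shows "{u, v} \<in> interface W X a b \<longleftrightarrow> (u \<in> outer_side W X a b) \<noteq> (v \<in> outer_side W X a b)"
proof -
  have *: "u \<in> inner_side W X a"
    if uv: "u \<in> W" "v \<in> W" "adjacent u v" "u \<notin> outer_side W X a b" "v \<in> outer_side W X a b" for u v
  proof (rule ccontr)
    assume "u \<notin> inner_side W X a"
    hence "u \<in> W - inner_side W X a" using uv by blast
    moreover have "v \<in> W - inner_side W X a" using uv outer_side_subset[OF ab] by blast
    ultimately have "u \<in> outer_side W X a b"
      using component_step[of v "W - inner_side W X a" b u] uv
      by (simp add: outer_side_def adjacent_sym)
    thus False using uv by simp
  qed
  have "(u \<in> outer_side W X a b) \<noteq> (v \<in> outer_side W X a b)" if "{u, v} \<in> interface W X a b"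
    using that outer_side_subset[OF ab] by (auto simp: interface_def doubleton_eq_iff)
  moreover have "{u, v} \<in> interface W X a b"
    if d: "(u \<in> outer_side W X a b) \<noteq> (v \<in> outer_side W X a b)"
  proof (cases "u \<in> outer_side W X a b")
    case True
    hence "v \<in> inner_side W X a" using *[of v u] uv d by (simp add: adjacent_sym)
    moreover have "{u, v} = {v, u}" "adjacent v u" using uv by (auto simp: adjacent_sym)
    ultimately show ?thesis using True unfolding interface_def by blast
  next
    case False
    hence "u \<in> inner_side W X a" using *[of u v] uv d by simp
    thus ?thesis using False d uv unfolding interface_def by blast
  qed
  ultimately show ?thesis by blast
qed

text \<open>
  A minimal cut of a box is connected through plaquettes. Suppose that no edge of \<open>P\<close> is near an edge
  of the rest of the interface. The interface is an edge boundary and therefore has an even number of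
  edges in each plaquette; a plaquette that meets \<open>P\<close> has all its interface edges in \<open>P\<close>, so \<open>P\<close> has
  the same parity property. Hence \<open>P\<close> consists of the edges on which some \<open>g\<close> changes. The inner
  and the outer side are connected by edges outside the interface, so \<open>g\<close> is constant on both, and
  either all or none of the interface edges belong to \<open>P\<close>.
\<close>
lemma interface_connected:
  fixes lo hi :: "int ^ 'd"
  assumes ab: "a \<in> {lo..hi}" "a \<in> X" "b \<in> {lo..hi}" "b \<notin> X"
    and P: "P \<subseteq> interface {lo..hi} X a b" "P \<noteq> {}" "P \<noteq> interface {lo..hi} X a b"
  shows "\<exists>e\<in>P. \<exists>f\<in>interface {lo..hi} X a b - P. near e f"
proof (rule ccontr)
  assume not_near: "\<not> ?thesis"
  let ?W = "{lo..hi}"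
  let ?G = "interface ?W X a b"
  let ?A = "inner_side ?W X a"
  let ?B = "outer_side ?W X a b"
  have between: "z \<in> ?W" if "x \<in> ?W" "y \<in> ?W" "\<And>k. x $ k \<le> z $ k \<and> z $ k \<le> y $ k" for x y z
    using that unfolding lattice_box_iff by (meson order_trans)
  have "\<exists>g :: int ^ 'd \<Rightarrow> bool. \<forall>x i. x \<in> ?W \<longrightarrow> x + axis i 1 \<in> ?W \<longrightarrow> ({x, x + axis i 1} \<in> P) = (g x \<noteq> g (x + axis i 1))"
  proof (rule plaquette_closed_imp_potential)
    fix x :: "int ^ 'd" and i j :: 'd
    assume ij: "i \<noteq> j" and x: "x \<in> ?W" and xij: "x + axis i 1 + axis j 1 \<in> ?W"
    have xi: "x + axis i 1 \<in> ?W" by (rule between[OF x xij]) (simp add: axis_def)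
    have xj: "x + axis j 1 \<in> ?W" by (rule between[OF x xij]) (simp add: axis_def)
    have xij': "x + axis j 1 + axis i 1 \<in> ?W" using xij by (simp add: algebra_simps)
    have comm: "x + axis j 1 + axis i 1 = x + axis i 1 + axis j 1" by (simp add: algebra_simps)
    let ?E = "{{x, x + axis i 1}, {x + axis j 1, x + axis j 1 + axis i 1},
      {x, x + axis j 1}, {x + axis i 1, x + axis i 1 + axis j 1}}"
    have nr: "near e f" if "e \<in> ?E" "f \<in> ?E" for e f
      unfolding near_def by (rule exI[of _ x]) (use that ij in \<open>auto simp: axis_def\<close>)
    have "({x, x + axis i 1} \<in> ?G) = ((x \<in> ?B) \<noteq> (x + axis i 1 \<in> ?B))"
      "({x, x + axis j 1} \<in> ?G) = ((x \<in> ?B) \<noteq> (x + axis j 1 \<in> ?B))"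
      "({x + axis j 1, x + axis j 1 + axis i 1} \<in> ?G) = ((x + axis j 1 \<in> ?B) \<noteq> (x + axis j 1 + axis i 1 \<in> ?B))"
      "({x + axis i 1, x + axis i 1 + axis j 1} \<in> ?G) = ((x + axis i 1 \<in> ?B) \<noteq> (x + axis i 1 + axis j 1 \<in> ?B))"
      using interface_iff[OF ab x xi] interface_iff[OF ab x xj] interface_iff[OF ab xj xij']
        interface_iff[OF ab xi xij] adjacent_step(1) by blast+
    hence parity: "(({x, x + axis i 1} \<in> ?G) = ({x + axis j 1, x + axis j 1 + axis i 1} \<in> ?G)) =
        (({x, x + axis j 1} \<in> ?G) = ({x + axis i 1, x + axis i 1 + axis j 1} \<in> ?G))"
      unfolding comm by blast
    show "(({x, x + axis i 1} \<in> P) = ({x + axis j 1, x + axis j 1 + axis i 1} \<in> P)) =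
        (({x, x + axis j 1} \<in> P) = ({x + axis i 1, x + axis i 1 + axis j 1} \<in> P))"
    proof (cases "\<exists>e\<in>?E. e \<in> P")
      case True
      then obtain e where e: "e \<in> ?E" "e \<in> P" by blast
      have "f \<in> P \<longleftrightarrow> f \<in> ?G" if "f \<in> ?E" for f
        using not_near nr[OF e(1) that] e(2) P(1) by blast
      thus ?thesis using parity by simp
    next
      case False
      thus ?thesis by simp
    qed
  qed
  then obtain g :: "int ^ 'd \<Rightarrow> bool" where g_all: "\<forall>x i. x \<in> ?W \<longrightarrow> x + axis i 1 \<in> ?W \<longrightarrow>
      ({x, x + axis i 1} \<in> P) = (g x \<noteq> g (x + axis i 1))" ..
  have g: "({x, x + axis i 1} \<in> P) = (g x \<noteq> g (x + axis i 1))"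
    if "x \<in> ?W" "x + axis i 1 \<in> ?W" for x i using g_all that by blast
  have gP: "({x, y} \<in> P) = (g x \<noteq> g y)" if xy: "x \<in> ?W" "y \<in> ?W" "adjacent x y" for x y
  proof -
    obtain i where "y = x + axis i 1 \<or> x = y + axis i 1" using xy adjacent_iff by blast
    thus ?thesis
    proof
      assume y: "y = x + axis i 1"
      show ?thesis using g[of x i] xy unfolding y by blast
    next
      assume x: "x = y + axis i 1"
      have "{x, y} = {y, y + axis i 1}" using x by blast
      moreover have "({y, y + axis i 1} \<in> P) = (g y \<noteq> g x)" using g[of y i] xy unfolding x by blast
      ultimately show ?thesis by metis
    qed
  qed
  have A: "x \<in> ?W" if "x \<in> ?A" for x using that inner_side_subset[OF ab] by blast
  have B: "x \<in> ?W" "x \<notin> ?A" if "x \<in> ?B" for x using that outer_side_subset[OF ab] by blast+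
  have gA: "g x = g a" if "x \<in> ?A" for x
  proof -
    have "x \<in> Collect g \<longleftrightarrow> a \<in> Collect g"
    proof (rule component_const[of x "?W \<inter> X" a])
      show "x \<in> component (?W \<inter> X) a" using that by (simp add: inner_side_def)
      fix u v assume "u \<in> component (?W \<inter> X) a" "v \<in> component (?W \<inter> X) a" "adjacent u v"
      hence uv: "u \<in> ?A" "v \<in> ?A" "adjacent u v" by (simp_all add: inner_side_def)
      have "{u, v} \<notin> ?G" using interface_iff[OF ab, of u v] uv A B by blast
      hence "{u, v} \<notin> P" using P(1) by blast
      thus "u \<in> Collect g \<longleftrightarrow> v \<in> Collect g" using gP[of u v] uv A unfolding mem_Collect_eq by blast
    qed
    thus ?thesis by simp
  qed
  have gB: "g x = g b" if "x \<in> ?B" for x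
  proof -
    have "x \<in> Collect g \<longleftrightarrow> b \<in> Collect g"
    proof (rule component_const[of x "?W - ?A" b])
      show "x \<in> component (?W - ?A) b" using that by (simp add: outer_side_def)
      fix u v assume "u \<in> component (?W - ?A) b" "v \<in> component (?W - ?A) b" "adjacent u v"
      hence uv: "u \<in> ?B" "v \<in> ?B" "adjacent u v" by (simp_all add: outer_side_def)
      have "{u, v} \<notin> ?G" using interface_iff[OF ab, of u v] uv B by blast
      hence "{u, v} \<notin> P" using P(1) by blast
      thus "u \<in> Collect g \<longleftrightarrow> v \<in> Collect g" using gP[of u v] uv B unfolding mem_Collect_eq by blast
    qed
    thus ?thesis by simp
  qed
  have G_iff: "{u, v} \<in> P \<longleftrightarrow> g a \<noteq> g b" if "u \<in> ?A" "v \<in> ?B" "adjacent u v" for u v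
    using gP[of u v] that A[of u] B(1)[of v] gA[of u] gB[of v] by metis
  obtain e where "e \<in> P" using P by blast
  moreover from this obtain u v where "e = {u, v}" "u \<in> ?A" "v \<in> ?B" "adjacent u v"
    using P(1) unfolding interface_def by blast
  ultimately have ne: "g a \<noteq> g b" using G_iff by blast
  have "?G \<subseteq> P"
  proof
    fix f assume "f \<in> ?G"
    then obtain u v where "f = {u, v}" "u \<in> ?A" "v \<in> ?B" "adjacent u v"
      unfolding interface_def by blast
    thus "f \<in> P" using G_iff ne by blast
  qed
  thus False using P by blast
qed

section \<open>The flat cut and the interface of a disconnected configuration\<close>

definition above :: "real ^ 'd \<Rightarrow> (int ^ 'd) set" where
  "above n = {x. lattice_point x \<bullet> n \<ge> 0}"

definition crossings :: "real ^ 'd \<Rightarrow> (int ^ 'd) set \<Rightarrow> 'd \<Rightarrow> (int ^ 'd) set" where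
  "crossings n V i = {x \<in> V. x + axis i 1 \<in> V \<and> (x \<in> above n \<longleftrightarrow> x + axis i 1 \<notin> above n)}"

definition flat_cut :: "real ^ 'd \<Rightarrow> (int ^ 'd) set \<Rightarrow> (int ^ 'd) set set" where
  "flat_cut n V = {{x, y} | x y. x \<in> V \<and> y \<in> V \<and> adjacent x y \<and> x \<in> above n \<and> y \<notin> above n}"

lemma lattice_point_inner: "lattice_point x \<bullet> n = (\<Sum>k\<in>UNIV. real_of_int (x $ k) * n $ k)"
  by (simp add: inner_vec_def lattice_point_def)

lemma lattice_point_step_inner: "lattice_point (x + axis i 1) \<bullet> n = lattice_point x \<bullet> n + n $ i"
  by (simp add: lattice_point_step inner_add_left inner_axis')

lemma flat_cut_subset: "flat_cut n V \<subseteq> edges V"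
  unfolding flat_cut_def edges_def by blast

lemma finite_crossings: "finite V \<Longrightarrow> finite (crossings n V i)"
  by (simp add: crossings_def)

lemma flat_cut_eq_image:
  "flat_cut n V = (\<lambda>(i, x). {x, x + axis i 1}) ` (SIGMA i:UNIV. crossings n V i)"
proof (intro equalityI subsetI)
  fix e assume "e \<in> flat_cut n V"
  then obtain x y where e: "e = {x, y}" and xy: "x \<in> V" "y \<in> V" "adjacent x y" "x \<in> above n" "y \<notin> above n"
    unfolding flat_cut_def by blast
  from xy(3) obtain i where "y = x + axis i 1 \<or> x = y + axis i 1" by (auto simp: adjacent_iff)
  thus "e \<in> (\<lambda>(i, x). {x, x + axis i 1}) ` (SIGMA i:UNIV. crossings n V i)"
  proof
    assume "y = x + axis i 1"
    thus ?thesis using e xy by (intro image_eqI[of _ _ "(i, x)"]) (auto simp: crossings_def)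
  next
    assume "x = y + axis i 1"
    thus ?thesis using e xy by (intro image_eqI[of _ _ "(i, y)"]) (auto simp: crossings_def)
  qed
next
  fix e assume "e \<in> (\<lambda>(i, x). {x, x + axis i 1}) ` (SIGMA i:UNIV. crossings n V i)"
  then obtain i x where e: "e = {x, x + axis i 1}" and x: "x \<in> V" "x + axis i 1 \<in> V"
      "x \<in> above n \<longleftrightarrow> x + axis i 1 \<notin> above n"
    by (auto simp: crossings_def)
  show "e \<in> flat_cut n V"
  proof (cases "x \<in> above n")
    case True
    thus ?thesis unfolding flat_cut_def e using x adjacent_step(1) by blast
  next
    case False
    moreover have "e = {x + axis i 1, x}" by (simp add: e insert_commute)
    ultimately show ?thesis unfolding flat_cut_def using x adjacent_step(2) by blast
  qed
qed

lemma card_flat_cut: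
  assumes "finite V"
  shows "card (flat_cut n V) = (\<Sum>i\<in>UNIV. card (crossings n V i))"
proof -
  have "inj_on (\<lambda>(i, x). {x, x + axis i 1}) (SIGMA i:UNIV. crossings n V i)"
    by (rule inj_onI) (auto simp: step_edge_eq_iff)
  hence "card (flat_cut n V) = card (SIGMA i:UNIV. crossings n V i)"
    unfolding flat_cut_eq_image by (rule card_image)
  also have "\<dots> = (\<Sum>i\<in>UNIV. card (crossings n V i))"
    using assms finite_crossings by (intro card_SigmaI) auto
  finally show ?thesis .
qed

text \<open>
  Along a lattice line in direction \<open>i\<close> the height above the hyperplane is monotone, so it changes its
  sign only once.
\<close>
lemma crossing_unique:
  assumes x: "x \<in> above n \<longleftrightarrow> x + axis i 1 \<notin> above n"
    and y: "y \<in> above n \<longleftrightarrow> y + axis i 1 \<notin> above n"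
    and off: "\<And>k. k \<noteq> i \<Longrightarrow> y $ k = x $ k"
  shows "y = x"
proof -
  define t where "t = y $ i - x $ i"
  have "lattice_point y \<bullet> n - lattice_point x \<bullet> n = (\<Sum>k\<in>UNIV. real_of_int (y $ k - x $ k) * n $ k)"
    by (simp add: lattice_point_inner sum_subtractf algebra_simps)
  also have "\<dots> = (\<Sum>k\<in>UNIV. if k = i then real_of_int t * n $ i else 0)"
    using off by (intro sum.cong) (auto simp: t_def)
  finally have yx: "lattice_point y \<bullet> n = lattice_point x \<bullet> n + real_of_int t * n $ i" by simp
  have "t = 0"
  proof (rule ccontr)
    assume "t \<noteq> 0"
    hence "1 \<le> real_of_int t \<or> real_of_int t \<le> -1" by linarith
    hence t: "0 \<le> n $ i \<and> n $ i \<le> real_of_int t * n $ i \<or> 0 \<le> n $ i \<and> real_of_int t * n $ i \<le> -1 * n $ i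
        \<or> n $ i \<le> 0 \<and> real_of_int t * n $ i \<le> 1 * n $ i \<or> n $ i \<le> 0 \<and> -1 * n $ i \<le> real_of_int t * n $ i"
      using mult_right_mono[of 1 "real_of_int t" "n $ i"] mult_right_mono_neg[of 1 "real_of_int t" "n $ i"]
        mult_right_mono[of "real_of_int t" "-1" "n $ i"] mult_right_mono_neg[of "real_of_int t" "-1" "n $ i"]
      by linarith
    show False using x y t unfolding above_def mem_Collect_eq lattice_point_step_inner yx
      by linarith
  qed
  hence "y $ k = x $ k" for k using off[of k] by (cases "k = i") (simp_all add: t_def)
  thus ?thesis by (simp add: vec_eq_iff)
qed

lemma inj_on_crossings_projection: "inj_on (\<lambda>x. \<chi> k. if k = i then c else x $ k) (crossings n V i)"
proof (rule inj_onI)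
  fix x y assume xy: "x \<in> crossings n V i" "y \<in> crossings n V i"
    "(\<chi> k. if k = i then c else x $ k) = (\<chi> k. if k = i then c else y $ k)"
  show "x = y"
  proof (rule crossing_unique[of y n i x])
    show "y \<in> above n \<longleftrightarrow> y + axis i 1 \<notin> above n" "x \<in> above n \<longleftrightarrow> x + axis i 1 \<notin> above n"
      using xy by (auto simp: crossings_def)
    show "x $ k = y $ k" if "k \<noteq> i" for k
      using arg_cong[OF xy(3), of "\<lambda>v. v $ k"] that by simp
  qed
qed
lemma exists_step_change:
  fixes P :: "nat \<Rightarrow> bool"
  assumes "P 0 \<noteq> P m"
  shows "\<exists>k<m. P k \<noteq> P (Suc k)"
  using assms
proof (induction m)
  case (Suc m)
  thus ?case by (cases "P m = P (Suc m)") (auto intro: less_SucI)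
qed simp

lemma inner_mono_signed:
  assumes "\<And>k. y $ k * s k \<le> x $ k * s k"
    and "\<And>k. s k = (if n $ k \<ge> 0 then 1 else -1 :: int)"
  shows "lattice_point y \<bullet> n \<le> lattice_point x \<bullet> n"
  unfolding lattice_point_inner
proof (rule sum_mono)
  fix k
  have "real_of_int (y $ k * s k) * \<bar>n $ k\<bar> \<le> real_of_int (x $ k * s k) * \<bar>n $ k\<bar>"
    using assms(1)[of k] by (intro mult_right_mono) (simp_all only: of_int_le_iff abs_ge_zero)
  thus "real_of_int (y $ k) * n $ k \<le> real_of_int (x $ k) * n $ k"
    by (auto simp: assms(2) split: if_splits)
qed

text \<open>
  A disconnected configuration contains a connected closed surface at least as large as the flat cut.
  Let \<open>X\<close> consist of the clusters of the upper boundary inside the cylinder and of the upper half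
  space outside of it. An edge from \<open>X\<close> to its complement is either a closed edge of the cylinder or
  an edge outside the cylinder that crosses the hyperplane: a vertex of the cylinder with a neighbour
  outside is a boundary vertex, and disconnection puts it into \<open>X\<close> only if it is an upper one. The
  interface \<open>G\<close> between two opposite corners of a large box \<open>W\<close> has only such edges. If the flat edge on a lattice line lies in the
  cylinder, then the line joins the two sides, so it meets \<open>G\<close>; the edge found there cannot be a
  crossing edge outside the cylinder, since the only crossing edge of the line lies inside. These
  edges are different for different lines.
\<close>
lemma disconnection_interface:
  fixes n :: "real ^ 'd" and M :: int and L H :: real and S :: "(real ^ 'd) set"
    and \<omega> :: "(int ^ 'd) set set"
  defines "h \<equiv> above n"
  defines "s \<equiv> \<lambda>k. if n $ k \<ge> 0 then 1 else -1 :: int"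
  defines "W \<equiv> {(\<chi> k. - M)..(\<chi> k. M)} :: (int ^ 'd) set"
  defines "V \<equiv> lattice_cylinder 0 L H S n"
  assumes n: "n \<noteq> 0" and VM: "\<And>x k. x \<in> V \<Longrightarrow> \<bar>x $ k\<bar> < M"
    and M: "M > 0"
    and \<omega>: "\<omega> \<in> disconnection 0 L H S n"
  defines "X \<equiv> {x \<in> V. \<exists>y\<in>upper_boundary 0 L H S n. (y, x) \<in> connection \<omega>} \<union> (h - V)"
  defines "G \<equiv> interface W X (\<chi> k. s k * M) (\<chi> k. - s k * M)"
  shows "G \<subseteq> edges W" "G \<noteq> {}" "G \<inter> edges V \<inter> \<omega> = {}" "G - edges V \<subseteq> flat_cut n W"
    "card (flat_cut n V) \<le> card (G \<inter> edges V)"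
    "\<And>P. P \<subseteq> G \<Longrightarrow> P \<noteq> {} \<Longrightarrow> P \<noteq> G \<Longrightarrow> \<exists>e\<in>P. \<exists>f\<in>G - P. near e f"
proof -
  \<comment> \<open>The corners of \<open>W\<close> that are highest and lowest in the direction \<open>n\<close>.\<close>
  define a where "a = (\<chi> k. s k * M)"
  define b where "b = (\<chi> k. - s k * M)"
  have G_ab: "G = interface W X a b" by (simp add: G_def a_def b_def)
  have s: "s k = 1 \<or> s k = -1" for k by (simp add: s_def)
  have memW: "x \<in> W \<longleftrightarrow> (\<forall>k. \<bar>x $ k\<bar> \<le> M)" for x
  proof -
    have "(- M \<le> x $ k \<and> x $ k \<le> M) = (\<bar>x $ k\<bar> \<le> M)" for k by linarith
    thus ?thesis unfolding W_def lattice_box_iff by simp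
  qed
  have aW: "a \<in> W" and bW: "b \<in> W" unfolding memW a_def b_def s_def using M by auto
  have face: "x \<notin> V" if "\<bar>x $ k\<bar> = M" for x k using VM[of x k] that by auto
  have aV: "a \<notin> V" and bV: "b \<notin> V"
    using face[of a] face[of b] M by (auto simp: a_def b_def s_def)
  have a_inner: "lattice_point a \<bullet> n = M * norm1 n"
    by (simp add: lattice_point_inner a_def s_def norm1_def sum_distrib_left cong: sum.cong)
       (rule sum.cong, auto)
  have b_inner: "lattice_point b \<bullet> n = - (M * norm1 n)"
    by (simp add: lattice_point_inner b_def s_def norm1_def sum_distrib_left sum_negf[symmetric] cong: sum.cong)
       (rule sum.cong, auto)
  have norm1: "norm1 n > 0"
  proof -
    obtain k where "n $ k \<noteq> 0" using n by (auto simp: vec_eq_iff)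
    thus ?thesis unfolding norm1_def by (intro sum_pos2[of _ k]) auto
  qed
  have aX: "a \<in> X" using aV M norm1 by (simp add: X_def h_def above_def a_inner)
  have bX: "b \<notin> X" using bV M norm1 by (simp add: X_def h_def above_def b_inner not_le)
  note ab = aW aX bW bX
  have upper: "upper_boundary 0 L H S n = {y \<in> inner_boundary V. y \<in> h}"
    by (simp add: upper_boundary_def V_def h_def above_def)
  have lower: "lower_boundary 0 L H S n = {y \<in> inner_boundary V. y \<notin> h}"
    by (simp add: lower_boundary_def V_def h_def above_def not_le)
  have \<omega>V: "\<omega> \<subseteq> edges V" and disc: "\<And>y z. y \<in> inner_boundary V \<Longrightarrow> y \<in> h \<Longrightarrow>
      z \<in> inner_boundary V \<Longrightarrow> z \<notin> h \<Longrightarrow> (y, z) \<notin> connection \<omega>"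
    using \<omega> unfolding disconnection_def V_def[symmetric] upper lower by blast+
  have leave: "{x, y} \<in> edges V - \<omega> \<or> {x, y} \<notin> edges V \<and> x \<in> h \<and> y \<notin> h"
    if xy: "adjacent x y" "x \<in> X" "y \<notin> X" for x y
  proof -
    have X_V: "x \<in> V \<Longrightarrow> \<exists>z. z \<in> inner_boundary V \<and> z \<in> h \<and> (z, x) \<in> connection \<omega>"
      using xy(2) unfolding X_def upper by blast
    have y_V: "y \<in> V \<Longrightarrow> z \<in> inner_boundary V \<Longrightarrow> z \<in> h \<Longrightarrow> (z, y) \<notin> connection \<omega>" for z
      using xy(3) unfolding X_def upper by blast
    have refl: "(y, y) \<in> connection \<omega>" by (simp add: connection_def)
    have out: "{x, y} \<notin> edges V" if "x \<notin> V \<or> y \<notin> V" using that by (auto simp: edge_mem_iff)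
    have ib: "x \<in> V \<Longrightarrow> y \<notin> V \<Longrightarrow> x \<in> inner_boundary V" "y \<in> V \<Longrightarrow> x \<notin> V \<Longrightarrow> y \<in> inner_boundary V"
      using xy(1) adjacent_sym unfolding inner_boundary_def by blast+
    show ?thesis
    proof (cases "x \<in> V"; cases "y \<in> V")
      assume V: "x \<in> V" "y \<in> V"
      then obtain z where z: "z \<in> inner_boundary V" "z \<in> h" "(z, x) \<in> connection \<omega>" using X_V by blast
      have "{x, y} \<notin> \<omega>"
      proof
        assume "{x, y} \<in> \<omega>"
        hence "(z, y) \<in> connection \<omega>" using z(3) unfolding connection_def
          by (auto intro: rtrancl_into_rtrancl)
        thus False using y_V[OF V(2) z(1,2)] by blast
      qed
      thus ?thesis using V xy(1) by (simp add: edge_mem_iff)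
    next
      assume V: "x \<in> V" "y \<notin> V"
      then obtain z where "z \<in> inner_boundary V" "z \<in> h" "(z, x) \<in> connection \<omega>" using X_V by blast
      hence "x \<in> h" using disc ib(1)[OF V] by blast
      moreover have "y \<notin> h" using xy(3) V by (simp add: X_def)
      ultimately show ?thesis using out V by blast
    next
      assume V: "x \<notin> V" "y \<in> V"
      have "x \<in> h" using xy(2) V by (simp add: X_def)
      moreover have "y \<notin> h" using y_V[OF V(2) ib(2)[OF V(2,1)]] refl by blast
      ultimately show ?thesis using out V by blast
    next
      assume V: "x \<notin> V" "y \<notin> V"
      hence "x \<in> h" "y \<notin> h" using xy by (auto simp: X_def)
      thus ?thesis using out V by blast
    qed
  qed
  have G_cases: "\<exists>x y. e = {x, y} \<and> adjacent x y \<and> x \<in> W \<and> y \<in> W \<and>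
      (e \<in> edges V - \<omega> \<or> e \<notin> edges V \<and> x \<in> h \<and> y \<notin> h)" if e: "e \<in> G" for e
  proof -
    obtain u v where uv: "e = {u, v}" using e unfolding G_def interface_def by blast
    note st = interface_step[OF ab e[unfolded G_ab uv]]
    from st(4) show ?thesis
    proof
      assume "u \<in> X \<and> v \<notin> X"
      thus ?thesis using leave[of u v] st uv by blast
    next
      assume "v \<in> X \<and> u \<notin> X"
      moreover have "e = {v, u}" "adjacent v u" using uv st(1) by (auto simp: adjacent_sym)
      ultimately show ?thesis using leave[of v u] st by blast
    qed
  qed
  show GW: "G \<subseteq> edges W"
  proof
    fix e assume "e \<in> G"
    then obtain x y where "e = {x, y}" "adjacent x y" "x \<in> W" "y \<in> W" using G_cases[of e] by blast
    thus "e \<in> edges W" by (simp add: edge_mem_iff)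
  qed
  show "G \<inter> edges V \<inter> \<omega> = {}"
  proof -
    have "e \<notin> edges V \<or> e \<notin> \<omega>" if "e \<in> G" for e using G_cases[OF that] by blast
    thus ?thesis by blast
  qed
  show flat: "G - edges V \<subseteq> flat_cut n W"
  proof
    fix e assume "e \<in> G - edges V"
    then obtain x y where "e = {x, y} \<and> adjacent x y \<and> x \<in> W \<and> y \<in> W \<and> x \<in> h \<and> y \<notin> h"
      using G_cases[of e] by blast
    thus "e \<in> flat_cut n W" unfolding flat_cut_def h_def by blast
  qed
  show "\<exists>e\<in>P. \<exists>f\<in>G - P. near e f" if "P \<subseteq> G" "P \<noteq> {}" "P \<noteq> G" for P
    using interface_connected[OF ab[unfolded W_def]] that unfolding G_ab W_def by blast
  have finG: "finite G" using GW finite_edges[OF finite_lattice_box] finite_subset unfolding W_def by blast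
  let ?B = "outer_side W X a b"
  have b_out: "b \<in> ?B" by (simp add: outer_side_def component_self)
  have inB: "x \<notin> inner_side W X a" if "x \<in> ?B" for x
    using that outer_side_subset[OF ab] by blast
  have side: "z \<in> W \<and> z \<notin> V" if z: "\<And>k. min (c $ k) (x $ k) \<le> z $ k \<and> z $ k \<le> max (c $ k) (x $ k)"
    and "x \<in> W" "c \<in> W" "x $ i = c $ i" "\<bar>c $ i\<bar> = M" for x z c i
  proof -
    have "\<bar>z $ k\<bar> \<le> M" for k
    proof -
      have "\<bar>c $ k\<bar> \<le> M" "\<bar>x $ k\<bar> \<le> M" using that memW by blast+
      thus ?thesis using z[of k] by linarith
    qed
    moreover have "z $ i = c $ i" using z[of i] that by auto
    ultimately show ?thesis using that face[of z i] memW by simp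
  qed
  \<comment> \<open>A vertex of the upper half space on a face of \<open>W\<close> through the corner \<open>a\<close> is joined to \<open>a\<close>
    inside that face by a path along which the height increases; the face does not meet \<open>V\<close>.\<close>
  have top: "x \<notin> ?B" if x: "x \<in> W" "x \<in> h" "x $ i = s i * M" for x i
  proof -
    have "x \<in> component (W \<inter> X) a"
    proof (rule component_hull)
      fix z assume z: "\<And>k. min (a $ k) (x $ k) \<le> z $ k \<and> z $ k \<le> max (a $ k) (x $ k)"
      have zWV: "z \<in> W \<and> z \<notin> V"
        using side[OF z x(1) aW, of i] x(3) M s[of i] by (auto simp: a_def)
      have "x $ k * s k \<le> z $ k * s k" for k
      proof -
        have "\<bar>x $ k\<bar> \<le> M" using x(1) memW by blast
        moreover have "a $ k = s k * M" by (simp add: a_def)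
        ultimately show ?thesis using z[of k] by (cases "s k = 1") (use s[of k] in auto)
      qed
      hence "lattice_point x \<bullet> n \<le> lattice_point z \<bullet> n"
        by (rule inner_mono_signed) (simp add: s_def)
      hence "z \<in> h" using x(2) by (simp add: h_def above_def)
      thus "z \<in> W \<inter> X" using zWV by (simp add: X_def)
    qed
    thus ?thesis using inB by (auto simp: inner_side_def)
  qed
  have bot: "x \<in> ?B" if x: "x \<in> W" "x \<notin> h" "x $ i = - s i * M" for x i
    unfolding outer_side_def
  proof (rule component_hull)
    fix z assume z: "\<And>k. min (b $ k) (x $ k) \<le> z $ k \<and> z $ k \<le> max (b $ k) (x $ k)"
    have zWV: "z \<in> W \<and> z \<notin> V"
      using side[OF z x(1) bW, of i] x(3) M s[of i] by (auto simp: b_def)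
    have "z $ k * s k \<le> x $ k * s k" for k
    proof -
      have "\<bar>x $ k\<bar> \<le> M" using x(1) memW by blast
      moreover have "b $ k = - s k * M" by (simp add: b_def)
      ultimately show ?thesis using z[of k] by (cases "s k = 1") (use s[of k] in auto)
    qed
    hence "lattice_point z \<bullet> n \<le> lattice_point x \<bullet> n"
      by (rule inner_mono_signed) (simp add: s_def)
    hence "z \<notin> h" using x(2) by (simp add: h_def above_def)
    hence "z \<notin> X" using zWV by (simp add: X_def)
    thus "z \<in> W - inner_side W X a" using zWV inner_side_subset[OF ab] by blast
  qed
  \<comment> \<open>A line whose end points on the faces of \<open>W\<close> lie on different sides contains an interface edge.\<close>
  have line: "\<exists>y. (\<forall>k. k \<noteq> i \<longrightarrow> y $ k = x $ k) \<and> {y, y + axis i 1} \<in> G"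
    if x: "x \<in> W" and top': "(\<chi> k. if k = i then s i * M else x $ k) \<in> h"
      and bot': "(\<chi> k. if k = i then - s i * M else x $ k) \<notin> h" for x i
  proof -
    define p where "p = (\<lambda>j::nat. (\<chi> k. if k = i then - M + int j else x $ k) :: int ^ 'd)"
    have xk: "\<bar>x $ k\<bar> \<le> M" for k using x memW by blast
    have pW: "p j \<in> W" if "j \<le> nat (2 * M)" for j
      unfolding memW p_def using that xk M by auto
    have tW: "(\<chi> k. if k = i then s i * M else x $ k) \<in> W" "(\<chi> k. if k = i then - s i * M else x $ k) \<in> W"
      unfolding memW using xk s[of i] M by auto
    have ends: "(p 0 = (\<chi> k. if k = i then - s i * M else x $ k) \<and>
          p (nat (2 * M)) = (\<chi> k. if k = i then s i * M else x $ k)) \<or>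
        (p 0 = (\<chi> k. if k = i then s i * M else x $ k) \<and>
          p (nat (2 * M)) = (\<chi> k. if k = i then - s i * M else x $ k))"
      using s[of i] M by (auto simp: p_def vec_eq_iff)
    have "(\<chi> k. if k = i then s i * M else x $ k) \<notin> ?B"
      by (rule top[OF tW(1) top', of i]) simp
    moreover have "(\<chi> k. if k = i then - s i * M else x $ k) \<in> ?B"
      by (rule bot[OF tW(2) bot', of i]) simp
    ultimately have "(p 0 \<in> ?B) \<noteq> (p (nat (2 * M)) \<in> ?B)" using ends by auto
    then obtain j where j: "j < nat (2 * M)" "(p j \<in> ?B) \<noteq> (p (Suc j) \<in> ?B)"
      using exists_step_change[of "\<lambda>j. p j \<in> ?B"] by blast
    have step: "p (Suc j) = p j + axis i 1" by (simp add: p_def vec_eq_iff axis_def)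
    have "{p j, p j + axis i 1} \<in> G"
      unfolding G_ab using interface_iff[OF ab pW[of j] pW[of "Suc j"]] j step by auto
    moreover have "\<forall>k. k \<noteq> i \<longrightarrow> p j $ k = x $ k" by (simp add: p_def)
    ultimately show ?thesis by blast
  qed
  have cross: "\<exists>y. (\<forall>k. k \<noteq> i \<longrightarrow> y $ k = x $ k) \<and> {y, y + axis i 1} \<in> G \<inter> edges V"
    if x: "x \<in> crossings n V i" for x i
  proof -
    have xV: "x \<in> V" "x + axis i 1 \<in> V" and xh: "x \<in> h \<longleftrightarrow> x + axis i 1 \<notin> h"
      using x by (auto simp: crossings_def h_def)
    have xW: "x \<in> W" unfolding memW using VM[OF xV(1)] by (auto intro: less_imp_le)
    have xi: "\<bar>x $ i\<bar> < M" "\<bar>x $ i + 1\<bar> < M" using VM[OF xV(1), of i] VM[OF xV(2), of i] by (auto simp: axis_def)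
    have hi: "lattice_point z \<bullet> n \<le> lattice_point (\<chi> k. if k = i then s i * M else x $ k) \<bullet> n"
      and lo: "lattice_point (\<chi> k. if k = i then - s i * M else x $ k) \<bullet> n \<le> lattice_point z \<bullet> n"
      if z: "z = x \<or> z = x + axis i 1" for z
    proof -
      have zk: "k \<noteq> i \<Longrightarrow> z $ k = x $ k" "\<bar>z $ i\<bar> < M" for k
        using z xi by (auto simp: axis_def)
      have "z $ k * s k \<le> (\<chi> k. if k = i then s i * M else x $ k) $ k * s k" for k
        using zk s[of k] s[of i] by auto
      thus "lattice_point z \<bullet> n \<le> lattice_point (\<chi> k. if k = i then s i * M else x $ k) \<bullet> n"
        by (rule inner_mono_signed) (simp add: s_def)
      have "(\<chi> k. if k = i then - s i * M else x $ k) $ k * s k \<le> z $ k * s k" for k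
        using zk s[of k] s[of i] by auto
      thus "lattice_point (\<chi> k. if k = i then - s i * M else x $ k) \<bullet> n \<le> lattice_point z \<bullet> n"
        by (rule inner_mono_signed) (simp add: s_def)
    qed
    have "(\<chi> k. if k = i then s i * M else x $ k) \<in> h" "(\<chi> k. if k = i then - s i * M else x $ k) \<notin> h"
      using hi[of x] hi[of "x + axis i 1"] lo[of x] lo[of "x + axis i 1"] xh
      unfolding h_def above_def by auto
    from line[OF xW this] obtain y where y: "\<forall>k. k \<noteq> i \<longrightarrow> y $ k = x $ k" "{y, y + axis i 1} \<in> G" by blast
    have "{y, y + axis i 1} \<in> edges V"
    proof (rule ccontr)
      assume nE: "{y, y + axis i 1} \<notin> edges V"
      hence "{y, y + axis i 1} \<in> flat_cut n W" using y flat by blast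
      hence yh: "y \<in> h \<longleftrightarrow> y + axis i 1 \<notin> h"
        unfolding flat_cut_def h_def by (auto simp: doubleton_eq_iff)
      have "y = x" by (rule crossing_unique[OF xh[unfolded h_def] yh[unfolded h_def]]) (use y in blast)
      thus False using nE xV by (simp add: edge_mem_iff)
    qed
    thus ?thesis using y by blast
  qed
  show "card (flat_cut n V) \<le> card (G \<inter> edges V)"
  proof -
    define Y where "Y = (\<lambda>(i, x). SOME y. (\<forall>k. k \<noteq> i \<longrightarrow> y $ k = x $ k) \<and> {y, y + axis i 1} \<in> G \<inter> edges V)"
    have Y: "(\<forall>k. k \<noteq> i \<longrightarrow> Y (i, x) $ k = x $ k) \<and> {Y (i, x), Y (i, x) + axis i 1} \<in> G \<inter> edges V"
      if "x \<in> crossings n V i" for i x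
      unfolding Y_def prod.case by (rule someI_ex) (rule cross[OF that])
    let ?C = "SIGMA i:UNIV. crossings n V i"
    have finV: "finite V"
    proof (rule finite_subset)
      show "V \<subseteq> W" unfolding subset_iff memW using VM by (auto intro: less_imp_le)
      show "finite W" unfolding W_def by (rule finite_lattice_box)
    qed
    have "inj_on (\<lambda>(i, x). {Y (i, x), Y (i, x) + axis i 1}) ?C"
    proof (rule inj_onI, clarify)
      fix i x j x'
      assume x: "x \<in> crossings n V i" and x': "x' \<in> crossings n V j"
        and eq: "{Y (i, x), Y (i, x) + axis i 1} = {Y (j, x'), Y (j, x') + axis j 1}"
      from eq have ij: "i = j" and YY: "Y (i, x) = Y (j, x')" by (auto simp: step_edge_eq_iff)
      have "x' = x"
      proof (rule crossing_unique)
        show "x \<in> above n \<longleftrightarrow> x + axis i 1 \<notin> above n" using x by (simp add: crossings_def)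
        show "x' \<in> above n \<longleftrightarrow> x' + axis i 1 \<notin> above n" using x' ij by (simp add: crossings_def)
        show "x' $ k = x $ k" if "k \<noteq> i" for k using Y[OF x] Y[OF x'] YY that ij by metis
      qed
      thus "i = j \<and> x = x'" using ij by simp
    qed
    moreover have "(\<lambda>(i, x). {Y (i, x), Y (i, x) + axis i 1}) ` ?C \<subseteq> G \<inter> edges V" using Y by auto
    ultimately have "card ?C \<le> card (G \<inter> edges V)" using finG by (meson card_inj_on_le finite_Int)
    moreover have "card ?C = card (flat_cut n V)"
      using card_flat_cut[OF finV] finite_crossings[OF finV] by (simp add: card_SigmaI)
    ultimately show ?thesis by simp
  qed
  show "G \<noteq> {}"
  proof
    assume empty: "G = {}"
    have "b \<in> component W a"
    proof (rule component_hull)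
      fix z assume z: "\<And>k. min (a $ k) (b $ k) \<le> z $ k \<and> z $ k \<le> max (a $ k) (b $ k)"
      show "z \<in> W" unfolding memW
      proof
        fix k show "\<bar>z $ k\<bar> \<le> M" using z[of k] s[of k] M by (auto simp: a_def b_def)
      qed
    qed
    hence "b \<in> ?B \<longleftrightarrow> a \<in> ?B"
    proof (rule component_const)
      fix u v assume "u \<in> component W a" "v \<in> component W a" "adjacent u v"
      moreover from this have "u \<in> W" "v \<in> W" using component_subset[OF aW] by blast+
      ultimately show "u \<in> ?B \<longleftrightarrow> v \<in> ?B"
        using interface_iff[OF ab, of u v] empty unfolding G_ab by blast
    qed
    moreover have "a \<notin> ?B" using inB component_self unfolding inner_side_def by blast
    ultimately show False using b_out by blast
  qed
qed

section \<open>Closing edges in the random cluster model\<close>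

lemma sym_connection: "sym (connection F)"
  unfolding connection_def by (intro sym_rtrancl symI) (auto simp: insert_commute)

lemma equiv_connection: "equiv A (connection F \<inter> (A \<times> A))"
proof (rule equivI)
  show "connection F \<inter> (A \<times> A) \<subseteq> A \<times> A" by blast
  show "refl_on A (connection F \<inter> (A \<times> A))" by (auto simp: refl_on_def connection_def)
  show "sym (connection F \<inter> (A \<times> A))" using sym_connection[of F] by (auto simp: sym_def)
  show "trans (connection F \<inter> (A \<times> A))"
    by (rule transI) (auto simp: connection_def intro: rtrancl_trans)
qed

lemma connection_mono: "F \<subseteq> F' \<Longrightarrow> connection F \<subseteq> connection F'"
  unfolding connection_def by (rule rtrancl_mono) auto

text \<open>
  Adding an edge \<open>{u, v}\<close> can only join the cluster of \<open>u\<close> to that of \<open>v\<close>. The disjunction is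
  stated with \<open>u\<close> alone because every new connection uses \<open>u\<close> on one of its two sides.
\<close>
lemma connection_insert:
  assumes "(x, y) \<in> connection (insert {u, v} F)"
  shows "(x, y) \<in> connection F \<or> (x, u) \<in> connection F \<or> (y, u) \<in> connection F"
proof -
  let ?c = "connection F"
  have s: "(b, a) \<in> ?c" if "(a, b) \<in> ?c" for a b using sym_connection that by (rule symD)
  have t: "(a, c) \<in> ?c" if "(a, b) \<in> ?c" "(b, c) \<in> ?c" for a b c
    using that unfolding connection_def by (rule rtrancl_trans)
  have "(x, y) \<in> ?c \<or> ((x, u) \<in> ?c \<or> (x, v) \<in> ?c) \<and> ((u, y) \<in> ?c \<or> (v, y) \<in> ?c)"
    using assms unfolding connection_def[of "insert {u, v} F"]
  proof (induction rule: rtrancl_induct)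
    case base
    show ?case by (simp add: connection_def)
  next
    case (step y z)
    show ?case
    proof (cases "{y, z} = {u, v}")
      case True
      hence yz: "(y = u \<and> z = v) \<or> (y = v \<and> z = u)" by (auto simp: doubleton_eq_iff)
      have r: "(u, u) \<in> ?c" "(v, v) \<in> ?c" by (auto simp: connection_def)
      show ?thesis using step.IH yz r by auto
    next
      case False
      hence "(y, z) \<in> ?c" using step.hyps by (auto simp: connection_def)
      thus ?thesis using step.IH t by blast
    qed
  qed
  thus ?thesis using s t by blast
qed

text \<open>
  Apart from the class of \<open>u\<close>, no two classes of \<open>r\<close> are merged in \<open>s\<close>.
\<close>
lemma card_quotient_merge:
  assumes r: "equiv A r" and s: "equiv A s" and "r \<subseteq> s" and fin: "finite A" and u: "u \<in> A"
    and merge: "\<And>x y. (x, y) \<in> s \<Longrightarrow> (x, y) \<in> r \<or> (x, u) \<in> r \<or> (y, u) \<in> r"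
  shows "card (A // r) \<le> card (A // s) + 1"
proof -
  have fq: "finite (A // r)" "finite (A // s)"
    using fin r s by (auto intro!: finite_quotient simp: equiv_def)
  let ?Q = "A // r - {r `` {u}}"
  have img: "s `` (r `` {x}) = s `` {x}" if "x \<in> A" for x
  proof -
    have "(x, x) \<in> r" using r that by (meson equivE refl_onD)
    moreover have "trans s" using s by (meson equivE)
    ultimately show ?thesis using \<open>r \<subseteq> s\<close> unfolding trans_def by blast
  qed
  have "inj_on (\<lambda>C. s `` C) ?Q"
  proof (rule inj_onI)
    fix C D assume C: "C \<in> ?Q" and D: "D \<in> ?Q" and eq: "s `` C = s `` D"
    then obtain x y where x: "x \<in> A" "C = r `` {x}" and y: "y \<in> A" "D = r `` {y}"
      by (auto elim!: quotientE)
    have "(x, y) \<in> s" using eq x y img s by (metis eq_equiv_class)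
    moreover have "(x, u) \<notin> r" "(y, u) \<notin> r"
      using C D x y r by (auto simp: equiv_class_eq_iff[OF r])
    ultimately have "(x, y) \<in> r" using merge by blast
    thus "C = D" using x y equiv_class_eq[OF r] by simp
  qed
  moreover have "(\<lambda>C. s `` C) ` ?Q \<subseteq> A // s"
    using img by (auto elim!: quotientE intro: quotientI)
  ultimately have "card ?Q \<le> card (A // s)" using fq by (metis card_inj_on_le)
  moreover have "card (A // r) = card ?Q + 1"
    using fq quotientI[OF u, of r] by (metis Suc_eq_plus1 card.remove)
  ultimately show ?thesis by simp
qed

lemma num_clusters_insert:
  assumes "finite (\<Union>E)" "{u, v} \<in> E"
  shows "num_clusters E \<pi> (insert {u, v} \<omega>) \<le> num_clusters E \<pi> \<omega>"
    and "num_clusters E \<pi> \<omega> \<le> num_clusters E \<pi> (insert {u, v} \<omega>) + 1"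
proof -
  let ?A = "\<Union>E"
  let ?r = "connection (\<omega> \<union> \<pi>) \<inter> (?A \<times> ?A)"
  let ?s = "connection (insert {u, v} \<omega> \<union> \<pi>) \<inter> (?A \<times> ?A)"
  have rs: "?r \<subseteq> ?s" using connection_mono[of "\<omega> \<union> \<pi>" "insert {u, v} \<omega> \<union> \<pi>"] by blast
  have "finite (?A // ?r)"
    using assms(1) by (rule finite_quotient) blast
  thus "num_clusters E \<pi> (insert {u, v} \<omega>) \<le> num_clusters E \<pi> \<omega>"
    unfolding num_clusters_def using rs equiv_connection equiv_connection
    by (rule finite_refines_card_le)
  show "num_clusters E \<pi> \<omega> \<le> num_clusters E \<pi> (insert {u, v} \<omega>) + 1"
    unfolding num_clusters_def
  proof (rule card_quotient_merge[OF equiv_connection equiv_connection rs assms(1), of u])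
    show "u \<in> ?A" using assms(2) by blast
    fix x y assume "(x, y) \<in> ?s"
    thus "(x, y) \<in> ?r \<or> (x, u) \<in> ?r \<or> (y, u) \<in> ?r"
      using connection_insert[of x y u v "\<omega> \<union> \<pi>"] \<open>u \<in> ?A\<close> by auto
  qed
qed

context
  fixes q \<beta> :: real and J :: "(int ^ 'd) set \<Rightarrow> real" and E \<pi> :: "(int ^ 'd) set set"
  assumes q: "q \<ge> 1" and \<beta>: "\<beta> \<ge> 0" and fin: "finite E" and E: "E \<subseteq> edges UNIV"
    and J: "\<And>e. e \<in> E \<Longrightarrow> J e \<ge> 0"
begin

lemma finite_endpoints: "finite (\<Union>E)"
  using fin E by (auto simp: edges_def)

lemma rc_weight_nonneg: "0 \<le> rc_weight q \<beta> J E \<pi> \<omega>"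
  unfolding rc_weight_def edge_prob_def using q \<beta> J
  by (intro mult_nonneg_nonneg prod_nonneg) auto

lemma rc_partition_pos: "0 < (\<Sum>\<omega>\<in>Pow E. rc_weight q \<beta> J E \<pi> \<omega>)"
proof (rule sum_pos2[of _ "{}"])
  show "0 < rc_weight q \<beta> J E \<pi> {}"
    unfolding rc_weight_def edge_prob_def using q by (auto intro!: mult_pos_pos prod_pos)
qed (use fin rc_weight_nonneg in auto)

text \<open>
  Opening \<open>e\<close> lowers the number of clusters by zero or one. Whatever the other edges are, the
  conditional probability that \<open>e\<close> is closed therefore lies between \<open>exp (- \<beta> * J e)\<close> and
  \<open>q * exp (- \<beta> * J e)\<close>; this is where \<open>q \<ge> 1\<close> enters.
\<close>
lemma rc_weight_insert:
  assumes e: "e \<in> E" "e \<notin> \<omega>"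
  defines "T \<equiv> rc_weight q \<beta> J E \<pi> \<omega> + rc_weight q \<beta> J E \<pi> (insert e \<omega>)"
  shows "exp (- \<beta> * J e) * T \<le> rc_weight q \<beta> J E \<pi> \<omega>"
    and "rc_weight q \<beta> J E \<pi> \<omega> \<le> q * exp (- \<beta> * J e) * T"
proof -
  obtain u v where uv: "e = {u, v}" using e E by (auto simp: edges_def)
  define s where "s = exp (- \<beta> * J e)"
  define C where "C = num_clusters E \<pi> \<omega>"
  define C' where "C' = num_clusters E \<pi> (insert e \<omega>)"
  define r where "r = (\<Prod>f\<in>E - {e}. if f \<in> \<omega> then edge_prob \<beta> J f else 1 - edge_prob \<beta> J f)"
  have C: "C' \<le> C" "C \<le> C' + 1"
    using num_clusters_insert[OF finite_endpoints, of u v \<pi> \<omega>] e by (auto simp: C_def C'_def uv)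
  have s: "0 < s" "s \<le> 1" using \<beta> J e by (auto simp: s_def)
  have r: "0 \<le> r" unfolding r_def edge_prob_def using \<beta> J by (intro prod_nonneg) auto
  have w: "rc_weight q \<beta> J E \<pi> \<omega> = s * r * q ^ C"
    using e fin by (simp add: rc_weight_def prod.remove[of E e] r_def s_def C_def edge_prob_def)
  have "(\<Prod>f\<in>E - {e}. if f \<in> insert e \<omega> then edge_prob \<beta> J f else 1 - edge_prob \<beta> J f) = r"
    unfolding r_def by (rule prod.cong) auto
  hence w': "rc_weight q \<beta> J E \<pi> (insert e \<omega>) = (1 - s) * r * q ^ C'"
    using e fin by (simp add: rc_weight_def prod.remove[of E e] s_def C'_def edge_prob_def)
  have q1: "q ^ C' \<le> q ^ C" using q C by (intro power_increasing) auto
  have q2: "q ^ C \<le> q * q ^ C'" using power_increasing[OF C(2) q] by simp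
  have T: "T = r * (s * q ^ C + (1 - s) * q ^ C')" by (simp add: T_def w w' algebra_simps)
  have "s * q ^ C + (1 - s) * q ^ C' \<le> s * q ^ C + (1 - s) * q ^ C"
    using q1 s by (intro add_left_mono mult_left_mono) auto
  hence "T \<le> r * q ^ C" unfolding T using r by (intro mult_left_mono) (auto simp: algebra_simps)
  hence "s * T \<le> s * (r * q ^ C)" using s by (intro mult_left_mono) auto
  thus "exp (- \<beta> * J e) * T \<le> rc_weight q \<beta> J E \<pi> \<omega>" by (simp add: w s_def mult_ac)
  have "s * q ^ C' + (1 - s) * q ^ C' \<le> s * q ^ C + (1 - s) * q ^ C'"
    using q1 s by (intro add_right_mono mult_left_mono) auto
  hence "r * q ^ C' \<le> T" unfolding T using r by (intro mult_left_mono) (auto simp: algebra_simps)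
  hence "q * s * (r * q ^ C') \<le> q * s * T" using s q by (intro mult_left_mono) auto
  moreover have "s * r * q ^ C \<le> s * r * (q * q ^ C')" using q2 s r by (intro mult_left_mono) auto
  ultimately have "s * r * q ^ C \<le> q * s * T" by (simp only: mult_ac)
  thus "rc_weight q \<beta> J E \<pi> \<omega> \<le> q * exp (- \<beta> * J e) * T" by (simp only: w s_def)
qed

text \<open>
  The conditional bounds for a single edge multiply up when the edges of \<open>G\<close> are closed one by one.
\<close>
lemma rc_closed_sum_bounds:
  assumes "G \<subseteq> E"
  defines "Z \<equiv> \<lambda>G. \<Sum>\<omega>\<in>Pow (E - G). rc_weight q \<beta> J E \<pi> \<omega>"
  shows "(\<Prod>e\<in>G. exp (- \<beta> * J e)) * Z {} \<le> Z G \<and> Z G \<le> (\<Prod>e\<in>G. q * exp (- \<beta> * J e)) * Z {}"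
  using finite_subset[OF assms(1) fin] assms(1)
proof (induction G rule: finite_induct)
  case empty
  thus ?case by simp
next
  case (insert e G)
  have e: "e \<in> E" "e \<notin> G" using insert by auto
  let ?w = "rc_weight q \<beta> J E \<pi>"
  let ?P = "Pow (E - insert e G)"
  have "E - G = insert e (E - insert e G)" using e by blast
  hence Pow: "Pow (E - G) = ?P \<union> insert e ` ?P" by (metis Pow_insert)
  have "Z G = (\<Sum>\<omega>\<in>?P. ?w \<omega>) + (\<Sum>\<omega>\<in>insert e ` ?P. ?w \<omega>)"
    unfolding Z_def Pow using fin by (intro sum.union_disjoint) auto
  also have "(\<Sum>\<omega>\<in>insert e ` ?P. ?w \<omega>) = (\<Sum>\<omega>\<in>?P. ?w (insert e \<omega>))"
    by (subst sum.reindex) (auto intro!: inj_onI)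
  finally have ZG: "Z G = (\<Sum>\<omega>\<in>?P. ?w \<omega> + ?w (insert e \<omega>))" by (simp add: sum.distrib)
  have eP: "e \<notin> \<omega>" if "\<omega> \<in> ?P" for \<omega> using that by auto
  have lo: "exp (- \<beta> * J e) * Z G \<le> Z (insert e G)"
    unfolding ZG sum_distrib_left unfolding Z_def
    by (rule sum_mono) (use rc_weight_insert(1)[OF e(1) eP] in simp)
  have hi: "Z (insert e G) \<le> q * exp (- \<beta> * J e) * Z G"
    unfolding ZG sum_distrib_left unfolding Z_def
    by (rule sum_mono) (use rc_weight_insert(2)[OF e(1) eP] in simp)
  have IH: "(\<Prod>e\<in>G. exp (- \<beta> * J e)) * Z {} \<le> Z G" "Z G \<le> (\<Prod>e\<in>G. q * exp (- \<beta> * J e)) * Z {}"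
    using insert by auto
  have "exp (- \<beta> * J e) * ((\<Prod>e\<in>G. exp (- \<beta> * J e)) * Z {}) \<le> Z (insert e G)"
    using IH(1) lo by (meson exp_ge_zero mult_left_mono order_trans)
  moreover have "q * exp (- \<beta> * J e) * Z G \<le> q * exp (- \<beta> * J e) * ((\<Prod>e\<in>G. q * exp (- \<beta> * J e)) * Z {})"
    using IH(2) q by (intro mult_left_mono) auto
  ultimately show ?case using hi insert by (simp add: mult_ac)
qed

lemma
  assumes "G \<subseteq> E"
  shows rc_prob_closed_ge: "(\<Prod>e\<in>G. exp (- \<beta> * J e)) \<le> rc_prob q \<beta> J E \<pi> {\<omega>. \<omega> \<inter> G = {}}"
    and rc_prob_closed_le: "rc_prob q \<beta> J E \<pi> {\<omega>. \<omega> \<inter> G = {}} \<le> (\<Prod>e\<in>G. q * exp (- \<beta> * J e))"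
proof -
  have "Pow E \<inter> {\<omega>. \<omega> \<inter> G = {}} = Pow (E - G)" by blast
  thus "(\<Prod>e\<in>G. exp (- \<beta> * J e)) \<le> rc_prob q \<beta> J E \<pi> {\<omega>. \<omega> \<inter> G = {}}"
    "rc_prob q \<beta> J E \<pi> {\<omega>. \<omega> \<inter> G = {}} \<le> (\<Prod>e\<in>G. q * exp (- \<beta> * J e))"
    using rc_closed_sum_bounds[OF assms] rc_partition_pos
    by (simp_all add: rc_prob_def field_simps)
qed

lemma rc_prob_mono:
  assumes "\<And>\<omega>. \<omega> \<subseteq> E \<Longrightarrow> \<omega> \<in> A \<Longrightarrow> \<omega> \<in> B"
  shows "rc_prob q \<beta> J E \<pi> A \<le> rc_prob q \<beta> J E \<pi> B"
  unfolding rc_prob_def using assms fin rc_weight_nonneg rc_partition_pos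
  by (intro divide_right_mono sum_mono2) auto

lemma rc_prob_le_one: "rc_prob q \<beta> J E \<pi> A \<le> 1"
proof -
  have "rc_prob q \<beta> J E \<pi> A \<le> rc_prob q \<beta> J E \<pi> UNIV" by (rule rc_prob_mono) auto
  also have "\<dots> = 1" using rc_partition_pos by (simp add: rc_prob_def)
  finally show ?thesis .
qed

lemma rc_prob_UN_le:
  assumes "finite I"
  shows "rc_prob q \<beta> J E \<pi> (\<Union>i\<in>I. A i) \<le> (\<Sum>i\<in>I. rc_prob q \<beta> J E \<pi> (A i))"
proof -
  let ?w = "rc_weight q \<beta> J E \<pi>"
  have "(\<Sum>\<omega>\<in>Pow E \<inter> (\<Union>i\<in>I. A i). ?w \<omega>) \<le> (\<Sum>i\<in>I. \<Sum>\<omega>\<in>Pow E \<inter> A i. ?w \<omega>)"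
    using assms
  proof (induction I rule: finite_induct)
    case (insert i I)
    have "(\<Sum>\<omega>\<in>Pow E \<inter> (\<Union>i\<in>insert i I. A i). ?w \<omega>) =
        (\<Sum>\<omega>\<in>(Pow E \<inter> A i) \<union> (Pow E \<inter> (\<Union>i\<in>I. A i)). ?w \<omega>)"
      by (rule sum.cong) auto
    also have "\<dots> \<le> (\<Sum>\<omega>\<in>Pow E \<inter> A i. ?w \<omega>) + (\<Sum>\<omega>\<in>Pow E \<inter> (\<Union>i\<in>I. A i). ?w \<omega>)"
      using fin rc_weight_nonneg by (subst sum_Un) (auto intro!: sum_nonneg)
    finally show ?case using insert by simp
  qed simp
  hence "rc_prob q \<beta> J E \<pi> (\<Union>i\<in>I. A i) \<le> (\<Sum>i\<in>I. \<Sum>\<omega>\<in>Pow E \<inter> A i. ?w \<omega>) / (\<Sum>\<omega>\<in>Pow E. ?w \<omega>)"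
    unfolding rc_prob_def using rc_partition_pos by (intro divide_right_mono) auto
  thus ?thesis by (simp add: rc_prob_def sum_divide_distrib)
qed

end

section \<open>The size of the flat cut\<close>

text \<open>
  A well-ordered type with as many elements as \<open>'a\<close>. Coordinates are renamed by it, because the
  transformation formula for the measure of a linear image speaks of well-ordered coordinates.
\<close>
typedef 'a index = "{..<CARD('a::finite)}"
  by (rule exI[of _ 0]) simp

lemma finite_UNIV_index: "finite (UNIV :: 'a::finite index set)"
proof -
  have "finite (Abs_index ` {..<CARD('a)} :: 'a index set)" by simp
  moreover have "(UNIV :: 'a index set) = Abs_index ` {..<CARD('a)}"
    using type_definition.Abs_image[OF type_definition_index] by metis
  ultimately show ?thesis by metis
qed

lemma card_UNIV_index: "card (UNIV :: 'a::finite index set) = CARD('a)"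
  using type_definition.card[OF type_definition_index[where 'a = 'a]] by simp

instantiation index :: (finite) "{finite, wellorder}"
begin

definition less_eq_index :: "'a index \<Rightarrow> 'a index \<Rightarrow> bool" where
  "less_eq_index j k \<longleftrightarrow> Rep_index j \<le> Rep_index k"

definition less_index :: "'a index \<Rightarrow> 'a index \<Rightarrow> bool" where
  "less_index j k \<longleftrightarrow> Rep_index j < Rep_index k"

instance
proof
  fix P :: "'a index \<Rightarrow> bool" and j
  assume step: "\<And>j. (\<And>k. k < j \<Longrightarrow> P k) \<Longrightarrow> P j"
  show "P j"
    by (induction j rule: measure_induct_rule[of Rep_index]) (auto intro: step simp: less_index_def)
qed (auto simp: less_eq_index_def less_index_def Rep_index_inject finite_UNIV_index)

end

definition frame :: "('d::finite \<Rightarrow> real ^ 'd) \<Rightarrow> bool" where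
  "frame f \<longleftrightarrow> (\<forall>j k. f j \<bullet> f k = (if j = k then 1 else 0))"

definition from_frame :: "('d::finite \<Rightarrow> real ^ 'd) \<Rightarrow> real ^ 'd \<Rightarrow> real ^ 'd" where
  "from_frame f w = (\<Sum>k\<in>UNIV. w $ k *\<^sub>R f k)"

lemma linear_from_frame: "linear (from_frame f)"
  by (rule linearI) (simp_all add: from_frame_def scaleR_left_distrib sum.distrib scaleR_sum_right)

lemma from_frame_inner: "frame f \<Longrightarrow> from_frame f w \<bullet> f k = w $ k"
proof -
  assume f: "frame f"
  have "from_frame f w \<bullet> f k = (\<Sum>j\<in>UNIV. w $ j * (f j \<bullet> f k))"
    by (simp add: from_frame_def inner_sum_left)
  also have "\<dots> = (\<Sum>j\<in>UNIV. if j = k then w $ j else 0)"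
    using f by (intro sum.cong) (auto simp: frame_def)
  finally show ?thesis by simp
qed

lemma orthogonal_from_frame: "frame f \<Longrightarrow> orthogonal_transformation (from_frame f)"
proof -
  assume f: "frame f"
  have "from_frame f v \<bullet> from_frame f w = v \<bullet> w" for v w
  proof -
    have "from_frame f v \<bullet> from_frame f w = (\<Sum>k\<in>UNIV. w $ k * (from_frame f v \<bullet> f k))"
      by (subst from_frame_def[of f w]) (simp add: inner_sum_right)
    also have "\<dots> = (\<Sum>k\<in>UNIV. w $ k * v $ k)" unfolding from_frame_inner[OF f] ..
    also have "\<dots> = v \<bullet> w" by (simp add: inner_vec_def mult.commute)
    finally show ?thesis .
  qed
  thus ?thesis using linear_from_frame by (simp add: orthogonal_transformation_def)
qed

lemma from_frame_expand:
  assumes f: "frame f"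
  shows "from_frame f (\<chi> k. z \<bullet> f k) = z"
proof -
  have "surj (from_frame f)" using orthogonal_transformation_surj[OF orthogonal_from_frame[OF f]] .
  then obtain w where w: "z = from_frame f w" by auto
  have "(\<chi> k. z \<bullet> f k) = w" unfolding w using from_frame_inner[OF f] by (simp add: vec_eq_iff)
  thus ?thesis using w by simp
qed

lemma norm_frame: "frame f \<Longrightarrow> norm (f k) = 1"
  by (simp add: frame_def norm_eq_sqrt_inner)

text \<open>
  This shear replaces the coordinate \<open>i\<close> of \<open>z\<close> by the height \<open>(z \<bullet> n) / n $ i\<close>, which runs through
  a unit interval while \<open>z\<close> moves along a crossing edge in direction \<open>i\<close>.
\<close>
definition coord_proj :: "'d \<Rightarrow> real ^ 'd \<Rightarrow> real ^ 'd \<Rightarrow> real ^ 'd" where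
  "coord_proj i n z = (\<chi> k. if k = i then (z \<bullet> n) / n $ i else z $ k)"

lemma linear_coord_proj: "linear (coord_proj i n)"
  by (rule linearI) (auto simp: coord_proj_def vec_eq_iff inner_add_left add_divide_distrib)

text \<open>
  The row \<open>i\<close> of the matrix differs from that of the identity by a combination of the other rows.
\<close>
lemma det_coord_proj:
  assumes "n $ i \<noteq> 0"
  shows "det (matrix (coord_proj i n)) = 1"
proof -
  define v where "v = (1 / n $ i) *\<^sub>R n - axis i 1"
  have row: "row j (mat 1 :: real ^ 'a ^ 'a) = axis j 1" for j
    by (simp add: row_def mat_def axis_def vec_eq_iff)
  have v: "v = (\<Sum>j\<in>UNIV - {i}. v $ j *\<^sub>R axis j 1)"
  proof -
    have "v = (\<Sum>j\<in>UNIV. v $ j *\<^sub>R axis j 1)"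
      by (simp add: vec_eq_iff axis_def if_distrib cong: if_cong)
    also have "\<dots> = v $ i *\<^sub>R axis i 1 + (\<Sum>j\<in>UNIV - {i}. v $ j *\<^sub>R axis j 1)"
      by (simp add: sum.remove[of UNIV i])
    also have "v $ i = 0" using assms by (simp add: v_def axis_def)
    finally show ?thesis by simp
  qed
  have "v \<in> vec.span {row j (mat 1 :: real ^ 'a ^ 'a) | j. j \<noteq> i}"
    unfolding row span_vec_eq
    by (subst v, intro span_sum span_scale span_base) auto
  hence "det (\<chi> k. if k = i then row i (mat 1) + v else row k (mat 1)) = det (mat 1 :: real ^ 'a ^ 'a)"
    by (rule det_row_span)
  moreover have "matrix (coord_proj i n) = (\<chi> k. if k = i then row i (mat 1) + v else row k (mat 1))"
    by (simp add: matrix_def coord_proj_def row v_def vec_eq_iff inner_axis') (simp add: axis_def)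
  ultimately show ?thesis by simp
qed

definition cell :: "int ^ 'd \<Rightarrow> (real ^ 'd) set" where
  "cell p = {y. \<forall>k. \<lfloor>y $ k\<rfloor> = p $ k}"

lemma
  fixes p :: "int ^ 'd"
  shows cell_lmeasurable: "cell p \<in> lmeasurable" and measure_cell: "measure lebesgue (cell p) = 1"
proof -
  let ?a = "lattice_point p" and ?b = "lattice_point p + (\<chi> k. 1)"
  have eq: "cell p = (\<Inter>k\<in>UNIV. {y. y $ k \<ge> real_of_int (p $ k)} \<inter> {y. y $ k < real_of_int (p $ k) + 1})"
    by (auto simp: cell_def floor_eq_iff)
  have "cell p \<in> sets borel" unfolding eq
    by (intro sets.finite_INT sets.Int borel_closed borel_open closed_halfspace_component_ge_cart
        open_halfspace_component_lt_cart) auto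
  hence meas: "cell p \<in> sets lebesgue" by simp
  have sub: "cell p \<subseteq> cbox ?a ?b"
  proof
    fix y assume "y \<in> cell p"
    hence "real_of_int (p $ k) \<le> y $ k \<and> y $ k < real_of_int (p $ k) + 1" for k
      unfolding eq by blast
    thus "y \<in> cbox ?a ?b" by (auto simp: mem_box_cart lattice_point_def intro: less_imp_le)
  qed
  have sup: "box ?a ?b \<subseteq> cell p"
    by (auto simp: cell_def mem_box_cart lattice_point_def floor_eq_iff intro: less_imp_le)
  show lm: "cell p \<in> lmeasurable"
    by (rule bounded_set_imp_lmeasurable[OF bounded_subset[OF bounded_cbox sub] meas])
  have ne: "cbox ?a ?b \<noteq> {}" unfolding interval_ne_empty_cart by simp
  have 1: "measure lebesgue (cbox ?a ?b) = 1"
    using ne by (simp add: content_cbox_cart)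
  have "measure lebesgue (cell p) \<le> measure lebesgue (cbox ?a ?b)"
    by (rule measure_mono_fmeasurable[OF sub meas]) simp
  hence "measure lebesgue (cell p) \<le> 1" using 1 by simp
  moreover have "measure lebesgue (box ?a ?b) \<le> measure lebesgue (cell p)"
    by (rule measure_mono_fmeasurable[OF sup _ lm]) simp
  moreover have "measure lebesgue (box ?a ?b) = measure lebesgue (cbox ?a ?b)"
    by (simp add: measure_lborel_box_eq measure_lborel_cbox_eq)
  ultimately have "1 \<le> measure lebesgue (cell p)" using 1 by simp
  with \<open>measure lebesgue (cell p) \<le> 1\<close> show "measure lebesgue (cell p) = 1" by simp
qed

lemma cell_disjoint: "p \<noteq> p' \<Longrightarrow> cell p \<inter> cell p' = {}"
  by (auto simp: cell_def vec_eq_iff)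

lemma measure_UN_cells:
  assumes "finite X" "inj_on p X"
  shows "measure lebesgue (\<Union>x\<in>X. cell (p x)) = card X" "(\<Union>x\<in>X. cell (p x)) \<in> lmeasurable"
proof -
  have "measure lebesgue (\<Union>x\<in>X. cell (p x)) = (\<Sum>x\<in>X. measure lebesgue (cell (p x)))"
  proof (rule measure_UNION'[OF assms(1)])
    show "pairwise (\<lambda>x y. disjnt (cell (p x)) (cell (p y))) X"
      unfolding pairwise_def disjnt_def using assms(2) cell_disjoint inj_onD by metis
  qed (rule cell_lmeasurable)
  thus "measure lebesgue (\<Union>x\<in>X. cell (p x)) = card X" by (simp add: measure_cell)
  show "(\<Union>x\<in>X. cell (p x)) \<in> lmeasurable"
    using assms(1) cell_lmeasurable by (intro fmeasurable.finite_UN) auto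
qed

lemma frame_image:
  fixes f :: "'d::{finite, wellorder} \<Rightarrow> real ^ 'd::_"
  assumes "frame f" "n $ i \<noteq> 0" "S \<in> lmeasurable"
  shows "coord_proj i n ` from_frame f ` S \<in> lmeasurable"
    and "measure lebesgue (coord_proj i n ` from_frame f ` S) = measure lebesgue S"
proof -
  note o = orthogonal_from_frame[OF assms(1)]
  have m: "from_frame f ` S \<in> lmeasurable" by (rule measurable_orthogonal_image[OF o assms(3)])
  show "coord_proj i n ` from_frame f ` S \<in> lmeasurable"
    by (rule measurable_linear_image[OF linear_coord_proj m])
  show "measure lebesgue (coord_proj i n ` from_frame f ` S) = measure lebesgue S"
    unfolding measure_linear_image[OF linear_coord_proj m] det_coord_proj[OF assms(2)]
    using measure_orthogonal_image[OF o assms(3)] by simp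
qed

lemma content_slab:
  fixes i :: "'d::finite" and lo hi b :: real
  assumes "b \<ge> 0" "lo \<le> hi"
  shows "measure lebesgue (cbox (\<chi> k :: 'd::finite. if k = i then lo else - b) (\<chi> k. if k = i then hi else b))
      = (hi - lo) * (2 * b) ^ (CARD('d) - 1)"
proof -
  let ?a = "\<chi> k. if k = i then lo else - b" and ?b = "\<chi> k. if k = i then hi else b"
  have "cbox ?a ?b \<noteq> {}" unfolding interval_ne_empty_cart using assms by simp
  hence "measure lebesgue (cbox ?a ?b) = (\<Prod>k\<in>UNIV. ?b $ k - ?a $ k)"
    by (simp add: content_cbox_cart)
  also have "\<dots> = (hi - lo) * (\<Prod>k\<in>UNIV - {i}. ?b $ k - ?a $ k)"
    by (simp add: prod.remove[of UNIV i])
  also have "(\<Prod>k\<in>UNIV - {i}. ?b $ k - ?a $ k) = (\<Prod>k\<in>UNIV - {i}. 2 * b)"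
    by (rule prod.cong) auto
  finally show ?thesis by (simp add: card_Diff_subset)
qed

text \<open>
  A bound for the distance between a lattice point near the hyperplane and a point of the same unit
  column near the hyperplane. It depends on \<open>n\<close>, but not on the size of the cylinder.
\<close>
definition spread :: "'d::finite \<Rightarrow> real ^ 'd \<Rightarrow> real" where
  "spread i n = CARD('d) + 2 + norm1 n / \<bar>n $ i\<bar>"

lemma spread_nonneg: "spread i n \<ge> 0"
  unfolding spread_def norm1_def by (intro add_nonneg_nonneg divide_nonneg_nonneg sum_nonneg) auto

lemma norm_diff_le_spread:
  fixes x z n :: "real ^ 'd"
  assumes ni: "n $ i \<noteq> 0" and off: "\<And>k. k \<noteq> i \<Longrightarrow> \<bar>z $ k - x $ k\<bar> \<le> 1"
    and z: "\<bar>z \<bullet> n\<bar> \<le> \<bar>n $ i\<bar>" and x: "\<bar>x \<bullet> n\<bar> \<le> \<bar>n $ i\<bar>"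
  shows "norm (z - x) \<le> spread i n"
proof -
  have "(z - x) \<bullet> n = n $ i * (z $ i - x $ i) + (\<Sum>k\<in>UNIV - {i}. n $ k * (z $ k - x $ k))"
    by (simp add: inner_vec_def sum.remove[of UNIV i] mult.commute)
  hence eq: "n $ i * (z $ i - x $ i) = z \<bullet> n - x \<bullet> n - (\<Sum>k\<in>UNIV - {i}. n $ k * (z $ k - x $ k))"
    by (simp add: inner_diff_left)
  have "\<bar>\<Sum>k\<in>UNIV - {i}. n $ k * (z $ k - x $ k)\<bar> \<le> (\<Sum>k\<in>UNIV - {i}. \<bar>n $ k\<bar> * 1)"
    by (rule order_trans[OF sum_abs sum_mono]) (use off in \<open>simp only: abs_mult, intro mult_left_mono, auto\<close>)
  also have "\<dots> \<le> norm1 n" unfolding norm1_def by (simp add: sum_mono2)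
  finally have "\<bar>n $ i\<bar> * \<bar>z $ i - x $ i\<bar> \<le> 2 * \<bar>n $ i\<bar> + norm1 n"
    using z x eq by (simp add: abs_mult[symmetric])
  hence "\<bar>z $ i - x $ i\<bar> \<le> (2 * \<bar>n $ i\<bar> + norm1 n) / \<bar>n $ i\<bar>"
    using ni by (simp add: pos_le_divide_eq mult.commute)
  also have "\<dots> = 2 + norm1 n / \<bar>n $ i\<bar>" using ni by (simp add: field_simps)
  finally have zi: "\<bar>z $ i - x $ i\<bar> \<le> 2 + norm1 n / \<bar>n $ i\<bar>" .
  have "norm (z - x) \<le> (\<Sum>k\<in>UNIV. \<bar>(z - x) $ k\<bar>)" by (rule norm_le_l1_cart)
  also have "\<dots> = \<bar>z $ i - x $ i\<bar> + (\<Sum>k\<in>UNIV - {i}. \<bar>z $ k - x $ k\<bar>)"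
    by (simp add: sum.remove[of UNIV i])
  also have "(\<Sum>k\<in>UNIV - {i}. \<bar>z $ k - x $ k\<bar>) \<le> (\<Sum>k\<in>UNIV - {i}. 1)"
    using off by (intro sum_mono) auto
  also have "\<dots> \<le> CARD('d)" by simp
  finally show ?thesis using zi by (simp add: spread_def)
qed

lemma crossing_height: 
  assumes "x \<in> crossings n V i"
  shows "\<bar>lattice_point x \<bullet> n\<bar> \<le> \<bar>n $ i\<bar>" "\<bar>lattice_point (x + axis i 1) \<bullet> n\<bar> \<le> \<bar>n $ i\<bar>"
  using assms unfolding crossings_def above_def mem_Collect_eq lattice_point_step_inner by linarith+

lemma abs_inner_frame_le:
  assumes "frame f" "norm (z - x) \<le> C"
  shows "\<bar>z \<bullet> f k\<bar> \<le> \<bar>x \<bullet> f k\<bar> + C"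
proof -
  have "\<bar>z \<bullet> f k - x \<bullet> f k\<bar> \<le> norm (z - x) * norm (f k)"
    using Cauchy_Schwarz_ineq2[of "z - x" "f k"] by (simp add: inner_diff_left)
  thus ?thesis using assms norm_frame[OF assms(1)] by simp
qed

text \<open>
  Each crossing in direction \<open>i\<close> is represented by the unit cell above its projection along \<open>i\<close>, with
  height in \<open>[-1, 0)\<close>. By uniqueness of the crossing on a line the cells are disjoint. Their union
  lies in the sheared image of a rotated slab of thickness \<open>\<bar>n $ i\<bar>\<close>, and rotation and shear preserve
  volume.
\<close>
lemma card_crossings_le:
  fixes f :: "'d::{finite, wellorder} \<Rightarrow> real ^ 'd::_"
  assumes f: "frame f" and ni: "f i $ i \<noteq> 0" and fin: "finite V" and a: "a \<ge> 0"
    and V: "\<And>x k. x \<in> V \<Longrightarrow> k \<noteq> i \<Longrightarrow> \<bar>lattice_point x \<bullet> f k\<bar> \<le> a"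
  shows "card (crossings (f i) V i) \<le> \<bar>f i $ i\<bar> * (2 * (a + spread i (f i))) ^ (CARD('d) - 1)"
proof -
  define n where "n = f i"
  define C where "C = spread i n"
  define X where "X = crossings n V i"
  define p where "p = (\<lambda>x. \<chi> k. if k = i then (-1 :: int) else x $ k)"
  define Q where "Q = cbox (\<chi> k. if k = i then min 0 (- n $ i) else - (a + C))
      (\<chi> k. if k = i then max 0 (- n $ i) else a + C)"
  have ni: "n $ i \<noteq> 0" using ni by (simp add: n_def)
  have C: "C \<ge> 0" by (simp add: C_def spread_nonneg)
  have finX: "finite X" using fin by (simp add: X_def finite_crossings)
  have inj: "inj_on p X" unfolding p_def X_def by (rule inj_on_crossings_projection)
  have sub: "(\<Union>x\<in>X. cell (p x)) \<subseteq> coord_proj i n ` from_frame f ` Q"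
  proof clarify
    fix x y assume x: "x \<in> X" and y: "y \<in> cell (p x)"
    have yi: "-1 \<le> y $ i" "y $ i \<le> 0" and yk: "k \<noteq> i \<Longrightarrow> \<bar>y $ k - lattice_point x $ k\<bar> \<le> 1" for k
    proof -
      have fl: "\<lfloor>y $ k\<rfloor> = p x $ k" for k using y by (simp add: cell_def)
      show "-1 \<le> y $ i" "y $ i \<le> 0" using fl[of i] by (simp_all add: p_def floor_eq_iff)
      show "k \<noteq> i \<Longrightarrow> \<bar>y $ k - lattice_point x $ k\<bar> \<le> 1"
        using fl[of k] by (simp add: p_def floor_eq_iff lattice_point_def)
    qed
    \<comment> \<open>The preimage of \<open>y\<close> under the shear.\<close>
    define z where "z = (\<chi> k. if k = i then y $ i - (\<Sum>k\<in>UNIV - {i}. y $ k * n $ k) / n $ i else y $ k)"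
    have "z \<bullet> n = z $ i * n $ i + (\<Sum>k\<in>UNIV - {i}. z $ k * n $ k)"
      by (simp add: inner_vec_def sum.remove[of UNIV i])
    also have "(\<Sum>k\<in>UNIV - {i}. z $ k * n $ k) = (\<Sum>k\<in>UNIV - {i}. y $ k * n $ k)"
      by (rule sum.cong) (auto simp: z_def)
    also have "z $ i * n $ i = y $ i * n $ i - (\<Sum>k\<in>UNIV - {i}. y $ k * n $ k)"
      using ni by (simp add: z_def left_diff_distrib)
    finally have zn: "z \<bullet> n = y $ i * n $ i" by simp
    have yz: "y = coord_proj i n z"
      using ni by (simp add: coord_proj_def zn vec_eq_iff) (simp add: z_def)
    have "\<bar>y $ i\<bar> * \<bar>n $ i\<bar> \<le> 1 * \<bar>n $ i\<bar>" using yi by (intro mult_right_mono) auto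
    hence "\<bar>z \<bullet> n\<bar> \<le> \<bar>n $ i\<bar>" by (simp add: zn abs_mult)
    moreover have "\<bar>z $ k - lattice_point x $ k\<bar> \<le> 1" if "k \<noteq> i" for k
      using yk[OF that] that by (simp add: z_def)
    ultimately have close: "norm (z - lattice_point x) \<le> C"
      using crossing_height(1)[OF x[unfolded X_def]] ni unfolding C_def by (intro norm_diff_le_spread)
    have zk: "- (a + C) \<le> z \<bullet> f k \<and> z \<bullet> f k \<le> a + C" if "k \<noteq> i" for k
    proof -
      have "\<bar>lattice_point x \<bullet> f k\<bar> \<le> a" using V[of x k] x that by (simp add: X_def crossings_def)
      thus ?thesis using abs_inner_frame_le[OF f close, of k] by linarith
    qed
    have "min 0 (- n $ i) \<le> z \<bullet> n \<and> z \<bullet> n \<le> max 0 (- n $ i)"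
    proof (cases "n $ i > 0")
      case True
      have "-1 * n $ i \<le> y $ i * n $ i" "y $ i * n $ i \<le> 0 * n $ i"
        using yi True by (auto simp only: intro!: mult_right_mono)
      thus ?thesis using True by (simp add: zn)
    next
      case False
      have "0 * n $ i \<le> y $ i * n $ i" "y $ i * n $ i \<le> -1 * n $ i"
        using yi False by (auto simp only: not_less intro!: mult_right_mono_neg)
      thus ?thesis using False by (simp add: zn)
    qed
    hence "(\<chi> k. z \<bullet> f k) \<in> Q" using zk unfolding Q_def mem_box_cart n_def by simp
    moreover have "z = from_frame f (\<chi> k. z \<bullet> f k)" using from_frame_expand[OF f] by simp
    ultimately show "y \<in> coord_proj i n ` from_frame f ` Q" unfolding yz by blast
  qed
  have Q: "Q \<in> lmeasurable" by (simp add: Q_def)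
  have "real (card X) = measure lebesgue (\<Union>x\<in>X. cell (p x))"
    using measure_UN_cells(1)[OF finX inj] by simp
  also have "\<dots> \<le> measure lebesgue (coord_proj i n ` from_frame f ` Q)"
    using measure_mono_fmeasurable[OF sub] measure_UN_cells(2)[OF finX inj] frame_image(1)[OF f ni Q]
    by blast
  also have "\<dots> = measure lebesgue Q" by (rule frame_image(2)[OF f ni Q])
  also have "\<dots> = (max 0 (- n $ i) - min 0 (- n $ i)) * (2 * (a + C)) ^ (CARD('d) - 1)"
    unfolding Q_def using a C by (intro content_slab) auto
  also have "max 0 (- n $ i) - min 0 (- n $ i) = \<bar>n $ i\<bar>" by auto
  finally show ?thesis by (simp add: X_def C_def n_def)
qed

lemma exists_crossing_on_line:
  assumes "n $ i \<noteq> 0"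
  obtains x :: "int ^ 'd" where "\<And>k. k \<noteq> i \<Longrightarrow> x $ k = y $ k" "x \<in> above n \<longleftrightarrow> x + axis i 1 \<notin> above n"
proof -
  define c where "c = (\<Sum>k\<in>UNIV - {i}. real_of_int (y $ k) * n $ k)"
  define m where "m = (if n $ i > 0 then \<lceil>- c / n $ i\<rceil> - 1 else \<lfloor>- c / n $ i\<rfloor>)"
  define x where "x = (\<chi> k. if k = i then m else y $ k)"
  have "(\<Sum>k\<in>UNIV - {i}. real_of_int (x $ k) * n $ k) = c"
    unfolding c_def by (rule sum.cong) (auto simp: x_def)
  hence xn: "lattice_point x \<bullet> n = real_of_int m * n $ i + c"
    by (simp add: lattice_point_inner sum.remove[of UNIV i] x_def)
  have "x \<in> above n \<longleftrightarrow> x + axis i 1 \<notin> above n"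
  proof (cases "n $ i > 0")
    case True
    have m_eq: "m = \<lceil>- c / n $ i\<rceil> - 1" using True by (simp add: m_def)
    have "real_of_int m < - c / n $ i" using m_eq by linarith
    moreover have "- c / n $ i \<le> real_of_int m + 1" using m_eq by linarith
    ultimately
    have "real_of_int m * n $ i < - c" "- c \<le> (real_of_int m + 1) * n $ i"
      using True pos_less_divide_eq pos_divide_le_eq by blast+
    thus ?thesis unfolding above_def mem_Collect_eq lattice_point_step_inner xn
      by (simp add: algebra_simps)
  next
    case False
    hence neg: "n $ i < 0" using assms by simp
    have m_eq: "m = \<lfloor>- c / n $ i\<rfloor>" using False by (simp add: m_def)
    have "real_of_int m \<le> - c / n $ i" using m_eq by linarith
    moreover have "- c / n $ i < real_of_int m + 1" using m_eq by linarith
    ultimately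
    have "- c \<le> real_of_int m * n $ i" "(real_of_int m + 1) * n $ i < - c"
      using neg neg_le_divide_eq neg_divide_less_eq by blast+
    thus ?thesis unfolding above_def mem_Collect_eq lattice_point_step_inner xn
      by (simp add: algebra_simps)
  qed
  thus ?thesis using that[of x] by (simp add: x_def)
qed

text \<open>
  Conversely the cells of the crossings cover the sheared image of a slightly smaller slab, since
  every line in direction \<open>i\<close> has a crossing.
\<close>
lemma card_crossings_ge:
  fixes f :: "'d::{finite, wellorder} \<Rightarrow> real ^ 'd::_"
  assumes f: "frame f" and ni: "f i $ i \<noteq> 0" and fin: "finite V"
    and a: "a \<ge> spread i (f i) + 1" and H: "H > \<bar>f i $ i\<bar>"
    and V: "\<And>x. (\<And>k. k \<noteq> i \<Longrightarrow> \<bar>lattice_point x \<bullet> f k\<bar> < a) \<Longrightarrow> \<bar>lattice_point x \<bullet> f i\<bar> < H \<Longrightarrow> x \<in> V"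
  shows "\<bar>f i $ i\<bar> * (2 * (a - (spread i (f i) + 1))) ^ (CARD('d) - 1) \<le> card (crossings (f i) V i)"
proof -
  define n where "n = f i"
  define C where "C = spread i n"
  define X where "X = crossings n V i"
  define p where "p = (\<lambda>x. \<chi> k. if k = i then (-1 :: int) else x $ k)"
  define lo where "lo = (\<chi> k. if k = i then min 0 (- n $ i) else - (a - (C + 1)))"
  define hi where "hi = (\<chi> k. if k = i then max 0 (- n $ i) else a - (C + 1))"
  have ni: "n $ i \<noteq> 0" using ni by (simp add: n_def)
  have finX: "finite X" using fin by (simp add: X_def finite_crossings)
  have inj: "inj_on p X" unfolding p_def X_def by (rule inj_on_crossings_projection)
  have sub: "coord_proj i n ` from_frame f ` box lo hi \<subseteq> (\<Union>x\<in>X. cell (p x))"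
  proof clarify
    fix w assume w: "w \<in> box lo hi"
    define z where "z = from_frame f w"
    have zf: "z \<bullet> f k = w $ k" for k unfolding z_def by (rule from_frame_inner[OF f])
    have wk: "lo $ k < w $ k \<and> w $ k < hi $ k" for k using w by (simp add: mem_box_cart)
    have zk: "\<bar>z \<bullet> f k\<bar> < a - (C + 1)" if "k \<noteq> i" for k
      using wk[of k] that by (simp add: zf lo_def hi_def abs_less_iff)
    have zn: "min 0 (- n $ i) < z \<bullet> n" "z \<bullet> n < max 0 (- n $ i)"
      using wk[of i] zf[of i] by (simp_all add: lo_def hi_def n_def)
    have zi: "-1 < z \<bullet> n / n $ i" "z \<bullet> n / n $ i < 0"
      using zn ni by (auto simp: divide_simps min_def max_def split: if_splits)
    obtain x where x: "\<And>k. k \<noteq> i \<Longrightarrow> x $ k = (\<chi> k. \<lfloor>z $ k\<rfloor>) $ k" "x \<in> above n \<longleftrightarrow> x + axis i 1 \<notin> above n"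
      using exists_crossing_on_line[OF ni, of "\<chi> k. \<lfloor>z $ k\<rfloor>"] by blast
    have xX: "x \<in> crossings n UNIV i" using x(2) by (simp add: crossings_def)
    have off: "\<bar>lattice_point x $ k - z $ k\<bar> \<le> 1" if "k \<noteq> i" for k
      using x(1)[OF that] by (simp add: lattice_point_def) linarith
    have "norm (lattice_point x - z) \<le> C"
      unfolding C_def using off crossing_height(1)[OF xX] zn ni
      by (intro norm_diff_le_spread) auto
    moreover have "norm (lattice_point (x + axis i 1) - z) \<le> norm (lattice_point x - z) + norm (axis i (1::real))"
      unfolding lattice_point_step by (metis add_diff_eq add.commute norm_triangle_ineq)
    ultimately have close: "norm (lattice_point x - z) \<le> C + 1" "norm (lattice_point (x + axis i 1) - z) \<le> C + 1"
      by simp_all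
    have "x \<in> V"
    proof (rule V)
      show "\<bar>lattice_point x \<bullet> f k\<bar> < a" if "k \<noteq> i" for k
        using abs_inner_frame_le[OF f close(1), of k] zk[OF that] by linarith
      show "\<bar>lattice_point x \<bullet> f i\<bar> < H" using crossing_height(1)[OF xX] H by (simp add: n_def)
    qed
    moreover have "x + axis i 1 \<in> V"
    proof (rule V)
      show "\<bar>lattice_point (x + axis i 1) \<bullet> f k\<bar> < a" if "k \<noteq> i" for k
        using abs_inner_frame_le[OF f close(2), of k] zk[OF that] by linarith
      show "\<bar>lattice_point (x + axis i 1) \<bullet> f i\<bar> < H" using crossing_height(2)[OF xX] H by (simp add: n_def)
    qed
    ultimately have "x \<in> X" using x(2) by (simp add: X_def crossings_def)
    moreover have "\<lfloor>coord_proj i n z $ k\<rfloor> = p x $ k" for k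
    proof (cases "k = i")
      case True
      thus ?thesis using zi by (simp add: coord_proj_def p_def floor_eq_iff)
    next
      case False
      thus ?thesis using x(1)[OF False] by (simp add: coord_proj_def p_def)
    qed
    hence "coord_proj i n z \<in> cell (p x)" by (simp add: cell_def)
    ultimately show "coord_proj i n (from_frame f w) \<in> (\<Union>x\<in>X. cell (p x))"
      unfolding z_def by blast
  qed
  have Q: "box lo hi \<in> lmeasurable" by simp
  have "\<bar>n $ i\<bar> = max 0 (- n $ i) - min 0 (- n $ i)" by auto
  hence "\<bar>n $ i\<bar> * (2 * (a - (C + 1))) ^ (CARD('d) - 1) = measure lebesgue (cbox lo hi)"
    unfolding lo_def hi_def using a by (subst content_slab) (auto simp: C_def n_def)
  also have "\<dots> = measure lebesgue (box lo hi)"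
    by (simp add: measure_lborel_box_eq measure_lborel_cbox_eq)
  also have "\<dots> = measure lebesgue (coord_proj i n ` from_frame f ` box lo hi)"
    by (rule frame_image(2)[OF f ni Q, symmetric])
  also have "\<dots> \<le> measure lebesgue (\<Union>x\<in>X. cell (p x))"
    using measure_mono_fmeasurable[OF sub] measure_UN_cells(2)[OF finX inj] frame_image(1)[OF f ni Q]
    by blast
  also have "\<dots> = real (card X)" by (rule measure_UN_cells(1)[OF finX inj])
  finally show ?thesis by (simp add: X_def C_def n_def)
qed

text \<open>
  Renaming coordinates is an isometry that maps lattice points to lattice points and crossings to
  crossings.
\<close>
definition reindex :: "('e::finite \<Rightarrow> 'd::finite) \<Rightarrow> 'a ^ 'd \<Rightarrow> 'a ^ 'e" where
  "reindex g v = (\<chi> j. v $ g j)"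

context
  fixes g :: "'e::finite \<Rightarrow> 'd::finite"
  assumes g: "bij g"
begin

lemma inj_reindex: "inj (reindex g)"
proof (rule injI)
  fix v w :: "'a ^ 'd" assume eq: "reindex g v = reindex g w"
  have "v $ g j = w $ g j" for j using arg_cong[OF eq, of "\<lambda>u. u $ j"] by (simp add: reindex_def)
  hence "v $ k = w $ k" for k using bij_is_surj[OF g] by (metis surjD)
  thus "v = w" by (simp add: vec_eq_iff)
qed

lemma reindex_surj: "\<exists>w. v = reindex g w"
  by (rule exI[of _ "\<chi> k. v $ inv g k"]) (simp add: reindex_def vec_eq_iff inv_f_f bij_is_inj[OF g])

lemma sum_reindex: "(\<Sum>j\<in>UNIV. h (g j)) = (\<Sum>k\<in>UNIV. h k)"
  by (rule sum.reindex_bij_betw[OF g])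

lemma reindex_inner: "reindex g v \<bullet> reindex g w = v \<bullet> (w :: real ^ 'd)"
  using sum_reindex[of "\<lambda>k. v $ k * w $ k"] by (simp add: inner_vec_def reindex_def)

lemma reindex_step: "reindex g (x + axis (g j) 1) = reindex g x + axis j (1::int)"
  using bij_is_inj[OF g] by (simp add: reindex_def vec_eq_iff axis_def inj_eq)

lemma reindex_lattice_point: "lattice_point (reindex g x) = reindex g (lattice_point x)"
  by (simp add: lattice_point_def reindex_def)

lemma reindex_crossings:
  "crossings (reindex g n) (reindex g ` V) j = reindex g ` crossings n V (g j)"
proof -
  have mem: "reindex g x \<in> reindex g ` W \<longleftrightarrow> x \<in> W" for x :: "int ^ 'd" and W
    using inj_reindex by (metis inj_image_mem_iff)
  have above: "reindex g x \<in> above (reindex g n) \<longleftrightarrow> x \<in> above n" for x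
    by (simp add: above_def reindex_lattice_point reindex_inner)
  have "reindex g x \<in> crossings (reindex g n) (reindex g ` V) j \<longleftrightarrow> x \<in> crossings n V (g j)" for x
    unfolding crossings_def mem_Collect_eq reindex_step[symmetric] mem above ..
  moreover have "v \<in> reindex g ` V" if "v \<in> crossings (reindex g n) (reindex g ` V) j" for v
    using that by (simp add: crossings_def)
  ultimately show ?thesis by blast
qed

lemma reindex_spread: "spread j (reindex g n) = spread (g j) n"
proof -
  have "CARD('e) = CARD('d)" using g by (rule bij_betw_same_card)
  moreover have "norm1 (reindex g n) = norm1 n"
    using sum_reindex[of "\<lambda>k. \<bar>n $ k\<bar>"] by (simp add: norm1_def reindex_def)
  ultimately show ?thesis by (simp add: spread_def reindex_def)
qed

end

lemma card_crossings_bounds: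
  fixes f :: "'d::finite \<Rightarrow> real ^ 'd"
  assumes f: "frame f" and ni: "f i $ i \<noteq> 0" and fin: "finite V"
    and upper: "\<And>x k. x \<in> V \<Longrightarrow> k \<noteq> i \<Longrightarrow> \<bar>lattice_point x \<bullet> f k\<bar> \<le> a"
    and a: "a \<ge> spread i (f i) + 1" and H: "H > \<bar>f i $ i\<bar>"
    and lower: "\<And>x. (\<And>k. k \<noteq> i \<Longrightarrow> \<bar>lattice_point x \<bullet> f k\<bar> < a) \<Longrightarrow> \<bar>lattice_point x \<bullet> f i\<bar> < H \<Longrightarrow> x \<in> V"
  shows "\<bar>f i $ i\<bar> * (2 * (a - (spread i (f i) + 1))) ^ (CARD('d) - 1) \<le> card (crossings (f i) V i)"
    and "card (crossings (f i) V i) \<le> \<bar>f i $ i\<bar> * (2 * (a + spread i (f i))) ^ (CARD('d) - 1)"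
proof -
  have "\<exists>g :: 'd index \<Rightarrow> 'd. bij g"
    using finite_same_card_bij[of "UNIV :: 'd index set" "UNIV :: 'd set"] card_UNIV_index[where 'a = 'd] by auto
  then obtain g :: "'d index \<Rightarrow> 'd" where g: "bij g" ..
  define j where "j = inv g i"
  have gj: "g j = i" unfolding j_def using g by (simp add: bij_is_surj surj_f_inv_f)
  have gk: "g k \<noteq> i" if "k \<noteq> j" for k using that gj bij_is_inj[OF g] by (metis injD)
  define f' where "f' = (\<lambda>k. reindex g (f (g k)))"
  have f': "frame f'" using f bij_is_inj[OF g] by (simp add: frame_def f'_def reindex_inner[OF g] inj_eq)
  have fj: "f' j = reindex g (f i)" by (simp add: f'_def gj)
  have fjj: "f' j $ j = f i $ i" by (simp add: fj reindex_def gj)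
  have sp: "spread j (f' j) = spread i (f i)" by (simp add: fj reindex_spread[OF g] gj)
  have inner: "lattice_point (reindex g x) \<bullet> f' k = lattice_point x \<bullet> f (g k)" for x k
    by (simp add: f'_def reindex_lattice_point[OF g] reindex_inner[OF g])
  have card: "card (crossings (f' j) (reindex g ` V) j) = card (crossings (f i) V i)"
    unfolding fj reindex_crossings[OF g] gj
    by (rule card_image) (rule inj_on_subset[OF inj_reindex[OF g] subset_UNIV])
  have CARD: "CARD('d index) = CARD('d)" by (rule card_UNIV_index)
  have ni': "f' j $ j \<noteq> 0" using ni fjj by simp
  have fin': "finite (reindex g ` V)" using fin by simp
  have a0: "a \<ge> 0" using a spread_nonneg[of i "f i"] by linarith
  have "real (card (crossings (f' j) (reindex g ` V) j))
      \<le> \<bar>f' j $ j\<bar> * (2 * (a + spread j (f' j))) ^ (CARD('d index) - 1)"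
  proof (rule card_crossings_le[OF f' ni' fin' a0])
    fix v k assume "v \<in> reindex g ` V" "k \<noteq> j"
    thus "\<bar>lattice_point v \<bullet> f' k\<bar> \<le> a" using upper gk[of k] inner by auto
  qed
  thus "card (crossings (f i) V i) \<le> \<bar>f i $ i\<bar> * (2 * (a + spread i (f i))) ^ (CARD('d) - 1)"
    unfolding card CARD fjj sp .
  have "\<bar>f' j $ j\<bar> * (2 * (a - (spread j (f' j) + 1))) ^ (CARD('d index) - 1)
      \<le> real (card (crossings (f' j) (reindex g ` V) j))"
  proof (rule card_crossings_ge[OF f' ni' fin'])
    show "spread j (f' j) + 1 \<le> a" "\<bar>f' j $ j\<bar> < H" using a H sp fjj by simp_all
    fix v assume v: "\<And>k. k \<noteq> j \<Longrightarrow> \<bar>lattice_point v \<bullet> f' k\<bar> < a" "\<bar>lattice_point v \<bullet> f' j\<bar> < H"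
    obtain x where x: "v = reindex g x" using reindex_surj[OF g] by blast
    have "x \<in> V"
    proof (rule lower)
      fix k assume "k \<noteq> i"
      moreover obtain m where m: "k = g m" using bij_is_surj[OF g] by (metis surjD)
      ultimately have "m \<noteq> j" using gj by auto
      thus "\<bar>lattice_point x \<bullet> f k\<bar> < a" using v(1)[of m] inner[of x m] x m by simp
    next
      show "\<bar>lattice_point x \<bullet> f i\<bar> < H" using v(2) inner[of x j] x gj by simp
    qed
    thus "v \<in> reindex g ` V" using x by blast
  qed
  thus "\<bar>f i $ i\<bar> * (2 * (a - (spread i (f i) + 1))) ^ (CARD('d) - 1) \<le> card (crossings (f i) V i)"
    unfolding card CARD fjj sp .
qed

section \<open>Lattice points of a cylinder\<close>

text \<open>
  An orthonormal frame with \<open>n\<close> at the position \<open>i\<close> and the edges of the cube at the other positions.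
  The position can be prescribed, which is convenient for counting crossings in direction \<open>i\<close>.
\<close>
definition cube_frame :: "(real ^ 'd) set \<Rightarrow> real ^ 'd \<Rightarrow> 'd \<Rightarrow> ('d \<Rightarrow> real ^ 'd) \<Rightarrow> bool" where
  "cube_frame S n i f \<longleftrightarrow> frame f \<and> f i = n \<and>
    (\<forall>L H. L > 0 \<longrightarrow> cylinder 0 L H S n =
      {y. (\<forall>k. k \<noteq> i \<longrightarrow> \<bar>y \<bullet> f k\<bar> \<le> L / 2) \<and> \<bar>y \<bullet> n\<bar> \<le> H})"

lemma unit_cube_frame:
  fixes n :: "real ^ 'd" and i :: 'd
  assumes "S \<in> unit_cubes n"
  shows "\<exists>f. cube_frame S n i f"
proof -
  obtain B where S: "S = {\<Sum>u\<in>B. t u *\<^sub>R u | t. \<forall>u\<in>B. - 1/2 \<le> t u \<and> t u \<le> 1/2}"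
    and nB: "n \<notin> B" and orth: "pairwise orthogonal (insert n B)"
    and unit: "\<And>u. u \<in> insert n B \<Longrightarrow> norm u = 1" and span: "span (insert n B) = UNIV"
    using assms unfolding unit_cubes_def by blast
  have "0 \<notin> insert n B" using unit by (metis norm_zero zero_neq_one)
  hence ind: "independent (insert n B)" using pairwise_orthogonal_independent[OF orth] by simp
  have fin: "finite B" using independent_imp_finite[OF ind] by simp
  have "card (insert n B) = dim (span (insert n B))"
    using dim_eq_card_independent[OF ind] by (simp only: dim_span)
  also have "\<dots> = CARD('d)" unfolding span by (simp add: dim_UNIV)
  finally have "card (insert n B) = CARD('d)" .
  hence cardB: "card B = CARD('d) - 1" using nB fin by simp
  have "card (UNIV - {i}) = card B" using cardB by (simp add: card_Diff_subset)
  then obtain h where h: "bij_betw h (UNIV - {i}) B"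
    using finite_same_card_bij[of "UNIV - {i}" B] fin by auto
  define f where "f = (\<lambda>k. if k = i then n else h k)"
  have fk: "f k \<in> B" if "k \<noteq> i" for k using h that by (auto simp: f_def bij_betw_def)
  have fB: "\<exists>k. k \<noteq> i \<and> u = f k" if "u \<in> B" for u
    using h that unfolding bij_betw_def f_def by auto
  have inner: "u \<bullet> v = (if u = v then 1 else 0)" if "u \<in> insert n B" "v \<in> insert n B" for u v
    using orth unit that by (auto simp: pairwise_def orthogonal_def norm_eq_1)
  have inj: "f j = f k \<longleftrightarrow> j = k" for j k
    using h nB fk[of j] fk[of k] unfolding f_def bij_betw_def inj_on_def by auto
  have fin_mem: "f k \<in> insert n B" for k using fk[of k] by (auto simp: f_def)
  have frame: "frame f" using inner fin_mem inj by (simp add: frame_def)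
  have cyl: "cylinder 0 L H S n = {y. (\<forall>k. k \<noteq> i \<longrightarrow> \<bar>y \<bullet> f k\<bar> \<le> L / 2) \<and> \<bar>y \<bullet> n\<bar> \<le> H}" if L: "L > 0" for L H
  proof (intro equalityI subsetI)
    fix y assume "y \<in> cylinder 0 L H S n"
    then obtain s h where s: "s \<in> S" and "h \<in> {-H..H}" and ysh: "y = 0 + L *\<^sub>R s + h *\<^sub>R n"
      unfolding cylinder_def by blast
    hence h: "\<bar>h\<bar> \<le> H" by (simp add: abs_le_iff)
    obtain t where t0: "\<forall>u\<in>B. - 1/2 \<le> t u \<and> t u \<le> 1/2" and "s = (\<Sum>u\<in>B. t u *\<^sub>R u)"
      using s unfolding S by blast
    hence y: "y = L *\<^sub>R (\<Sum>u\<in>B. t u *\<^sub>R u) + h *\<^sub>R n" using ysh by simp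
    have t: "\<bar>t u\<bar> \<le> 1/2" if "u \<in> B" for u using bspec[OF t0 that] by linarith
    have yB: "y \<bullet> v = L * t v" if v: "v \<in> B" for v
    proof -
      have "(\<Sum>u\<in>B. t u * (u \<bullet> v)) = (\<Sum>u\<in>B. if u = v then t u else 0)"
        using inner v by (intro sum.cong) auto
      moreover have "n \<bullet> v = 0" using inner[of n v] v nB by auto
      ultimately show ?thesis using v fin by (simp add: y inner_add_left inner_sum_left)
    qed
    have "\<bar>y \<bullet> f k\<bar> \<le> L / 2" if "k \<noteq> i" for k
    proof -
      have "\<bar>y \<bullet> f k\<bar> = L * \<bar>t (f k)\<bar>" using yB[OF fk[OF that]] L by (simp add: abs_mult)
      also have "\<dots> \<le> L * (1/2)" using t[OF fk[OF that]] L by (intro mult_left_mono) auto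
      finally show ?thesis by simp
    qed
    moreover have "y \<bullet> n = h"
    proof -
      have "(\<Sum>u\<in>B. t u * (u \<bullet> n)) = 0" using inner nB by (intro sum.neutral) auto
      thus ?thesis using inner[of n n] by (simp add: y inner_add_left inner_sum_left)
    qed
    ultimately show "y \<in> {y. (\<forall>k. k \<noteq> i \<longrightarrow> \<bar>y \<bullet> f k\<bar> \<le> L / 2) \<and> \<bar>y \<bullet> n\<bar> \<le> H}" using h by simp
  next
    fix y assume "y \<in> {y. (\<forall>k. k \<noteq> i \<longrightarrow> \<bar>y \<bullet> f k\<bar> \<le> L / 2) \<and> \<bar>y \<bullet> n\<bar> \<le> H}"
    hence yk: "\<And>k. k \<noteq> i \<Longrightarrow> \<bar>y \<bullet> f k\<bar> \<le> L / 2" and yn: "\<bar>y \<bullet> n\<bar> \<le> H" by auto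
    define t where "t = (\<lambda>u. (y \<bullet> u) / L)"
    have t: "- 1/2 \<le> t u \<and> t u \<le> 1/2" if u: "u \<in> B" for u
    proof -
      obtain k where "k \<noteq> i" "u = f k" using fB[OF u] by blast
      hence "\<bar>y \<bullet> u\<bar> \<le> L / 2" using yk by simp
      hence "- (L / 2) \<le> y \<bullet> u \<and> y \<bullet> u \<le> L / 2" by linarith
      thus ?thesis using L by (simp add: t_def field_simps)
    qed
    have "y = (\<Sum>u\<in>insert n B. (y \<bullet> u) *\<^sub>R u)"
      using orthonormal_basis_expand[OF orth unit, of y] span fin by simp
    also have "\<dots> = (y \<bullet> n) *\<^sub>R n + (\<Sum>u\<in>B. (y \<bullet> u) *\<^sub>R u)" using nB fin by simp
    also have "(\<Sum>u\<in>B. (y \<bullet> u) *\<^sub>R u) = L *\<^sub>R (\<Sum>u\<in>B. t u *\<^sub>R u)"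
      using L by (simp add: t_def scaleR_sum_right)
    finally have "y = 0 + L *\<^sub>R (\<Sum>u\<in>B. t u *\<^sub>R u) + (y \<bullet> n) *\<^sub>R n" by (simp add: add.commute)
    moreover have "(\<Sum>u\<in>B. t u *\<^sub>R u) \<in> S" unfolding S using t by blast
    moreover have "y \<bullet> n \<in> {-H..H}" using yn by (auto simp: abs_le_iff)
    ultimately show "y \<in> cylinder 0 L H S n" unfolding cylinder_def by blast
  qed
  have "f i = n" by (simp add: f_def)
  thus ?thesis unfolding cube_frame_def using frame cyl by blast
qed

lemma unit_cubes_nonempty:
  assumes "norm (n :: real ^ 'd) = 1"
  shows "\<exists>S. S \<in> unit_cubes n"
proof -
  obtain B where B: "n \<in> B" "pairwise orthogonal B" "\<And>x. x \<in> B \<Longrightarrow> norm x = 1" "span B = UNIV"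
    using vector_in_orthonormal_basis[OF assms] by metis
  have "insert n (B - {n}) = B" using B(1) by blast
  hence "n \<notin> B - {n} \<and> pairwise orthogonal (insert n (B - {n})) \<and>
      (\<forall>u\<in>insert n (B - {n}). norm u = 1) \<and> span (insert n (B - {n})) = UNIV" using B by auto
  thus ?thesis unfolding unit_cubes_def by blast
qed

lemma norm_le_sum_frame: "frame f \<Longrightarrow> norm x \<le> (\<Sum>k\<in>UNIV. \<bar>x \<bullet> f k\<bar>)"
proof -
  assume f: "frame f"
  have "norm x = norm (\<Sum>k\<in>UNIV. (x \<bullet> f k) *\<^sub>R f k)"
    using from_frame_expand[OF f, of x] by (simp add: from_frame_def)
  also have "\<dots> \<le> (\<Sum>k\<in>UNIV. norm ((x \<bullet> f k) *\<^sub>R f k))" by (rule norm_sum)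
  finally show ?thesis using norm_frame[OF f] by simp
qed

context
  fixes f :: "'d::finite \<Rightarrow> real ^ 'd" and i :: 'd and S n and L H :: real
  assumes cf: "cube_frame S n i f" and L: "L > 0"
begin

lemma cube_frame_cylinder:
  "cylinder 0 L H S n = {y. (\<forall>k. k \<noteq> i \<longrightarrow> \<bar>y \<bullet> f k\<bar> \<le> L / 2) \<and> \<bar>y \<bullet> n\<bar> \<le> H}"
  using cf L unfolding cube_frame_def by blast

lemma lattice_cylinder_upper:
  assumes "x \<in> lattice_cylinder 0 L H S n"
  shows "k \<noteq> i \<Longrightarrow> \<bar>lattice_point x \<bullet> f k\<bar> \<le> L / 2" "\<bar>lattice_point x \<bullet> n\<bar> \<le> H"
  using assms interior_subset[of "cylinder 0 L H S n"] unfolding lattice_cylinder_def cube_frame_cylinder by auto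

lemma lattice_cylinder_lower:
  assumes "\<And>k. k \<noteq> i \<Longrightarrow> \<bar>lattice_point x \<bullet> f k\<bar> < L / 2" "\<bar>lattice_point x \<bullet> n\<bar> < H"
  shows "x \<in> lattice_cylinder 0 L H S n"
proof -
  let ?U = "(\<Inter>k\<in>UNIV - {i}. {y. \<bar>y \<bullet> f k\<bar> < L / 2}) \<inter> {y. \<bar>y \<bullet> n\<bar> < H}"
  have "open ?U"
    by (intro open_Int open_INT ballI open_Collect_less continuous_intros) auto
  moreover have "?U \<subseteq> cylinder 0 L H S n" unfolding cube_frame_cylinder by (auto intro: less_imp_le)
  ultimately have "?U \<subseteq> interior (cylinder 0 L H S n)" by (metis interior_maximal)
  moreover have "lattice_point x \<in> ?U" using assms by auto
  ultimately show ?thesis unfolding lattice_cylinder_def by blast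
qed

lemma lattice_cylinder_coord:
  assumes "x \<in> lattice_cylinder 0 L H S n" "L / 2 \<le> H"
  shows "\<bar>real_of_int (x $ k)\<bar> \<le> CARD('d) * H"
proof -
  have "\<bar>real_of_int (x $ k)\<bar> \<le> norm (lattice_point x)"
    using component_le_norm_cart[of "lattice_point x" k] by (simp add: lattice_point_def)
  also have "\<dots> \<le> (\<Sum>k\<in>UNIV. \<bar>lattice_point x \<bullet> f k\<bar>)" by (rule norm_le_sum_frame) (use cf in \<open>simp add: cube_frame_def\<close>)
  also have "\<dots> \<le> (\<Sum>k\<in>(UNIV :: 'd set). H)"
  proof (rule sum_mono)
    fix k show "\<bar>lattice_point x \<bullet> f k\<bar> \<le> H"
      using lattice_cylinder_upper(1)[OF assms(1), of k] lattice_cylinder_upper(2)[OF assms(1)] assms cf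
      by (cases "k = i") (auto simp: cube_frame_def)
  qed
  finally show ?thesis by simp
qed

end

lemma finite_bounded_lattice:
  assumes "\<And>x k. x \<in> V \<Longrightarrow> \<bar>real_of_int (x $ k)\<bar> \<le> b"
  shows "finite (V :: (int ^ 'd) set)"
proof (rule finite_subset)
  show "V \<subseteq> {(\<chi> k. - \<lceil>b\<rceil>)..(\<chi> k. \<lceil>b\<rceil>)}"
  proof
    fix x assume x: "x \<in> V"
    have "- \<lceil>b\<rceil> \<le> x $ k \<and> x $ k \<le> \<lceil>b\<rceil>" for k using assms[OF x, of k] by linarith
    thus "x \<in> {(\<chi> k. - \<lceil>b\<rceil>)..(\<chi> k. \<lceil>b\<rceil>)}" unfolding lattice_box_iff by simp
  qed
qed (rule finite_lattice_box)

lemma lattice_cylinder_coord_le: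
  fixes n :: "real ^ 'd" and L b :: real
  assumes S: "S \<in> unit_cubes n" and L: "L > 0" and x: "x \<in> lattice_cylinder 0 L L S n"
  shows "\<bar>real_of_int (x $ k)\<bar> \<le> CARD('d) * L"
proof -
  obtain f where cf: "cube_frame S n k f" using unit_cube_frame[OF S] by blast
  hence f: "frame f" "f k = n" by (simp_all add: cube_frame_def)
  show ?thesis by (rule lattice_cylinder_coord[OF cf L x]) (use L in simp)
qed

lemma finite_lattice_cylinder:
  fixes n :: "real ^ 'd" and L :: real
  assumes "S \<in> unit_cubes n" "L > 0"
  shows "finite (lattice_cylinder 0 L L S n)"
  by (rule finite_bounded_lattice) (rule lattice_cylinder_coord_le[OF assms])

lemma box_subset_lattice_cylinder:
  fixes n :: "real ^ 'd" and L b :: real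
  assumes S: "S \<in> unit_cubes n" and L: "L > 0" and x: "\<And>k. \<bar>real_of_int (x $ k)\<bar> \<le> b"
    and b: "CARD('d) * b < L / 2"
  shows "x \<in> lattice_cylinder 0 L L S n"
proof -
  obtain i :: 'd where True by simp
  obtain f where cf: "cube_frame S n i f" using unit_cube_frame[OF S] by blast
  hence f: "frame f" "f i = n" by (simp_all add: cube_frame_def)
  have "norm (lattice_point x) \<le> (\<Sum>k\<in>UNIV. \<bar>lattice_point x $ k\<bar>)" by (rule norm_le_l1_cart)
  also have "\<dots> \<le> (\<Sum>k\<in>(UNIV :: 'd set). b)" using x by (intro sum_mono) (simp add: lattice_point_def)
  finally have nx: "norm (lattice_point x) < L / 2" using b by simp
  have "\<bar>lattice_point x \<bullet> f k\<bar> < L / 2" for k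
    using Cauchy_Schwarz_ineq2[of "lattice_point x" "f k"] norm_frame[OF f(1)] nx by simp
  moreover from this[of i] have "\<bar>lattice_point x \<bullet> n\<bar> < L" using f(2) L by simp
  ultimately show ?thesis by (intro lattice_cylinder_lower[OF cf L])
qed

text \<open>
  The projection of the base of the cylinder along the direction \<open>i\<close> has the area \<open>\<bar>n $ i\<bar> * L ^ (d - 1)\<close>,
  and the error made by a bounded change of \<open>L\<close> is of lower order.
\<close>
lemma card_crossings_asymp:
  fixes n :: "real ^ 'd"
  assumes S: "S \<in> unit_cubes n" and c: "c > 0"
  shows "(\<lambda>N::nat. card (crossings n (lattice_cylinder 0 (c * real N) (c * real N) S n) i) / real N ^ (CARD('d) - 1))
    \<longlonglongrightarrow> \<bar>n $ i\<bar> * c ^ (CARD('d) - 1)"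
proof (cases "n $ i = 0")
  case True
  have "crossings n V i = {}" for V
    unfolding crossings_def above_def mem_Collect_eq lattice_point_step_inner True by auto
  thus ?thesis using True by simp
next
  case False
  obtain f where cf: "cube_frame S n i f" using unit_cube_frame[OF S] by blast
  hence f: "frame f" "f i = n" by (simp_all add: cube_frame_def)
  let ?d = "CARD('d) - 1"
  define s where "s = spread i n"
  define K where "K = (\<lambda>N::nat. real (card (crossings n (lattice_cylinder 0 (c * real N) (c * real N) S n) i)))"
  have bounds: "\<bar>n $ i\<bar> * (c * real N - 2 * (s + 1)) ^ ?d \<le> K N \<and> K N \<le> \<bar>n $ i\<bar> * (c * real N + 2 * s) ^ ?d"
    if N: "c * real N > 2 * (s + 1) + \<bar>n $ i\<bar>" for N
  proof -
    let ?L = "c * real N"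
    have L: "?L > 0" using N spread_nonneg[of i n] by (simp add: s_def)
    have a: "?L / 2 \<ge> spread i (f i) + 1" "?L > \<bar>f i $ i\<bar>"
      using N spread_nonneg[of i n] by (simp_all add: f(2) s_def)
    have ni: "f i $ i \<noteq> 0" using False f(2) by simp
    have up: "\<bar>lattice_point x \<bullet> f k\<bar> \<le> ?L / 2" if "x \<in> lattice_cylinder 0 ?L ?L S n" "k \<noteq> i" for x k
      using lattice_cylinder_upper(1)[OF cf L] that by blast
    have low: "x \<in> lattice_cylinder 0 ?L ?L S n"
      if "\<And>k. k \<noteq> i \<Longrightarrow> \<bar>lattice_point x \<bullet> f k\<bar> < ?L / 2" "\<bar>lattice_point x \<bullet> f i\<bar> < ?L" for x
      using that f(2) by (intro lattice_cylinder_lower[OF cf L]) auto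
    note bd = card_crossings_bounds[OF f(1) ni finite_lattice_cylinder[OF S L] up a low]
    have "\<bar>f i $ i\<bar> * (2 * (?L / 2 - (spread i (f i) + 1))) ^ ?d \<le> K N
        \<and> K N \<le> \<bar>f i $ i\<bar> * (2 * (?L / 2 + spread i (f i))) ^ ?d"
      unfolding K_def using bd f(2) by simp
    thus ?thesis by (simp add: f(2) s_def algebra_simps)
  qed
  have "filterlim (\<lambda>N. c * real N) at_top sequentially"
    using filterlim_tendsto_pos_mult_at_top[OF tendsto_const c filterlim_real_sequentially] .
  hence ev: "\<forall>\<^sub>F N in sequentially. c * real N > 2 * (s + 1) + \<bar>n $ i\<bar>"
    by (rule filterlim_at_top_dense[THEN iffD1, rule_format])
  have lim: "(\<lambda>N. \<bar>n $ i\<bar> * ((c * real N + b) ^ ?d / real N ^ ?d)) \<longlonglongrightarrow> \<bar>n $ i\<bar> * c ^ ?d" for b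
  proof -
    have "(\<lambda>N. b / real N) \<longlonglongrightarrow> 0" by (rule lim_const_over_n)
    hence "(\<lambda>N. \<bar>n $ i\<bar> * (c + b / real N) ^ ?d) \<longlonglongrightarrow> \<bar>n $ i\<bar> * (c + 0) ^ ?d"
      by (intro tendsto_intros)
    moreover have "\<forall>\<^sub>F N in sequentially. \<bar>n $ i\<bar> * (c + b / real N) ^ ?d = \<bar>n $ i\<bar> * ((c * real N + b) ^ ?d / real N ^ ?d)"
      using eventually_gt_at_top[of 0]
    proof eventually_elim
      case (elim N)
      hence "c + b / real N = (c * real N + b) / real N" by (simp add: field_simps)
      thus ?case by (simp add: power_divide)
    qed
    ultimately show ?thesis by (simp add: tendsto_cong)
  qed
  have "(\<lambda>N. K N / real N ^ ?d) \<longlonglongrightarrow> \<bar>n $ i\<bar> * c ^ ?d"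
  proof (rule tendsto_sandwich[OF _ _ lim[of "- (2 * (s + 1))"] lim[of "2 * s"]])
    show "\<forall>\<^sub>F N in sequentially. \<bar>n $ i\<bar> * ((c * real N + - (2 * (s + 1))) ^ ?d / real N ^ ?d) \<le> K N / real N ^ ?d"
      using ev
    proof eventually_elim
      case (elim N)
      have "\<bar>n $ i\<bar> * (c * real N - 2 * (s + 1)) ^ ?d / real N ^ ?d \<le> K N / real N ^ ?d"
        using bounds[OF elim] by (intro divide_right_mono) auto
      thus ?case by (simp only: times_divide_eq_right add_uminus_conv_diff)
    qed
    show "\<forall>\<^sub>F N in sequentially. K N / real N ^ ?d \<le> \<bar>n $ i\<bar> * ((c * real N + 2 * s) ^ ?d / real N ^ ?d)"
      using ev
    proof eventually_elim
      case (elim N)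
      have "K N / real N ^ ?d \<le> \<bar>n $ i\<bar> * (c * real N + 2 * s) ^ ?d / real N ^ ?d"
        using bounds[OF elim] by (intro divide_right_mono) auto
      thus ?case by simp
    qed
  qed
  thus ?thesis by (simp add: K_def)
qed

lemma card_flat_cut_asymp:
  fixes n :: "real ^ 'd"
  assumes S: "S \<in> unit_cubes n" and c: "c > 0"
  shows "(\<lambda>N::nat. card (flat_cut n (lattice_cylinder 0 (c * real N) (c * real N) S n)) / real N ^ (CARD('d) - 1))
    \<longlonglongrightarrow> norm1 n * c ^ (CARD('d) - 1)"
proof -
  let ?V = "\<lambda>N. lattice_cylinder 0 (c * real N) (c * real N) S n"
  have "(\<lambda>N. \<Sum>i\<in>UNIV. card (crossings n (?V N) i) / real N ^ (CARD('d) - 1))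
      \<longlonglongrightarrow> (\<Sum>i\<in>UNIV. \<bar>n $ i\<bar> * c ^ (CARD('d) - 1))"
    by (intro tendsto_sum card_crossings_asymp[OF S c])
  moreover have "\<forall>\<^sub>F N in sequentially. (\<Sum>i\<in>UNIV. card (crossings n (?V N) i) / real N ^ (CARD('d) - 1))
      = card (flat_cut n (?V N)) / real N ^ (CARD('d) - 1)"
    using eventually_gt_at_top[of 0]
  proof eventually_elim
    case (elim N)
    hence "finite (?V N)" using c by (intro finite_lattice_cylinder[OF S]) simp
    thus ?case by (simp add: card_flat_cut sum_divide_distrib)
  qed
  ultimately show ?thesis by (simp add: tendsto_cong norm1_def sum_distrib_right)
qed

section \<open>Probability of disconnection\<close>

text \<open>
  An open path that avoids the flat cut stays on one side of the hyperplane.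
\<close>
lemma flat_cut_closed_imp_disconnection:
  assumes "\<omega> \<subseteq> edges (lattice_cylinder 0 L H S n)" "\<omega> \<inter> flat_cut n (lattice_cylinder 0 L H S n) = {}"
  shows "\<omega> \<in> disconnection 0 L H S n"
proof -
  let ?V = "lattice_cylinder 0 L H S n"
  have same: "x \<in> above n \<longleftrightarrow> y \<in> above n" if xy: "{x, y} \<in> \<omega>" for x y
  proof -
    have e: "x \<in> ?V" "y \<in> ?V" "adjacent x y" "adjacent y x"
      using assms(1) xy edge_mem_iff adjacent_sym by blast+
    have "{x, y} \<notin> flat_cut n ?V" "{y, x} \<notin> flat_cut n ?V"
      using assms(2) xy by (auto simp: insert_commute)
    thus ?thesis using e unfolding flat_cut_def by blast
  qed
  have "x \<in> above n \<longleftrightarrow> y \<in> above n" if "(x, y) \<in> connection \<omega>" for x y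
    using that unfolding connection_def
  proof (induction rule: rtrancl_induct)
    case (step y z)
    thus ?case using same[of y z] by simp
  qed simp
  thus ?thesis
    using assms(1) unfolding disconnection_def upper_boundary_def lower_boundary_def above_def by auto
qed

context
  fixes q \<beta> L H :: real and J :: "(int ^ 'd) set \<Rightarrow> real" and n :: "real ^ 'd" and S
  assumes q: "q \<ge> 1" and \<beta>: "\<beta> \<ge> 0" and J: "\<And>e. e \<in> edges UNIV \<Longrightarrow> J e \<ge> 0"
    and fin: "finite (lattice_cylinder 0 L H S n)"
begin

abbreviation (input) "cylV \<equiv> lattice_cylinder 0 L H S n"
abbreviation (input) "discP \<equiv> rc_prob q \<beta> J (edges cylV) (wired (edges cylV)) (disconnection 0 L H S n)"

lemma cylinder_edges: "finite (edges cylV)" "edges cylV \<subseteq> edges UNIV"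
  "\<And>e. e \<in> edges cylV \<Longrightarrow> J e \<ge> 0"
  using fin finite_edges edges_mono[of cylV UNIV] J by auto

lemma rc_prob_disconnection_ge: "exp (- \<beta> * (\<Sum>e\<in>flat_cut n cylV. J e)) \<le> discP"
proof -
  have "exp (- \<beta> * (\<Sum>e\<in>flat_cut n cylV. J e)) = (\<Prod>e\<in>flat_cut n cylV. exp (- \<beta> * J e))"
    using cylinder_edges(1) flat_cut_subset finite_subset
    by (subst exp_sum[symmetric]) (auto simp: sum_distrib_left sum_negf intro: finite_subset)
  also have "\<dots> \<le> rc_prob q \<beta> J (edges cylV) (wired (edges cylV)) {\<omega>. \<omega> \<inter> flat_cut n cylV = {}}"
    by (rule rc_prob_closed_ge[OF q \<beta> cylinder_edges flat_cut_subset])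
  also have "\<dots> \<le> discP"
    by (rule rc_prob_mono[OF q \<beta> cylinder_edges]) (auto intro: flat_cut_closed_imp_disconnection)
  finally show ?thesis .
qed

lemma surface_tension_le:
  assumes "L > 0"
  shows "surface_tension q \<beta> J 0 L H S n \<le> \<beta> * (\<Sum>e\<in>flat_cut n cylV. J e) / L ^ (CARD('d) - 1)"
proof -
  have "- \<beta> * (\<Sum>e\<in>flat_cut n cylV. J e) \<le> ln discP"
    using rc_prob_disconnection_ge ln_ge_iff[of discP] by (meson exp_gt_zero less_le_trans)
  hence "- ln discP / L ^ (CARD('d) - 1) \<le> \<beta> * (\<Sum>e\<in>flat_cut n cylV. J e) / L ^ (CARD('d) - 1)"
    using assms by (intro divide_right_mono) auto
  thus ?thesis by (simp add: surface_tension_def Let_def)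
qed

lemma surface_tension_nonneg:
  assumes "L > 0"
  shows "surface_tension q \<beta> J 0 L H S n \<ge> 0"
proof -
  have "discP \<le> 1" by (rule rc_prob_le_one[OF q \<beta> cylinder_edges])
  moreover have "discP > 0" using rc_prob_disconnection_ge exp_gt_zero less_le_trans by blast
  ultimately have "ln discP \<le> 0" by simp
  hence "- (1 / L ^ (CARD('d) - 1)) * ln discP \<ge> 0"
    using assms by (intro mult_nonpos_nonpos) auto
  thus ?thesis by (simp add: surface_tension_def Let_def)
qed

end

text \<open>
  The weight per edge for which the sum over connected sets through a given edge is at most one; the
  exponent contains the bound on the number of edges near to an edge.
\<close>
definition peierls_weight :: "'d::finite itself \<Rightarrow> real" where
  "peierls_weight _ = 1 / 2 ^ Suc (2 ^ (3 ^ CARD('d)))"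

lemma peierls_weight: "0 < peierls_weight TYPE('d::finite)" "peierls_weight TYPE('d) \<le> 1"
  by (simp_all add: peierls_weight_def del: power_Suc)

text \<open>
  The Peierls argument. The probability is at most the sum of \<open>z ^ card (G \<inter> edges V)\<close> over all possible
  interfaces \<open>G\<close>. Since \<open>G\<close> has at least as many edges in the cylinder as the flat cut, the factor
  \<open>z / w\<close> can be extracted to that power. What remains is at most \<open>w ^ card G\<close>, up to the edges outside
  the cylinder, whose number is bounded by the flat cut of the box. The sum of \<open>w ^ card G\<close> over the
  connected sets is at most the number of possible roots.
\<close>
lemma rc_prob_disconnection_le:
  fixes q \<beta> j L H :: real and n :: "real ^ 'd" and S and M :: int
  defines "V \<equiv> lattice_cylinder 0 L H S n"
  defines "W \<equiv> {(\<chi> k. - M)..(\<chi> k. M)} :: (int ^ 'd) set"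
  defines "z \<equiv> q * exp (- \<beta> * j)" and "w \<equiv> peierls_weight TYPE('d)"
  assumes q: "q \<ge> 1" and \<beta>: "\<beta> \<ge> 0" and j: "j \<ge> 0" and n: "n \<noteq> 0"
    and VM: "\<And>x k. x \<in> V \<Longrightarrow> \<bar>x $ k\<bar> < M" and M: "M > 0" and zw: "z \<le> w"
  shows "rc_prob q \<beta> (\<lambda>_. j) (edges V) (wired (edges V)) (disconnection 0 L H S n)
    \<le> card (edges W) * (z / w) ^ card (flat_cut n V) * (1 / w) ^ card (flat_cut n W)"
proof -
  let ?E = "edges V" and ?K = "card (flat_cut n V)" and ?F = "card (flat_cut n W)"
  let ?P = "rc_prob q \<beta> (\<lambda>_. j) ?E (wired ?E)"
  define \<G> where "\<G> = {G. G \<subseteq> edges W \<and> G \<noteq> {} \<and> G - ?E \<subseteq> flat_cut n W \<and> ?K \<le> card (G \<inter> ?E) \<and>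
      (\<forall>P. P \<subseteq> G \<longrightarrow> P \<noteq> {} \<longrightarrow> P \<noteq> G \<longrightarrow> (\<exists>e\<in>P. \<exists>f\<in>G - P. near e f))}"
  have finW: "finite W" unfolding W_def by (rule finite_lattice_box)
  have finEW: "finite (edges W)" by (rule finite_edges[OF finW])
  have "V \<subseteq> W"
  proof
    fix x assume x: "x \<in> V"
    have "- M \<le> x $ k \<and> x $ k \<le> M" for k using VM[OF x, of k] by linarith
    thus "x \<in> W" unfolding W_def lattice_box_iff by simp
  qed
  hence finV: "finite V" using finW finite_subset by blast
  have fin\<G>: "finite \<G>"
    by (rule finite_subset[of _ "Pow (edges W)"]) (use finEW in \<open>auto simp: \<G>_def\<close>)
  have E: "finite ?E" "?E \<subseteq> edges UNIV" using finite_edges[OF finV] edges_mono[of V UNIV] by auto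
  have z: "z > 0" and w: "w > 0" "w \<le> 1" using q peierls_weight[where 'd = 'd] by (simp_all add: z_def w_def)
  have each: "?P {\<omega>. \<omega> \<inter> (G \<inter> ?E) = {}} \<le> (z / w) ^ ?K * (1 / w) ^ ?F * w ^ card G" if G: "G \<in> \<G>" for G
  proof -
    let ?c = "card (G \<inter> ?E)"
    have finG: "finite G" using G finEW finite_subset by (auto simp: \<G>_def)
    have "card G = ?c + card (G - ?E)" using finG by (metis card_Int_Diff)
    also have "card (G - ?E) \<le> ?F"
    proof (rule card_mono)
      show "finite (flat_cut n W)" by (rule finite_subset[OF flat_cut_subset finEW])
      show "G - ?E \<subseteq> flat_cut n W" using G unfolding \<G>_def by blast
    qed
    finally have cG: "card G \<le> ?c + ?F" by simp
    have cK: "?K \<le> ?c" using G by (simp add: \<G>_def)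
    have "?P {\<omega>. \<omega> \<inter> (G \<inter> ?E) = {}} \<le> (\<Prod>e\<in>G \<inter> ?E. q * exp (- \<beta> * j))"
      by (rule rc_prob_closed_le[OF q \<beta> E]) (use j in auto)
    also have "\<dots> = z ^ ?c" by (simp add: z_def)
    also have "\<dots> = (z / w) ^ ?c * w ^ ?c" using w by (simp add: power_divide)
    also have "\<dots> \<le> (z / w) ^ ?K * w ^ ?c"
      using z w zw cK by (intro mult_right_mono power_decreasing) auto
    also have "w ^ ?c = (1 / w) ^ ?F * w ^ (?c + ?F)" using w by (simp add: power_add power_divide)
    also have "(z / w) ^ ?K * ((1 / w) ^ ?F * w ^ (?c + ?F)) \<le> (z / w) ^ ?K * ((1 / w) ^ ?F * w ^ card G)"
      using z w cG by (intro mult_left_mono power_decreasing) auto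
    finally show ?thesis by (simp add: mult.assoc)
  qed
  have "?P (disconnection 0 L H S n) \<le> ?P (\<Union>G\<in>\<G>. {\<omega>. \<omega> \<inter> (G \<inter> ?E) = {}})"
  proof (rule rc_prob_mono[OF q \<beta> E])
    fix \<omega> assume "\<omega> \<in> disconnection 0 L H S n"
    note G = disconnection_interface[OF n VM[unfolded V_def] M this]
    show "\<omega> \<in> (\<Union>G\<in>\<G>. {\<omega>. \<omega> \<inter> (G \<inter> ?E) = {}})"
      unfolding UN_iff
    proof (rule bexI)
      let ?X = "{x \<in> V. \<exists>y\<in>upper_boundary 0 L H S n. (y, x) \<in> connection \<omega>} \<union> (above n - V)"
      let ?G = "interface W ?X (\<chi> k. (if 0 \<le> n $ k then 1 else - 1) * M) (\<chi> k. - (if 0 \<le> n $ k then 1 else - 1) * M)"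
      show "\<omega> \<in> {\<omega>. \<omega> \<inter> (?G \<inter> ?E) = {}}" using G(3) unfolding V_def W_def by blast
      show "?G \<in> \<G>"
        using G(1,2,4,5,6) unfolding \<G>_def V_def W_def by simp
    qed
  qed (use j in auto)
  also have "\<dots> \<le> (\<Sum>G\<in>\<G>. ?P {\<omega>. \<omega> \<inter> (G \<inter> ?E) = {}})"
    by (rule rc_prob_UN_le[OF q \<beta> E]) (use j fin\<G> in auto)
  also have "\<dots> \<le> (\<Sum>G\<in>\<G>. (z / w) ^ ?K * (1 / w) ^ ?F * w ^ card G)"
    by (rule sum_mono) (rule each)
  also have "\<dots> = (z / w) ^ ?K * (1 / w) ^ ?F * (\<Sum>G\<in>\<G>. w ^ card G)" by (simp add: sum_distrib_left)
  also have "\<dots> \<le> (z / w) ^ ?K * (1 / w) ^ ?F * card (edges W)"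
  proof (rule mult_left_mono)
    show "(\<Sum>G\<in>\<G>. w ^ card G) \<le> card (edges W)"
      unfolding w_def peierls_weight_def
    proof (rule sum_rooted_connected_sets_le_card[OF finEW near_degree])
      fix G P assume "G \<in> \<G>" "P \<subseteq> G" "P \<noteq> {}" "P \<noteq> G"
      thus "\<exists>e\<in>P. \<exists>f\<in>G - P. near e f" unfolding \<G>_def by blast
    qed (auto simp: \<G>_def)
    show "0 \<le> (z / w) ^ ?K * (1 / w) ^ ?F" using z w by simp
  qed
  finally show ?thesis by (simp only: mult_ac)
qed

section \<open>Bounds on the minimal surface tension\<close>

lemma card_edges_box_le:
  fixes M :: int
  assumes "M > 0"
  shows "real (card (edges ({(\<chi> k. - M)..(\<chi> k. M)} :: (int ^ 'd) set))) \<le> (2 * M + 1) ^ CARD('d) * CARD('d)"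
proof -
  let ?W = "{(\<chi> k. - M)..(\<chi> k. M)} :: (int ^ 'd) set"
  have "card (edges ?W) \<le> card ((\<lambda>(x, i). {x, x + axis i 1}) ` (?W \<times> UNIV))"
    by (rule card_mono[OF _ edges_eq_image]) (simp add: finite_lattice_box)
  also have "\<dots> \<le> card (?W \<times> (UNIV :: 'd set))" by (rule card_image_le) (simp add: finite_lattice_box)
  also have "\<dots> = card ?W * CARD('d)" by (rule card_cartesian_product)
  also have "card ?W = nat (2 * M + 1) ^ CARD('d)"
    using assms by (subst card_lattice_box) (auto simp: less_eq_vec_def algebra_simps)
  finally have "real (card (edges ?W)) \<le> real (nat (2 * M + 1)) ^ CARD('d) * CARD('d)"
    by (metis of_nat_le_iff of_nat_mult of_nat_power)
  thus ?thesis using assms by simp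
qed

lemma flat_cut_mono: "V \<subseteq> W \<Longrightarrow> flat_cut n V \<subseteq> flat_cut n W"
  unfolding flat_cut_def by blast

text \<open>
  The loss in the Peierls bound per unit area, uniform over the unit vectors \<open>n\<close> and independent of
  \<open>\<beta>\<close>. Its parts come from the factor \<open>q / w\<close> per interface edge, from the flat cut of the
  surrounding box, and from the logarithm of the number of roots.
\<close>
definition peierls_const :: "'d::finite itself \<Rightarrow> real \<Rightarrow> real" where
  "peierls_const _ q = CARD('d) * (ln q - ln (peierls_weight TYPE('d)))
     - ln (peierls_weight TYPE('d)) * CARD('d) * real (2 * CARD('d) * (CARD('d) + 1) + 1) ^ (CARD('d) - 1)
     + CARD('d) * (2 * CARD('d) + 3)"

lemma norm1_le: "norm (n :: real ^ 'd) = 1 \<Longrightarrow> norm1 n \<le> CARD('d)"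
proof -
  assume n: "norm n = 1"
  have "\<bar>n $ k\<bar> \<le> 1" for k using component_le_norm_cart[of n k] n by simp
  hence "norm1 n \<le> (\<Sum>k\<in>(UNIV :: 'd set). 1)" unfolding norm1_def by (intro sum_mono) simp
  thus ?thesis by simp
qed

lemma norm1_nonneg: "norm1 n \<ge> 0"
  unfolding norm1_def by (simp add: sum_nonneg)

text \<open>
  The box with \<open>M = (d + 1) * N\<close> contains the cylinder of size \<open>N\<close> in its interior and is itself
  contained in the cylinder of size \<open>c * N\<close>, so its flat cut is of the order \<open>N ^ (d - 1)\<close>. The
  logarithm of the number of roots is at most of the order \<open>N\<close>, which is dominated because \<open>d \<ge> 2\<close>.
\<close>
lemma surface_tension_ge:
  fixes n :: "real ^ 'd" and N :: nat and q \<beta> j :: real and S :: "(real ^ 'd) set"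
  defines "w \<equiv> peierls_weight TYPE('d)" and "V \<equiv> \<lambda>c. lattice_cylinder 0 (c * real N) (c * real N) S n"
    and "c \<equiv> real (2 * CARD('d) * (CARD('d) + 1) + 1)"
  assumes d: "CARD('d) \<ge> 2" and q: "q \<ge> 1" and \<beta>: "\<beta> \<ge> 0" and j: "j \<ge> 0"
    and S: "S \<in> unit_cubes n" and n: "norm n = 1" and N: "N > 0"
    and A: "\<beta> * j - ln q + ln w \<ge> 0"
  shows "card (flat_cut n (V 1)) / real N ^ (CARD('d) - 1) * (\<beta> * j - ln q + ln w)
      + ln w * (card (flat_cut n (V c)) / real N ^ (CARD('d) - 1)) - CARD('d) * (2 * CARD('d) + 3)
    \<le> surface_tension q \<beta> (\<lambda>_. j) 0 (real N) (1 * real N) S n"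
proof -
  let ?d = "CARD('d)"
  define M where "M = (int ?d + 1) * int N"
  define W where "W = ({(\<chi> k. - M)..(\<chi> k. M)} :: (int ^ 'd) set)"
  define z where "z = q * exp (- \<beta> * j)"
  define P where "P = rc_prob q \<beta> (\<lambda>_. j) (edges (V 1)) (wired (edges (V 1))) (disconnection 0 (real N) (real N) S n)"
  let ?K = "real (card (flat_cut n (V 1)))" and ?F = "real (card (flat_cut n W))" and ?F' = "real (card (flat_cut n (V c)))"
  have w: "0 < w" "w \<le> 1" using peierls_weight[where 'd = 'd] by (simp_all add: w_def)
  have z: "z > 0" using q by (simp add: z_def)
  have lnz: "ln z = ln q - \<beta> * j" using q by (simp add: z_def ln_mult)
  have zw: "z \<le> w" using A lnz z w by (metis add.commute diff_ge_0_iff_ge diff_minus_eq_add ln_le_cancel_iff minus_diff_eq uminus_add_conv_diff)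
  have N0: "real N > 0" using N by simp
  have c: "c > 0" unfolding c_def of_nat_0_less_iff by simp
  have n0: "n \<noteq> 0" using n by auto
  have V1: "V 1 = lattice_cylinder 0 (real N) (real N) S n" by (simp add: V_def)
  have M: "M > 0" using N by (simp add: M_def)
  have VM: "\<bar>x $ k\<bar> < M" if "x \<in> V 1" for x k
  proof -
    have "\<bar>real_of_int (x $ k)\<bar> \<le> ?d * real N"
      using lattice_cylinder_coord_le[OF S N0] that by (simp add: V1)
    also have "\<dots> < real_of_int M" using N by (simp add: M_def algebra_simps)
    finally show ?thesis by linarith
  qed
  have "P \<le> card (edges W) * (z / w) ^ card (flat_cut n (V 1)) * (1 / w) ^ card (flat_cut n W)"
    unfolding P_def V1 W_def z_def w_def
    by (rule rc_prob_disconnection_le[OF q \<beta> j n0 VM[unfolded V1] M zw[unfolded z_def w_def]])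
  moreover have P: "P > 0"
  proof -
    have "exp (- \<beta> * (\<Sum>e\<in>flat_cut n (V 1). j)) \<le> P"
      unfolding P_def V1 by (rule rc_prob_disconnection_ge[OF q \<beta>]) (use j finite_lattice_cylinder[OF S N0] in auto)
    thus ?thesis by (meson exp_gt_zero less_le_trans)
  qed
  ultimately have "ln P \<le> ln (card (edges W) * (z / w) ^ card (flat_cut n (V 1)) * (1 / w) ^ card (flat_cut n W))"
    by (intro ln_mono) auto
  also have "\<dots> = ln (card (edges W)) + ?K * (ln z - ln w) - ?F * ln w"
  proof -
    have "card (edges W) \<noteq> 0"
    proof
      assume "card (edges W) = 0"
      hence "P \<le> 0" using \<open>P \<le> _\<close> by simp
      thus False using P by simp
    qed
    thus ?thesis using z w by (simp add: ln_mult ln_realpow ln_div)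
  qed
  finally have lnP: "ln P \<le> ln (card (edges W)) - ?K * (\<beta> * j - ln q + ln w) - ?F * ln w"
    by (simp add: lnz algebra_simps)
  have WV: "W \<subseteq> V c"
  proof
    fix x assume x: "x \<in> W"
    have "\<bar>real_of_int (x $ k)\<bar> \<le> real_of_int M" for k
    proof -
      have "- M \<le> x $ k \<and> x $ k \<le> M" using x unfolding W_def lattice_box_iff by simp
      thus ?thesis by linarith
    qed
    moreover have "?d * real_of_int M < c * real N / 2"
      using N by (simp add: M_def c_def algebra_simps)
    ultimately show "x \<in> V c" unfolding V_def using c N0
      by (intro box_subset_lattice_cylinder[OF S]) auto
  qed
  have "finite (V c)" unfolding V_def using c N0 by (intro finite_lattice_cylinder[OF S]) simp
  hence "finite (flat_cut n (V c))" using finite_edges flat_cut_subset finite_subset by metis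
  hence "?F \<le> ?F'" using flat_cut_mono[OF WV] by (simp add: card_mono)
  hence "?F' * ln w \<le> ?F * ln w" using w by (intro mult_right_mono_neg) auto
  moreover have "ln (card (edges W)) \<le> ?d * (2 * ?d + 3) * real N ^ (?d - 1)"
  proof (cases "card (edges W) = 0")
    case False
    have "real (card (edges W)) \<le> (2 * M + 1) ^ ?d * ?d"
      unfolding W_def by (rule card_edges_box_le[OF M])
    hence "ln (card (edges W)) \<le> ln ((2 * real_of_int M + 1) ^ ?d * ?d)"
      using False by (intro ln_mono) auto
    also have "\<dots> = ?d * ln (2 * real_of_int M + 1) + ln ?d"
      using M by (simp add: ln_mult ln_realpow)
    also have "\<dots> \<le> ?d * (2 * real_of_int M) + ?d"
    proof (intro add_mono mult_left_mono)
      show "ln (2 * real_of_int M + 1) \<le> 2 * real_of_int M"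
        using ln_add_one_self_le_self[of "2 * real_of_int M"] M by (simp add: add.commute)
      show "ln (real ?d) \<le> real ?d" using ln_le_minus_one[of "real ?d"] by simp
    qed auto
    also have "\<dots> \<le> ?d * (2 * real_of_int M) + ?d * real N" using N by simp
    also have "\<dots> = ?d * (2 * ?d + 3) * real N" by (simp add: M_def algebra_simps)
    also have "\<dots> \<le> ?d * (2 * ?d + 3) * real N ^ (?d - 1)"
      using d N power_increasing[of 1 "?d - 1" "real N"] by (intro mult_left_mono) auto
    finally show ?thesis .
  qed simp
  ultimately have "- ln P \<ge> ?K * (\<beta> * j - ln q + ln w) + ?F' * ln w - ?d * (2 * ?d + 3) * real N ^ (?d - 1)"
    using lnP by linarith
  hence "(?K * (\<beta> * j - ln q + ln w) + ?F' * ln w - ?d * (2 * ?d + 3) * real N ^ (?d - 1)) / real N ^ (?d - 1)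
      \<le> - ln P / real N ^ (?d - 1)"
    using N0 by (intro divide_right_mono) auto
  moreover have "surface_tension q \<beta> (\<lambda>_. j) 0 (real N) (1 * real N) S n = - ln P / real N ^ (?d - 1)"
    by (simp add: surface_tension_def Let_def P_def V1)
  moreover have "(?K * (\<beta> * j - ln q + ln w) + ?F' * ln w - ?d * (2 * ?d + 3) * real N ^ (?d - 1)) / real N ^ (?d - 1)
     = ?K / real N ^ (?d - 1) * (\<beta> * j - ln q + ln w) + ln w * (?F' / real N ^ (?d - 1)) - ?d * (2 * ?d + 3)"
    using N0 by (simp add: field_simps)
  ultimately show ?thesis by (simp only:)
qed

text \<open>
  If \<open>\<beta> * j\<close> is so small that the Peierls argument does not apply, then \<open>\<beta> * j * norm1 n\<close> is
  at most the constant, and the bound holds because surface tensions are nonnegative.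
\<close>
lemma min_surface_tension_ge:
  fixes n :: "real ^ 'd" and q \<beta> j t :: real
  assumes d: "CARD('d) \<ge> 2" and q: "q \<ge> 1" and \<beta>: "\<beta> \<ge> 0" and j: "j \<ge> 0" and n: "norm n = 1"
    and S: "S \<in> unit_cubes n"
    and lim: "(\<lambda>N::nat. surface_tension q \<beta> (\<lambda>_. j) 0 (real N) (1 * real N) S n) \<longlonglongrightarrow> t"
  shows "\<beta> * j * norm1 n - peierls_const TYPE('d) q \<le> t"
proof -
  let ?d = "CARD('d)"
  define w where "w = peierls_weight TYPE('d)"
  define c where "c = real (2 * ?d * (?d + 1) + 1)"
  define A where "A = \<beta> * j - ln q + ln w"
  have w: "0 < w" "w \<le> 1" using peierls_weight[where 'd = 'd] by (simp_all add: w_def)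
  have lnw: "ln w \<le> 0" using w by simp
  have lnq: "ln q \<ge> 0" using q by simp
  have n1: "0 \<le> norm1 n" "norm1 n \<le> ?d" using norm1_nonneg norm1_le[OF n] by auto
  have c: "c > 0" unfolding c_def of_nat_0_less_iff by simp
  have C: "peierls_const TYPE('d) q = ?d * (ln q - ln w) - ln w * ?d * c ^ (?d - 1) + ?d * (2 * ?d + 3)"
    by (simp add: peierls_const_def w_def c_def)
  have b1: "norm1 n * (ln q - ln w) \<le> ?d * (ln q - ln w)" using n1 lnq lnw by (intro mult_right_mono) auto
  have b2: "ln w * ?d * c ^ (?d - 1) \<le> ln w * (norm1 n * c ^ (?d - 1))"
    using n1 lnw c by (simp add: mult.assoc) (intro mult_left_mono_neg mult_right_mono, auto)
  have b3: "ln w * ?d * c ^ (?d - 1) \<le> 0" using lnw c by (simp add: mult_nonpos_nonneg)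
  show ?thesis
  proof (cases "A \<ge> 0")
    case True
    let ?V = "\<lambda>c N. lattice_cylinder 0 (c * real N) (c * real N) S n"
    have "(\<lambda>N. card (flat_cut n (?V 1 N)) / real N ^ (?d - 1) * A
        + ln w * (card (flat_cut n (?V c N)) / real N ^ (?d - 1)) - ?d * (2 * ?d + 3))
      \<longlonglongrightarrow> norm1 n * 1 ^ (?d - 1) * A + ln w * (norm1 n * c ^ (?d - 1)) - ?d * (2 * ?d + 3)"
      by (intro tendsto_intros card_flat_cut_asymp[OF S] c) simp
    hence "norm1 n * 1 ^ (?d - 1) * A + ln w * (norm1 n * c ^ (?d - 1)) - ?d * (2 * ?d + 3) \<le> t"
    proof (rule tendsto_le[OF sequentially_bot lim])
      show "\<forall>\<^sub>F N in sequentially. card (flat_cut n (?V 1 N)) / real N ^ (?d - 1) * A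
          + ln w * (card (flat_cut n (?V c N)) / real N ^ (?d - 1)) - ?d * (2 * ?d + 3)
        \<le> surface_tension q \<beta> (\<lambda>_. j) 0 (real N) (1 * real N) S n"
        using eventually_gt_at_top[of 0]
      proof eventually_elim
        case (elim N)
        show ?case unfolding A_def w_def c_def
          by (rule surface_tension_ge[OF d q \<beta> j S n elim]) (use True in \<open>simp add: A_def w_def\<close>)
      qed
    qed
    thus ?thesis using b1 b2 unfolding C A_def by (simp add: algebra_simps)
  next
    case False
    have "t \<ge> 0"
    proof (rule tendsto_lowerbound[OF lim])
      show "\<forall>\<^sub>F N in sequentially. 0 \<le> surface_tension q \<beta> (\<lambda>_. j) 0 (real N) (1 * real N) S n"
        using eventually_gt_at_top[of 0]
      proof eventually_elim
        case (elim N)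
        hence "real N > 0" by simp
        thus ?case using finite_lattice_cylinder[OF S, of "real N"] j
          by (intro surface_tension_nonneg[OF q \<beta>]) auto
      qed
    qed simp
    moreover have "norm1 n * (\<beta> * j) \<le> norm1 n * (ln q - ln w)"
      using False n1 by (intro mult_left_mono) (auto simp: A_def)
    moreover have "0 \<le> real ?d * (2 * real ?d + 3)" by simp
    moreover have "\<beta> * j * norm1 n = norm1 n * (\<beta> * j)" by simp
    ultimately show ?thesis using b1 b3 unfolding C by linarith
  qed
qed

lemma min_surface_tension_le:
  fixes n :: "real ^ 'd" and q \<beta> j t :: real
  assumes q: "q \<ge> 1" and \<beta>: "\<beta> \<ge> 0" and j: "j \<ge> 0" and S: "S \<in> unit_cubes n"
    and lim: "(\<lambda>N::nat. surface_tension q \<beta> (\<lambda>_. j) 0 (real N) (1 * real N) S n) \<longlonglongrightarrow> t"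
  shows "t \<le> \<beta> * j * norm1 n"
proof -
  let ?V = "\<lambda>N. lattice_cylinder 0 (1 * real N) (1 * real N) S n"
  have lim': "(\<lambda>N. \<beta> * j * (card (flat_cut n (?V N)) / real N ^ (CARD('d) - 1))) \<longlonglongrightarrow> \<beta> * j * (norm1 n * 1 ^ (CARD('d) - 1))"
    by (intro tendsto_intros card_flat_cut_asymp[OF S]) simp
  have "t \<le> \<beta> * j * (norm1 n * 1 ^ (CARD('d) - 1))"
  proof (rule tendsto_le[OF sequentially_bot lim' lim])
    show "\<forall>\<^sub>F N in sequentially. surface_tension q \<beta> (\<lambda>_. j) 0 (real N) (1 * real N) S n
        \<le> \<beta> * j * (card (flat_cut n (?V N)) / real N ^ (CARD('d) - 1))"
      using eventually_gt_at_top[of 0]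
    proof eventually_elim
      case (elim N)
      hence N: "real N > 0" by simp
      have "surface_tension q \<beta> (\<lambda>_. j) 0 (real N) (1 * real N) S n
          \<le> \<beta> * (\<Sum>e\<in>flat_cut n (lattice_cylinder 0 (real N) (1 * real N) S n). j) / real N ^ (CARD('d) - 1)"
        by (rule surface_tension_le[OF q \<beta>]) (use j N finite_lattice_cylinder[OF S N] in auto)
      thus ?case by (simp add: mult_ac)
    qed
  qed
  thus ?thesis by simp
qed

section \<open>Upper bound on the rate function\<close>

lemma coupling_law_space: "coupling_law \<mu> \<Longrightarrow> space \<mu> = {0..1}"
  by (metis coupling_law_def inf_top.right_neutral sets_eq_imp_space_eq space_borel space_restrict_space)

lemma coupling_law_borel: "coupling_law \<mu> \<Longrightarrow> (\<lambda>x. x) \<in> borel_measurable \<mu>"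
proof -
  assume "coupling_law \<mu>"
  hence "sets \<mu> = sets (restrict_space borel {0..1})" by (simp add: coupling_law_def)
  moreover have "(\<lambda>x::real. x) \<in> borel_measurable (restrict_space borel {0..1})"
    by (rule measurable_restrict_space1) simp
  ultimately show ?thesis using measurable_cong_sets by blast
qed

lemma
  assumes "coupling_law \<mu>"
  shows J_min_nonneg: "0 \<le> J_min \<mu>"
    and J_min_approx: "\<epsilon> > 0 \<Longrightarrow> measure \<mu> {x \<in> space \<mu>. x < J_min \<mu> + \<epsilon>} > 0"
proof -
  interpret prob_space \<mu> using assms by (simp add: coupling_law_def)
  define A where "A = {l. 0 \<le> l \<and> measure \<mu> {j \<in> space \<mu>. j < l} > 0}"
  have "{j \<in> space \<mu>. j < 2} = space \<mu>" unfolding coupling_law_space[OF assms] by auto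
  hence "2 \<in> A" by (simp add: A_def prob_space)
  hence ne: "A \<noteq> {}" by blast
  have J: "J_min \<mu> = Inf A" by (simp add: J_min_def A_def)
  show "0 \<le> J_min \<mu>" unfolding J using ne by (intro cInf_greatest) (auto simp: A_def)
  show "measure \<mu> {x \<in> space \<mu>. x < J_min \<mu> + \<epsilon>} > 0" if eps: "\<epsilon> > 0"
  proof -
    obtain l where l: "l \<in> A" "l < J_min \<mu> + \<epsilon>"
      using cInf_lessD[OF ne, of "J_min \<mu> + \<epsilon>"] eps J by auto
    note [measurable] = coupling_law_borel[OF assms]
    have "measure \<mu> {j \<in> space \<mu>. j < l} \<le> measure \<mu> {x \<in> space \<mu>. x < J_min \<mu> + \<epsilon>}"
      using l(2) by (intro finite_measure_mono) auto
    thus ?thesis using l(1) by (simp add: A_def)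
  qed
qed

text \<open>
  The surface tension is built by measurable operations from the finitely many couplings of the edges
  in the cylinder.
\<close>
lemma surface_tension_measurable:
  fixes n :: "real ^ 'd"
  assumes \<mu>: "coupling_law \<mu>"
  shows "(\<lambda>J. surface_tension q \<beta> J x L H S n) \<in> borel_measurable (coupling_measure \<mu>)"
proof -
  let ?E = "edges (lattice_cylinder x L H S n)"
  have comp: "(\<lambda>J. J e) \<in> borel_measurable (coupling_measure \<mu>)" if "e \<in> ?E" for e
  proof -
    have "e \<in> edges UNIV" using that edges_mono[OF subset_UNIV] by blast
    hence "(\<lambda>J. J e) \<in> measurable (coupling_measure \<mu>) \<mu>"
      unfolding coupling_measure_def by (rule measurable_component_singleton)
    from measurable_comp[OF this coupling_law_borel[OF \<mu>]] show ?thesis by (simp add: comp_def)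
  qed
  have "(\<lambda>J. rc_weight q \<beta> J ?E \<pi> \<omega>) \<in> borel_measurable (coupling_measure \<mu>)" for \<pi> \<omega>
    unfolding rc_weight_def edge_prob_def
  proof (intro borel_measurable_times borel_measurable_prod borel_measurable_const)
    fix e assume "e \<in> ?E"
    note [measurable] = comp[OF this]
    show "(\<lambda>J. if e \<in> \<omega> then 1 - exp (- \<beta> * J e) else 1 - (1 - exp (- \<beta> * J e)))
        \<in> borel_measurable (coupling_measure \<mu>)"
      by (cases "e \<in> \<omega>") simp_all
  qed
  thus ?thesis unfolding surface_tension_def Let_def rc_prob_def
    by (intro borel_measurable_times borel_measurable_const borel_measurable_ln borel_measurable_divide
        borel_measurable_sum)
qed

lemma coupling_measure_cylinder:
  fixes F :: "(int ^ 'd) set set"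
  assumes \<mu>: "coupling_law \<mu>" and F: "finite F" "F \<subseteq> edges UNIV" and A: "A \<in> sets \<mu>"
  shows "measure (coupling_measure \<mu>) {J \<in> space (coupling_measure \<mu>). \<forall>e\<in>F. J e \<in> A} = measure \<mu> A ^ card F"
proof -
  interpret prob_space \<mu> using \<mu> by (simp add: coupling_law_def)
  interpret product_prob_space "\<lambda>_. \<mu>" "edges UNIV :: (int ^ 'd) set set" ..
  have "prod_emb (edges UNIV) (\<lambda>_. \<mu>) F (Pi\<^sub>E F (\<lambda>_. A))
      = {J \<in> space (coupling_measure \<mu>). \<forall>e\<in>F. J e \<in> A}"
    using F by (auto simp: prod_emb_def coupling_measure_def space_PiM PiE_iff extensional_def)
  moreover have "measure (PiM (edges UNIV) (\<lambda>_. \<mu>)) (prod_emb (edges UNIV) (\<lambda>_. \<mu>) F (Pi\<^sub>E F (\<lambda>_. A)))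
      = (\<Prod>e\<in>F. measure \<mu> A)"
    using F A by (intro measure_PiM_emb) auto
  ultimately show ?thesis by (simp add: coupling_measure_def)
qed

text \<open>
  If all couplings on the flat cut are below \<open>J_min \<mu> + \<epsilon>\<close>, then closing the flat cut already forces
  the surface tension below \<open>t\<close> in large cylinders. By independence this has the probability \<open>p\<close> to the power of the
  size of the flat cut, where \<open>p > 0\<close> does not depend on \<open>\<beta>\<close>.
\<close>
lemma rate_function_le:
  fixes n :: "real ^ 'd" and q \<beta> t t_min \<epsilon> :: real
  assumes \<mu>: "coupling_law \<mu>" and q: "q \<ge> 1" and \<beta>: "\<beta> \<ge> 0" and S: "S \<in> unit_cubes n" and \<epsilon>: "\<epsilon> > 0"
    and I: "is_rate_function q \<beta> \<mu> n t_min I"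
    and t: "t > t_min" "t > \<beta> * (J_min \<mu> + \<epsilon>) * norm1 n"
  shows "I t \<le> ereal (norm1 n * - ln (measure \<mu> {x \<in> space \<mu>. x < J_min \<mu> + \<epsilon>}))"
proof -
  let ?d = "CARD('d)" and ?M = "coupling_measure \<mu> :: ((int ^ 'd) set \<Rightarrow> real) measure"
  define A where "A = {x \<in> space \<mu>. x < J_min \<mu> + \<epsilon>}"
  define p where "p = measure \<mu> A"
  define V where "V = (\<lambda>N::nat. lattice_cylinder 0 (1 * real N) (1 * real N) S n)"
  define K where "K = (\<lambda>N. card (flat_cut n (V N)))"
  define B where "B = (\<lambda>N::nat. {J \<in> space ?M. surface_tension q \<beta> J 0 (real N) (1 * real N) S n \<le> t})"
  interpret prob_space \<mu> using \<mu> by (simp add: coupling_law_def)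
  interpret M: prob_space ?M
    unfolding coupling_measure_def by (rule prob_space_PiM) (rule prob_space_axioms)
  have p: "p > 0" "p \<le> 1" using J_min_approx[OF \<mu> \<epsilon>] prob_le_1 by (auto simp: p_def A_def)
  have A: "A \<in> sets \<mu>" unfolding A_def using coupling_law_borel[OF \<mu>] by measurable
  have lim_I: "(\<lambda>N. neg_log (measure ?M (B N)) / ereal (real N ^ (?d - 1))) \<longlonglongrightarrow> I t"
    using I S t(1) zero_less_one unfolding is_rate_function_def B_def by blast
  have K_lim: "(\<lambda>N. K N / real N ^ (?d - 1)) \<longlonglongrightarrow> norm1 n"
    using card_flat_cut_asymp[OF S, of 1] by (simp add: K_def V_def)
  hence "(\<lambda>N. \<beta> * (J_min \<mu> + \<epsilon>) * (K N / real N ^ (?d - 1))) \<longlonglongrightarrow> \<beta> * (J_min \<mu> + \<epsilon>) * norm1 n"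
    by (intro tendsto_intros)
  hence ev: "\<forall>\<^sub>F N in sequentially. \<beta> * (J_min \<mu> + \<epsilon>) * (K N / real N ^ (?d - 1)) < t"
    using t(2) by (rule order_tendstoD(2))
  have "\<forall>\<^sub>F N in sequentially. neg_log (measure ?M (B N)) / ereal (real N ^ (?d - 1))
      \<le> ereal (K N / real N ^ (?d - 1) * - ln p)"
    using ev eventually_gt_at_top[of 0]
  proof eventually_elim
    case (elim N)
    hence N: "real N > 0" by simp
    have fin: "finite (V N)" using finite_lattice_cylinder[OF S N] by (simp add: V_def)
    have sub: "{J \<in> space ?M. \<forall>e\<in>flat_cut n (V N). J e \<in> A} \<subseteq> B N"
    proof
      fix J assume J: "J \<in> {J \<in> space ?M. \<forall>e\<in>flat_cut n (V N). J e \<in> A}"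
      have nonneg: "J e \<ge> 0" if "e \<in> edges UNIV" for e
      proof -
        have "J e \<in> space \<mu>" using J that by (auto simp: coupling_measure_def space_PiM PiE_iff)
        thus ?thesis using coupling_law_space[OF \<mu>] by simp
      qed
      have "surface_tension q \<beta> J 0 (real N) (1 * real N) S n
          \<le> \<beta> * (\<Sum>e\<in>flat_cut n (lattice_cylinder 0 (real N) (1 * real N) S n). J e) / real N ^ (?d - 1)"
        by (rule surface_tension_le[OF q \<beta> nonneg]) (use N fin in \<open>auto simp: V_def\<close>)
      also have "\<dots> = \<beta> * (\<Sum>e\<in>flat_cut n (V N). J e) / real N ^ (?d - 1)" by (simp add: V_def)
      also have "\<dots> \<le> \<beta> * (\<Sum>e\<in>flat_cut n (V N). J_min \<mu> + \<epsilon>) / real N ^ (?d - 1)"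
        using J \<beta> N by (intro divide_right_mono mult_left_mono sum_mono) (auto simp: A_def less_imp_le)
      also have "\<dots> = \<beta> * (J_min \<mu> + \<epsilon>) * (K N / real N ^ (?d - 1))" by (simp add: K_def)
      also have "\<dots> < t" by (rule elim(1))
      finally show "J \<in> B N" using J by (simp add: B_def)
    qed
    have "B N \<in> sets ?M"
      unfolding B_def using surface_tension_measurable[OF \<mu>] by measurable
    hence "measure ?M {J \<in> space ?M. \<forall>e\<in>flat_cut n (V N). J e \<in> A} \<le> measure ?M (B N)"
      by (rule M.finite_measure_mono[OF sub])
    moreover have F: "finite (flat_cut n (V N))" "flat_cut n (V N) \<subseteq> edges UNIV"
      using finite_subset[OF flat_cut_subset finite_edges[OF fin]] flat_cut_subset[of n "V N"]
        edges_mono[of "V N" UNIV] by auto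
    ultimately have le: "p ^ K N \<le> measure ?M (B N)"
      unfolding coupling_measure_cylinder[OF \<mu> F A] by (simp add: p_def K_def)
    have pos: "0 < p ^ K N" using p by simp
    have "neg_log (measure ?M (B N)) = ereal (- ln (measure ?M (B N)))"
      using le pos by (simp add: neg_log_def)
    also have "\<dots> \<le> ereal (K N * - ln p)"
    proof -
      have "ln (p ^ K N) \<le> ln (measure ?M (B N))" using le pos by (intro ln_mono) auto
      thus ?thesis using p by (simp add: ln_realpow)
    qed
    finally have "neg_log (measure ?M (B N)) / ereal (real N ^ (?d - 1)) \<le> ereal (K N * - ln p) / ereal (real N ^ (?d - 1))"
      using N by (intro ereal_divide_right_mono) auto
    thus ?case using N by simp
  qed
  moreover have "(\<lambda>N. ereal (K N / real N ^ (?d - 1) * - ln p)) \<longlonglongrightarrow> ereal (norm1 n * - ln p)"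
    by (intro tendsto_intros K_lim)
  ultimately show ?thesis
    unfolding p_def[unfolded A_def, symmetric] using tendsto_le[OF sequentially_bot _ lim_I] by blast
qed

text \<open>
  The value at the minimal surface tension is a limit of values to the right of it.
\<close>
lemma rate_function_nonneg:
  assumes "is_rate_function q \<beta> \<mu> n t_min I"
  shows "0 \<le> I t_min"
proof (rule tendsto_lowerbound)
  show "((\<lambda>\<epsilon>. I (t_min + \<epsilon>)) \<longlongrightarrow> I t_min) (at_right 0)"
    using assms by (simp add: is_rate_function_def)
  show "\<forall>\<^sub>F \<epsilon> in at_right 0. 0 \<le> I (t_min + \<epsilon>)"
    using assms unfolding is_rate_function_def
    by (auto intro!: eventually_at_right_less[THEN eventually_mono])
qed simp

text \<open>
  Below \<open>t_min\<close> the rate function is infinite and elsewhere it is nonnegative, so the infimum is at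
  least \<open>l * t_min\<close>; any point \<open>t\<close> gives an upper bound.
\<close>
lemma averaged_surface_tension_bounds:
  assumes I: "is_rate_function q \<beta> \<mu> n t_min I" and l: "l > 0" and t: "I t \<le> ereal b"
  shows "l * t_min \<le> averaged_surface_tension l I" "averaged_surface_tension l I \<le> l * t + b"
proof -
  define R where "R = (INF t. ereal (l * t) + I t)"
  have lower: "ereal (l * t_min) \<le> R"
    unfolding R_def
  proof (rule INF_greatest)
    fix u
    consider "u < t_min" | "u = t_min" | "u > t_min" by linarith
    thus "ereal (l * t_min) \<le> ereal (l * u) + I u"
    proof cases
      case 1
      hence "I u = \<infinity>" using I by (simp add: is_rate_function_def)
      thus ?thesis by simp
    next
      case 2
      have "ereal (l * t_min) + 0 \<le> ereal (l * t_min) + I t_min"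
        using rate_function_nonneg[OF I] by (intro add_left_mono)
      thus ?thesis using 2 by simp
    next
      case 3
      have "0 \<le> I u" using I 3 by (simp add: is_rate_function_def)
      moreover have "ereal (l * t_min) \<le> ereal (l * u)" using 3 l by simp
      ultimately have "ereal (l * t_min) + 0 \<le> ereal (l * u) + I u" by (rule add_mono[rotated])
      thus ?thesis by simp
    qed
  qed
  have "R \<le> ereal (l * t) + I t" unfolding R_def by (rule INF_lower) simp
  also have "\<dots> \<le> ereal (l * t) + ereal b" using t by (intro add_left_mono)
  finally have upper: "R \<le> ereal (l * t + b)" by simp
  obtain r where r: "R = ereal r" using lower upper by (cases R) auto
  have "averaged_surface_tension l I = r"
    unfolding averaged_surface_tension_def R_def[symmetric] r by simp
  thus "l * t_min \<le> averaged_surface_tension l I" "averaged_surface_tension l I \<le> l * t + b"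
    using lower upper r by auto
qed

section \<open>The limit of large inverse temperature\<close>

theorem proposition1p13:
  fixes q l :: real and \<mu> :: "real measure"
    and tau_min :: "real \<Rightarrow> real ^ 'd \<Rightarrow> real"
    and I :: "real \<Rightarrow> real ^ 'd \<Rightarrow> real \<Rightarrow> ereal"
  assumes "CARD('d) \<ge> 2" and "q \<ge> 1" and "l > 0"
    and "coupling_law \<mu>"
    and "\<And>\<beta> n. \<beta> \<ge> 0 \<Longrightarrow> n \<in> sphere 0 1 \<Longrightarrow> is_min_surface_tension q \<beta> \<mu> n (tau_min \<beta> n)"
    and "\<And>\<beta> n. \<beta> \<ge> 0 \<Longrightarrow> n \<in> sphere 0 1 \<Longrightarrow> is_rate_function q \<beta> \<mu> n (tau_min \<beta> n) (I \<beta> n)"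
  shows "uniform_limit (sphere 0 1)
           (\<lambda>\<beta> n. averaged_surface_tension l (I \<beta> n) / \<beta>)
           (\<lambda>n. l * J_min \<mu> * norm1 n)
           at_top"
proof (rule uniform_limitI)
  fix e :: real assume e: "e > 0"
  let ?d = "real CARD('d)"
  define j where "j = J_min \<mu>"
  define C where "C = peierls_const TYPE('d) q"
  \<comment> \<open>The excess \<open>\<epsilon>\<close> of the couplings over \<open>J_min\<close> is chosen such that it changes the limit by at
    most \<open>e / 2\<close>; \<open>norm1 n \<le> d\<close>, and one more \<open>\<epsilon>\<close> makes inequalities strict.\<close>
  define \<epsilon> where "\<epsilon> = e / (2 * l * (?d + 1))"
  define p where "p = measure \<mu> {x \<in> space \<mu>. x < j + \<epsilon>}"
  have l: "l > 0" by fact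
  have \<epsilon>: "\<epsilon> > 0" using e l by (simp add: \<epsilon>_def)
  have l\<epsilon>: "l * (\<epsilon> * (?d + 1)) = e / 2" 
  proof -
    have "?d + 1 \<noteq> 0" by (metis add_nonneg_pos of_nat_0_le_iff order_less_irrefl zero_less_one)
    thus ?thesis using l by (simp add: \<epsilon>_def divide_simps)
  qed
  have j: "j \<ge> 0" using J_min_nonneg assms(4) by (simp add: j_def)
  have "prob_space \<mu>" using assms(4) by (simp add: coupling_law_def)
  hence "p \<le> 1" by (simp add: p_def prob_space.prob_le_1)
  moreover have "p > 0" using J_min_approx[OF assms(4) \<epsilon>] by (simp add: p_def j_def)
  ultimately have lnp: "- ln p \<ge> 0" by simp
  have "\<forall>\<^sub>F \<beta> in at_top. \<beta> > 0 \<and> \<beta> > 2 * (?d * - ln p) / e \<and> \<beta> > l * C / e"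
    by (intro eventually_conj eventually_gt_at_top)
  thus "\<forall>\<^sub>F \<beta> in at_top. \<forall>n\<in>sphere 0 1.
      dist (averaged_surface_tension l (I \<beta> n) / \<beta>) (l * J_min \<mu> * norm1 n) < e"
  proof (rule eventually_mono, intro ballI)
    fix \<beta> :: real and n :: "real ^ 'd"
    assume b: "\<beta> > 0 \<and> \<beta> > 2 * (?d * - ln p) / e \<and> \<beta> > l * C / e" and n: "n \<in> sphere 0 1"
    hence \<beta>: "\<beta> > 0" "\<beta> \<ge> 0" and norm: "norm n = 1" by auto
    have b1: "?d * - ln p < \<beta> * (e / 2)" and b2: "l * C < \<beta> * e"
      using b e by (auto simp: divide_less_eq field_simps)
    obtain S where S: "S \<in> unit_cubes n" using unit_cubes_nonempty[OF norm] by blast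
    have lim: "(\<lambda>N::nat. surface_tension q \<beta> (\<lambda>_. j) 0 (real N) (1 * real N) S n) \<longlonglongrightarrow> tau_min \<beta> n"
      using assms(5)[OF \<beta>(2) n] S zero_less_one unfolding is_min_surface_tension_def j_def by blast
    note rate = assms(6)[OF \<beta>(2) n]
    have ge: "\<beta> * j * norm1 n - C \<le> tau_min \<beta> n"
      unfolding C_def by (rule min_surface_tension_ge[OF assms(1,2) \<beta>(2) j norm S lim])
    have le: "tau_min \<beta> n \<le> \<beta> * j * norm1 n"
      by (rule min_surface_tension_le[OF assms(2) \<beta>(2) j S lim])
    have n1: "0 \<le> norm1 n" "norm1 n \<le> ?d" using norm1_nonneg norm1_le[OF norm] by auto
    define t where "t = \<beta> * (j * norm1 n + \<epsilon> * (?d + 1))"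
    have t1: "t > tau_min \<beta> n"
    proof -
      have "0 < \<beta> * (\<epsilon> * (?d + 1))" using \<beta> \<epsilon> by simp
      thus ?thesis using le by (simp add: t_def algebra_simps)
    qed
    have t2: "t > \<beta> * (j + \<epsilon>) * norm1 n"
    proof -
      have "\<epsilon> * norm1 n < \<epsilon> * (?d + 1)" using n1 \<epsilon> by (intro mult_strict_left_mono) auto
      hence "\<beta> * ((j + \<epsilon>) * norm1 n) < t"
        unfolding t_def using \<beta> by (intro mult_strict_left_mono) (auto simp: algebra_simps)
      thus ?thesis by (simp add: mult.assoc)
    qed
    have "I \<beta> n t \<le> ereal (norm1 n * - ln p)"
      unfolding p_def j_def
      by (rule rate_function_le[OF assms(4,2) \<beta>(2) S \<epsilon> rate t1 t2[unfolded j_def]])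
    note bounds = averaged_surface_tension_bounds[OF rate l this]
    have "averaged_surface_tension l (I \<beta> n) \<le> l * t + ?d * - ln p"
      using bounds(2) mult_right_mono[OF n1(2) lnp] by linarith
    also have "\<dots> < l * t + \<beta> * (e / 2)" using b1 by simp
    also have "l * t = \<beta> * (l * j * norm1 n) + \<beta> * (l * (\<epsilon> * (?d + 1)))"
      by (simp add: t_def algebra_simps)
    finally have up: "averaged_surface_tension l (I \<beta> n) < \<beta> * (l * j * norm1 n + e)"
      unfolding l\<epsilon> by (simp add: algebra_simps)
    have "l * (\<beta> * j * norm1 n - C) \<le> averaged_surface_tension l (I \<beta> n)"
      using bounds(1) mult_left_mono[OF ge, of l] l by linarith
    hence lo: "\<beta> * (l * j * norm1 n - e) < averaged_surface_tension l (I \<beta> n)"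
      using b2 by (simp add: algebra_simps)
    have "averaged_surface_tension l (I \<beta> n) / \<beta> < l * j * norm1 n + e"
      using up \<beta> by (simp add: divide_less_eq mult.commute)
    moreover have "l * j * norm1 n - e < averaged_surface_tension l (I \<beta> n) / \<beta>"
      using lo \<beta> by (simp add: less_divide_eq mult.commute)
    ultimately show "dist (averaged_surface_tension l (I \<beta> n) / \<beta>) (l * J_min \<mu> * norm1 n) < e"
      unfolding dist_real_def j_def[symmetric] by linarith
  qed
qed

end
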